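(* Let $(X,\sigma_X)$ be a compact connected complex manifold with involution, let $(\mathcal{L},[\cdot,\cdot],\sharp,\sigma^{\mathcal{L}})$ be a smooth complex Lie algebroid on $X$ with real structure, and let $(E,\sigma^E)$ be a smooth real (respectively, quaternionic) complex vector bundle on $(X,\sigma_X)$. Let $\nabla,\nabla'\in A(E,\mathcal{L})^{\sigma}$ be two irreducible real (respectively, quaternionic) $\mathcal{L}$-connections. Then $\nabla$ and $\nabla'$ lie in the same $\mathrm{Gau}(E)$-orbit if and only if they lie in the same $\mathrm{Gau}(E)^{\sigma}$-orbit.
   Context: A complex Lie algebroid on a connected complex manifold $X$ is a smooth complex vector bundle $\mathcal{L}\to X$ with a Lie bracket $[\cdot,\cdot]$ on $\Gamma(X,\mathcal{L})$ and a vector bundle morphism (anchor) $\sharp:\mathcal{L}\to TX_{\mathbb{C}}$ over $\mathrm{id}_X$ such that $\sharp([s_1,s_2])=[\sharp(s_1),\sharp(s_2)]$ and $[s_1,fs_2]=f[s_1,s_2]+(\sharp(s_1)(f))s_2$. Write $\mathcal{A}^k_{\mathcal{L}}(X,E)=\Gamma(X,\Lambda^k\mathcal{L}^\star\otimes E)$ and $d_{\mathcal{L}}(f)(\xi)=\sharp(\xi)f$ for $f\in C^\infty(X)$ (complex-valued). An $\mathcal{L}$-connection on $E$ is a $\mathbb{C}$-linear map $\nabla:\mathcal{A}^0_{\mathcal{L}}(X,E)\to\mathcal{A}^1_{\mathcal{L}}(X,E)$ with $\nabla(fs)=d_{\mathcal{L}}(f)\otimes s+f\nabla(s)$. A complex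 manifold with involution $(X,\sigma_X)$ is a complex manifold with an anti-holomorphic map $\sigma_X$, $\sigma_X^2=\mathrm{id}_X$. A real (resp. quaternionic) vector bundle $(E,\sigma^E)$ is a complex vector bundle with a bundle automorphism $\sigma^E:E\to E$ over $\sigma_X$ that is $\mathbb{C}$-antilinear on fibres and satisfies $\sigma^E\circ\sigma^E=\mathrm{id}_E$ (resp. $-\mathrm{id}_E$). A real structure $\sigma^{\mathcal{L}}$ on $\mathcal{L}$ is a fibrewise $\mathbb{C}$-antilinear involution of $\mathcal{L}$ over $\sigma_X$ compatible with the bracket and with the anchor (with $TX_{\mathbb{C}}$ carrying the antilinear extension of $d\sigma_X$). The induced structure on $\mathcal{L}^\star\otimes E$ is $(\tilde\sigma\omega)(\xi)=\sigma^E(\omega(\sigma^{\mathcal{L}}\xi))$. For an endomorphism $\phi$ of $E$ put $\overline{\phi}=\sigma^E\circ\phi\circ(\sigma^E)^{-1}$, and for $\alpha\in\mathcal{A}^1_{\mathcal{L}}(X,\mathrm{End}(E))$ put $\overline{\alpha}(\xi)=\sigma^E\circ\alpha(\sigma^{\mathcal{L}}\xi)\circ(\sigma^E)^{-1}$. Fix a reference $\mathcal{L}$-connection $\nabla_0$ compatible with the structures, $\nabla_0(\sigma^E\circ s\circ\sigma_X)=\tilde\sigma\circ\nabla_0(s)\circ\sigma_X$; for $\nabla=\nabla_0+\alpha$ put $\overline{\nabla}=\nabla_0+\overline{\alpha}$. Then $A(E,\mathcal{L})^{\sigma}$ is the set of $\mathcal{L}$-connections with $\overline{\nabla}=\nabla$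 (real, resp. quaternionic, $\mathcal{L}$-connections). $\mathrm{Gau}(E)$ is the group of smooth vector bundle automorphisms of $E$ over $\mathrm{id}_X$, acting on $\mathcal{L}$-connections by $\phi\odot\nabla=\nabla^\phi$, $\nabla^\phi(s)=(\mathrm{id}_{\mathcal{L}^\star}\otimes\phi^{-1})(\nabla(\phi(s)))$. $\mathrm{Gau}(E)^{\sigma}=\{\phi\in\mathrm{Gau}(E)\mid\overline{\phi}=\phi\}$. A real (resp. quaternionic) $\mathcal{L}$-connection $\nabla$ is irreducible if $\{\phi\in\mathrm{Gau}(E)^{\sigma}\mid\phi\odot\nabla=\nabla\}=\mathbb{R}^\star\cdot\mathrm{id}_E$. *)

theory Defs
  imports "HOL-Analysis.Analysis"
begin

section \<open>Smooth and holomorphic functions on open subsets of complex coordinate space\<close>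

text \<open>
  \<open>\<complex>\<^sup>n\<close>, for an arbitrary \<open>n \<ge> 0\<close>, is the set of sequences vanishing from index \<open>n\<close> on. The
  product topology of \<^typ>\<open>nat \<Rightarrow> complex\<close> induces the usual topology on it.
\<close>

definition coord_space :: "nat \<Rightarrow> (nat \<Rightarrow> complex) set" where
  "coord_space n = {z. \<forall>i\<ge>n. z i = 0}"

definition unit_coord :: "nat \<Rightarrow> nat \<Rightarrow> complex" where
  "unit_coord j = (\<lambda>i. if i = j then 1 else 0)"

text \<open>
  With \<open>z\<^sub>i = x\<^sub>i + \<i> y\<^sub>i\<close>, the curve below differentiates along \<open>\<partial>/\<partial>x\<^sub>i\<close> for \<open>c = 1\<close> and along
  \<open>\<partial>/\<partial>y\<^sub>i\<close> for \<open>c = \<i>\<close>.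
\<close>

definition coord_line ::
  "((nat \<Rightarrow> complex) \<Rightarrow> complex) \<Rightarrow> complex \<Rightarrow> nat \<Rightarrow> (nat \<Rightarrow> complex) \<Rightarrow> real \<Rightarrow> complex" where
  "coord_line f c i z = (\<lambda>t. f (z(i := z i + of_real t * c)))"

definition real_partial ::
  "complex \<Rightarrow> nat \<Rightarrow> ((nat \<Rightarrow> complex) \<Rightarrow> complex) \<Rightarrow> (nat \<Rightarrow> complex) \<Rightarrow> complex" where
  "real_partial c i f z = vector_derivative (coord_line f c i z) (at 0)"

primrec C_k_on ::
  "nat \<Rightarrow> nat \<Rightarrow> (nat \<Rightarrow> complex) set \<Rightarrow> ((nat \<Rightarrow> complex) \<Rightarrow> complex) \<Rightarrow> bool" where
  "C_k_on n 0 W f \<longleftrightarrow> continuous_on W f"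
| "C_k_on n (Suc k) W f \<longleftrightarrow> continuous_on W f \<and>
     (\<forall>i<n. \<forall>c\<in>{1, \<i>}.
        (\<forall>z\<in>W. coord_line f c i z differentiable (at 0)) \<and> C_k_on n k W (real_partial c i f))"

definition smooth_coord ::
  "nat \<Rightarrow> (nat \<Rightarrow> complex) set \<Rightarrow> ((nat \<Rightarrow> complex) \<Rightarrow> complex) \<Rightarrow> bool" where
  "smooth_coord n W f \<longleftrightarrow> (\<forall>k. C_k_on n k W f)"

definition holomorphic_coord ::
  "nat \<Rightarrow> (nat \<Rightarrow> complex) set \<Rightarrow> ((nat \<Rightarrow> complex) \<Rightarrow> complex) \<Rightarrow> bool" where
  "holomorphic_coord n W f \<longleftrightarrow> smooth_coord n W f \<and>
     (\<forall>z\<in>W. \<forall>i<n. (\<lambda>w. f (z(i := w))) field_differentiable (at (z i)))"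


section \<open>Complex manifolds with involution\<close>

text \<open>
  The underlying topological space is the whole type \<open>'x\<close>; Hausdorffness and second countability
  come from its type class.
\<close>

record 'x cmanifold =
  cdim :: nat
  charts :: "('x set \<times> ('x \<Rightarrow> nat \<Rightarrow> complex)) set"

definition complex_manifold ::
  "'x::{t2_space, second_countable_topology} cmanifold \<Rightarrow> bool" where
  "complex_manifold M \<longleftrightarrow>
     (\<Union>(U, \<phi>)\<in>charts M. U) = UNIV \<and>
     (\<forall>(U, \<phi>)\<in>charts M.
        open U \<and> openin (top_of_set (coord_space (cdim M))) (\<phi> ` U) \<and>
        homeomorphism U (\<phi> ` U) \<phi> (inv_into U \<phi>)) \<and>
     (\<forall>(U, \<phi>)\<in>charts M. \<forall>(V, \<psi>)\<in>charts M. \<forall>i<cdim M.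
        holomorphic_coord (cdim M) (\<phi> ` (U \<inter> V)) (\<lambda>z. \<psi> (inv_into U \<phi> z) i))"

definition smooth_on_mfd :: "'x cmanifold \<Rightarrow> 'x set \<Rightarrow> ('x \<Rightarrow> complex) \<Rightarrow> bool" where
  "smooth_on_mfd M V f \<longleftrightarrow>
     (\<forall>(U, \<phi>)\<in>charts M. smooth_coord (cdim M) (\<phi> ` (U \<inter> V)) (\<lambda>z. f (inv_into U \<phi> z)))"

definition smooth_funs :: "'x cmanifold \<Rightarrow> ('x \<Rightarrow> complex) set" where
  "smooth_funs M = {f. smooth_on_mfd M UNIV f}"

definition antiholomorphic ::
  "'x::topological_space cmanifold \<Rightarrow> ('x \<Rightarrow> 'x) \<Rightarrow> bool" where
  "antiholomorphic M g \<longleftrightarrow> continuous_on UNIV g \<and>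
     (\<forall>(U, \<phi>)\<in>charts M. \<forall>(V, \<psi>)\<in>charts M. \<forall>i<cdim M.
        holomorphic_coord (cdim M) (\<phi> ` (U \<inter> g -` V)) (\<lambda>z. cnj (\<psi> (g (inv_into U \<phi> z)) i)))"

definition manifold_involution ::
  "'x::topological_space cmanifold \<Rightarrow> ('x \<Rightarrow> 'x) \<Rightarrow> bool" where
  "manifold_involution M \<sigma>X \<longleftrightarrow> antiholomorphic M \<sigma>X \<and> (\<forall>x. \<sigma>X (\<sigma>X x) = x)"


section \<open>Smooth complex vector bundles\<close>

text \<open>
  A local trivialization is a pair \<open>(U, \<tau>)\<close>, where \<open>\<tau>\<close> is the second component of a
  diffeomorphism from the part of the total space over \<open>U\<close> onto \<open>U \<times> \<complex>\<^sup>r\<close>; the smooth structure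
  of the total space is the one given by these.
\<close>

record ('e, 'x) cvbundle =
  total :: "'e set"
  bproj :: "'e \<Rightarrow> 'x"
  vzero :: "'x \<Rightarrow> 'e"
  vadd :: "'e \<Rightarrow> 'e \<Rightarrow> 'e"
  vscale :: "complex \<Rightarrow> 'e \<Rightarrow> 'e"
  brank :: nat
  trivs :: "('x set \<times> ('e \<Rightarrow> nat \<Rightarrow> complex)) set"

definition fibre :: "('e, 'x, 'm) cvbundle_scheme \<Rightarrow> 'x \<Rightarrow> 'e set" where
  "fibre B x = {e \<in> total B. bproj B e = x}"

definition frame ::
  "('e, 'x, 'm) cvbundle_scheme \<Rightarrow> ('e \<Rightarrow> nat \<Rightarrow> complex) \<Rightarrow> nat \<Rightarrow> 'x \<Rightarrow> 'e" where
  "frame B \<tau> j x = inv_into (fibre B x) \<tau> (unit_coord j)"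

text \<open>
  The vector space axioms of the fibres need not be listed: they are transported from \<open>\<complex>\<^sup>r\<close>
  along the trivializations. Smoothness of a transition map is smoothness of its matrix.
\<close>

definition smooth_bundle ::
  "'x::topological_space cmanifold \<Rightarrow> ('e, 'x, 'm) cvbundle_scheme \<Rightarrow> bool" where
  "smooth_bundle M B \<longleftrightarrow>
     (\<forall>x. vzero B x \<in> fibre B x) \<and>
     (\<forall>x. \<forall>u\<in>fibre B x. \<forall>v\<in>fibre B x. vadd B u v \<in> fibre B x) \<and>
     (\<forall>x. \<forall>c. \<forall>u\<in>fibre B x. vscale B c u \<in> fibre B x) \<and>
     (\<Union>(U, \<tau>)\<in>trivs B. U) = UNIV \<and>
     (\<forall>(U, \<tau>)\<in>trivs B. open U \<and>
        (\<forall>x\<in>U. bij_betw \<tau> (fibre B x) (coord_space (brank B)) \<and>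
           \<tau> (vzero B x) = (\<lambda>i. 0) \<and>
           (\<forall>u\<in>fibre B x. \<forall>v\<in>fibre B x. \<tau> (vadd B u v) = (\<lambda>i. \<tau> u i + \<tau> v i)) \<and>
           (\<forall>c. \<forall>u\<in>fibre B x. \<tau> (vscale B c u) = (\<lambda>i. c * \<tau> u i)))) \<and>
     (\<forall>(U, \<tau>)\<in>trivs B. \<forall>(V, \<rho>)\<in>trivs B. \<forall>j<brank B. \<forall>i<brank B.
        smooth_on_mfd M (U \<inter> V) (\<lambda>x. \<rho> (frame B \<tau> j x) i))"

definition sections ::
  "'x cmanifold \<Rightarrow> ('e, 'x, 'm) cvbundle_scheme \<Rightarrow> ('x \<Rightarrow> 'e) set" where
  "sections M B = {s. (\<forall>x. s x \<in> fibre B x) \<and>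
     (\<forall>(U, \<tau>)\<in>trivs B. \<forall>i<brank B. smooth_on_mfd M U (\<lambda>x. \<tau> (s x) i))}"

definition sec_add ::
  "('e, 'x, 'm) cvbundle_scheme \<Rightarrow> ('x \<Rightarrow> 'e) \<Rightarrow> ('x \<Rightarrow> 'e) \<Rightarrow> 'x \<Rightarrow> 'e" where
  "sec_add B s t = (\<lambda>x. vadd B (s x) (t x))"

definition sec_scale ::
  "('e, 'x, 'm) cvbundle_scheme \<Rightarrow> ('x \<Rightarrow> complex) \<Rightarrow> ('x \<Rightarrow> 'e) \<Rightarrow> 'x \<Rightarrow> 'e" where
  "sec_scale B f s = (\<lambda>x. vscale B (f x) (s x))"

text \<open>
  Smoothness of a fibrewise \<open>\<complex>\<close>-linear or \<open>\<complex>\<close>-antilinear map over \<open>g\<close>, again through the entries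
  of its matrices.
\<close>

definition smooth_fibre_map ::
  "'x cmanifold \<Rightarrow> ('e, 'x, 'm) cvbundle_scheme \<Rightarrow> ('f, 'x, 'k) cvbundle_scheme \<Rightarrow>
     ('x \<Rightarrow> 'x) \<Rightarrow> ('e \<Rightarrow> 'f) \<Rightarrow> bool" where
  "smooth_fibre_map M B C g F \<longleftrightarrow>
     (\<forall>(U, \<tau>)\<in>trivs B. \<forall>(V, \<rho>)\<in>trivs C. \<forall>j<brank B. \<forall>i<brank C.
        smooth_on_mfd M (U \<inter> g -` V) (\<lambda>x. \<rho> (F (frame B \<tau> j x)) i))"

text \<open>Maps out of a total space are extensional, so that equality of such maps is \<open>=\<close>.\<close>

definition bundle_hom ::
  "'x cmanifold \<Rightarrow> ('e, 'x, 'm) cvbundle_scheme \<Rightarrow> ('f, 'x, 'k) cvbundle_scheme \<Rightarrow>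
     ('e \<Rightarrow> 'f) set" where
  "bundle_hom M B C = {F \<in> total B \<rightarrow>\<^sub>E total C.
     (\<forall>e\<in>total B. bproj C (F e) = bproj B e) \<and>
     (\<forall>x. \<forall>u\<in>fibre B x. \<forall>v\<in>fibre B x. F (vadd B u v) = vadd C (F u) (F v)) \<and>
     (\<forall>c. \<forall>u\<in>total B. F (vscale B c u) = vscale C c (F u)) \<and>
     smooth_fibre_map M B C (\<lambda>x. x) F}"

definition antilinear_bundle_map ::
  "'x cmanifold \<Rightarrow> ('x \<Rightarrow> 'x) \<Rightarrow> ('e, 'x, 'm) cvbundle_scheme \<Rightarrow> ('e \<Rightarrow> 'e) \<Rightarrow> bool" where
  "antilinear_bundle_map M g B F \<longleftrightarrow>
     F \<in> total B \<rightarrow> total B \<and>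
     (\<forall>e\<in>total B. bproj B (F e) = g (bproj B e)) \<and>
     (\<forall>x. \<forall>u\<in>fibre B x. \<forall>v\<in>fibre B x. F (vadd B u v) = vadd B (F u) (F v)) \<and>
     (\<forall>c. \<forall>u\<in>total B. F (vscale B c u) = vscale B (cnj c) (F u)) \<and>
     smooth_fibre_map M B B g F"

definition real_structure ::
  "'x cmanifold \<Rightarrow> ('x \<Rightarrow> 'x) \<Rightarrow> ('e, 'x, 'm) cvbundle_scheme \<Rightarrow> ('e \<Rightarrow> 'e) \<Rightarrow> bool" where
  "real_structure M \<sigma>X E \<sigma>E \<longleftrightarrow>
     antilinear_bundle_map M \<sigma>X E \<sigma>E \<and> (\<forall>e\<in>total E. \<sigma>E (\<sigma>E e) = e)"

definition quaternionic_structure ::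
  "'x cmanifold \<Rightarrow> ('x \<Rightarrow> 'x) \<Rightarrow> ('e, 'x, 'm) cvbundle_scheme \<Rightarrow> ('e \<Rightarrow> 'e) \<Rightarrow> bool" where
  "quaternionic_structure M \<sigma>X E \<sigma>E \<longleftrightarrow>
     antilinear_bundle_map M \<sigma>X E \<sigma>E \<and> (\<forall>e\<in>total E. \<sigma>E (\<sigma>E e) = vscale E (-1) e)"

text \<open>
  The bundle \<open>End(E)\<close>: the endomorphism with matrix \<open>(T\<^sub>a\<^sub>b)\<close> has coordinate \<open>T\<^sub>a\<^sub>b\<close> at index
  \<open>a r + b\<close>.
\<close>

definition fibre_end :: "('e, 'x, 'm) cvbundle_scheme \<Rightarrow> 'x \<Rightarrow> ('e \<Rightarrow> 'e) set" where
  "fibre_end E x = {T \<in> fibre E x \<rightarrow>\<^sub>E fibre E x.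
     (\<forall>u\<in>fibre E x. \<forall>v\<in>fibre E x. T (vadd E u v) = vadd E (T u) (T v)) \<and>
     (\<forall>c. \<forall>u\<in>fibre E x. T (vscale E c u) = vscale E c (T u))}"

definition End_bundle ::
  "('e, 'x, 'm) cvbundle_scheme \<Rightarrow> ('x \<times> ('e \<Rightarrow> 'e), 'x) cvbundle" where
  "End_bundle E = \<lparr>
     total = {(x, T). T \<in> fibre_end E x},
     bproj = fst,
     vzero = (\<lambda>x. (x, \<lambda>e\<in>fibre E x. vzero E x)),
     vadd = (\<lambda>(x, S) (y, T). (x, \<lambda>e\<in>fibre E x. vadd E (S e) (T e))),
     vscale = (\<lambda>c (x, T). (x, \<lambda>e\<in>fibre E x. vscale E c (T e))),
     brank = brank E * brank E,
     trivs = (\<lambda>(U, \<tau>). (U, \<lambda>(x, T) k. if k < brank E * brank E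
                then \<tau> (T (frame E \<tau> (k mod brank E) x)) (k div brank E) else 0)) ` trivs E\<rparr>"


section \<open>The complexified tangent bundle\<close>

text \<open>
  The fibre of \<open>TX\<^sub>\<complex>\<close> at \<open>x\<close> consists of the \<open>\<complex>\<close>-linear derivations at \<open>x\<close> of the algebra of
  complex-valued smooth functions.
\<close>

definition derivations_at ::
  "'x cmanifold \<Rightarrow> 'x \<Rightarrow> (('x \<Rightarrow> complex) \<Rightarrow> complex) set" where
  "derivations_at M x = {v \<in> extensional (smooth_funs M).
     (\<forall>f\<in>smooth_funs M. \<forall>g\<in>smooth_funs M. v (\<lambda>y. f y + g y) = v f + v g) \<and>
     (\<forall>c. \<forall>f\<in>smooth_funs M. v (\<lambda>y. c * f y) = c * v f) \<and>
     (\<forall>f\<in>smooth_funs M. \<forall>g\<in>smooth_funs M. v (\<lambda>y. f y * g y) = f x * v g + g x * v f)}"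

text \<open>A derivation is local, hence acts on functions that are only defined and smooth near \<open>x\<close>.\<close>

definition germ_apply ::
  "'x::topological_space cmanifold \<Rightarrow> 'x \<Rightarrow> (('x \<Rightarrow> complex) \<Rightarrow> complex) \<Rightarrow> ('x \<Rightarrow> complex) \<Rightarrow>
     complex" where
  "germ_apply M x v f = v (SOME g. g \<in> smooth_funs M \<and> eventually (\<lambda>y. g y = f y) (nhds x))"

text \<open>
  Over a chart with coordinates \<open>z\<^sub>0, \<dots>, z\<^sub>n\<^sub>-\<^sub>1\<close> the trivialization is
  \<open>(dz\<^sub>0, \<dots>, dz\<^sub>n\<^sub>-\<^sub>1, d(cnj z\<^sub>0), \<dots>, d(cnj z\<^sub>n\<^sub>-\<^sub>1))\<close>.
\<close>

definition TXC ::
  "'x::topological_space cmanifold \<Rightarrow> ('x \<times> (('x \<Rightarrow> complex) \<Rightarrow> complex), 'x) cvbundle" where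
  "TXC M = \<lparr>
     total = {(x, v). v \<in> derivations_at M x},
     bproj = fst,
     vzero = (\<lambda>x. (x, \<lambda>f\<in>smooth_funs M. 0)),
     vadd = (\<lambda>(x, v) (y, w). (x, \<lambda>f\<in>smooth_funs M. v f + w f)),
     vscale = (\<lambda>c (x, v). (x, \<lambda>f\<in>smooth_funs M. c * v f)),
     brank = 2 * cdim M,
     trivs = (\<lambda>(U, \<phi>). (U, \<lambda>(x, v) k.
                if k < cdim M then germ_apply M x v (\<lambda>y. \<phi> y k)
                else if k < 2 * cdim M then germ_apply M x v (\<lambda>y. cnj (\<phi> y (k - cdim M)))
                else 0)) ` charts M\<rparr>"

definition vf_bracket ::
  "'x cmanifold \<Rightarrow> ('x \<Rightarrow> 'x \<times> (('x \<Rightarrow> complex) \<Rightarrow> complex)) \<Rightarrow>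
     ('x \<Rightarrow> 'x \<times> (('x \<Rightarrow> complex) \<Rightarrow> complex)) \<Rightarrow> 'x \<Rightarrow> 'x \<times> (('x \<Rightarrow> complex) \<Rightarrow> complex)" where
  "vf_bracket M V W = (\<lambda>x. (x, \<lambda>f\<in>smooth_funs M.
     snd (V x) (\<lambda>y. snd (W y) f) - snd (W x) (\<lambda>y. snd (V y) f)))"

text \<open>
  The antilinear extension of \<open>d\<sigma>\<^sub>X\<close>: a real tangent vector \<open>v\<close> and \<open>c \<in> \<complex>\<close> satisfy
  \<open>v (cnj \<circ> f) = cnj (v f)\<close>, so \<open>c v\<close> is sent to \<open>f \<mapsto> cnj c * v (f \<circ> \<sigma>\<^sub>X)\<close>.
\<close>

definition tangent_conj ::
  "'x cmanifold \<Rightarrow> ('x \<Rightarrow> 'x) \<Rightarrow> 'x \<times> (('x \<Rightarrow> complex) \<Rightarrow> complex) \<Rightarrow>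
     'x \<times> (('x \<Rightarrow> complex) \<Rightarrow> complex)" where
  "tangent_conj M \<sigma>X = (\<lambda>(x, v). (\<sigma>X x, \<lambda>f\<in>smooth_funs M. cnj (v (\<lambda>y. cnj (f (\<sigma>X y))))))"


section \<open>Complex Lie algebroids\<close>

record ('l, 'x) lie_algebroid_data = "('l, 'x) cvbundle" +
  lbracket :: "('x \<Rightarrow> 'l) \<Rightarrow> ('x \<Rightarrow> 'l) \<Rightarrow> 'x \<Rightarrow> 'l"
  anchor :: "'l \<Rightarrow> 'x \<times> (('x \<Rightarrow> complex) \<Rightarrow> complex)"

definition lie_algebroid ::
  "'x::topological_space cmanifold \<Rightarrow> ('l, 'x) lie_algebroid_data \<Rightarrow> bool" where
  "lie_algebroid M L \<longleftrightarrow>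
     smooth_bundle M L \<and>
     anchor L \<in> bundle_hom M L (TXC M) \<and>
     (\<forall>s\<in>sections M L. \<forall>t\<in>sections M L. lbracket L s t \<in> sections M L) \<and>
     (\<forall>s\<in>sections M L. \<forall>t\<in>sections M L. \<forall>u\<in>sections M L.
        lbracket L (sec_add L s t) u = sec_add L (lbracket L s u) (lbracket L t u)) \<and>
     (\<forall>c. \<forall>s\<in>sections M L. \<forall>t\<in>sections M L.
        lbracket L (sec_scale L (\<lambda>x. c) s) t = sec_scale L (\<lambda>x. c) (lbracket L s t)) \<and>
     (\<forall>s\<in>sections M L. \<forall>t\<in>sections M L.
        lbracket L s t = sec_scale L (\<lambda>x. -1) (lbracket L t s)) \<and>
     (\<forall>s\<in>sections M L. \<forall>t\<in>sections M L. \<forall>u\<in>sections M L.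
        sec_add L (lbracket L s (lbracket L t u))
          (sec_add L (lbracket L t (lbracket L u s)) (lbracket L u (lbracket L s t))) = vzero L) \<and>
     (\<forall>s\<in>sections M L. \<forall>t\<in>sections M L.
        (\<lambda>x. anchor L (lbracket L s t x)) =
          vf_bracket M (\<lambda>x. anchor L (s x)) (\<lambda>x. anchor L (t x))) \<and>
     (\<forall>f\<in>smooth_funs M. \<forall>s\<in>sections M L. \<forall>t\<in>sections M L.
        lbracket L s (sec_scale L f t) =
          sec_add L (sec_scale L f (lbracket L s t))
            (sec_scale L (\<lambda>x. snd (anchor L (s x)) f) t))"

definition lie_algebroid_real_structure ::
  "'x cmanifold \<Rightarrow> ('x \<Rightarrow> 'x) \<Rightarrow> ('l, 'x) lie_algebroid_data \<Rightarrow> ('l \<Rightarrow> 'l) \<Rightarrow> bool" where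
  "lie_algebroid_real_structure M \<sigma>X L \<sigma>L \<longleftrightarrow>
     real_structure M \<sigma>X L \<sigma>L \<and>
     (\<forall>s\<in>sections M L. \<forall>t\<in>sections M L.
        lbracket L (\<sigma>L \<circ> s \<circ> \<sigma>X) (\<sigma>L \<circ> t \<circ> \<sigma>X) = \<sigma>L \<circ> lbracket L s t \<circ> \<sigma>X) \<and>
     (\<forall>\<xi>\<in>total L. anchor L (\<sigma>L \<xi>) = tangent_conj M \<sigma>X (anchor L \<xi>))"


section \<open>Connections along a Lie algebroid\<close>

text \<open>
  For a bundle \<open>F\<close>, sections of \<open>L\<^sup>\<star> \<otimes> F\<close> are treated as vector bundle morphisms \<open>L \<rightarrow> F\<close>.
\<close>

definition one_forms ::
  "'x cmanifold \<Rightarrow> ('l, 'x) lie_algebroid_data \<Rightarrow> ('f, 'x) cvbundle \<Rightarrow> ('l \<Rightarrow> 'f) set" where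
  "one_forms M L F = bundle_hom M L F"

definition form_add ::
  "('l, 'x) lie_algebroid_data \<Rightarrow> ('f, 'x) cvbundle \<Rightarrow> ('l \<Rightarrow> 'f) \<Rightarrow> ('l \<Rightarrow> 'f) \<Rightarrow> 'l \<Rightarrow> 'f" where
  "form_add L F \<omega> \<eta> = (\<lambda>\<xi>\<in>total L. vadd F (\<omega> \<xi>) (\<eta> \<xi>))"

definition form_scale ::
  "('l, 'x) lie_algebroid_data \<Rightarrow> ('f, 'x) cvbundle \<Rightarrow> ('x \<Rightarrow> complex) \<Rightarrow> ('l \<Rightarrow> 'f) \<Rightarrow> 'l \<Rightarrow> 'f" where
  "form_scale L F f \<omega> = (\<lambda>\<xi>\<in>total L. vscale F (f (bproj L \<xi>)) (\<omega> \<xi>))"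

definition dL :: "('l, 'x) lie_algebroid_data \<Rightarrow> ('x \<Rightarrow> complex) \<Rightarrow> 'l \<Rightarrow> complex" where
  "dL L f \<xi> = snd (anchor L \<xi>) f"

definition form_tensor ::
  "('l, 'x) lie_algebroid_data \<Rightarrow> ('e, 'x) cvbundle \<Rightarrow> ('l \<Rightarrow> complex) \<Rightarrow> ('x \<Rightarrow> 'e) \<Rightarrow> 'l \<Rightarrow> 'e" where
  "form_tensor L E \<theta> s = (\<lambda>\<xi>\<in>total L. vscale E (\<theta> \<xi>) (s (bproj L \<xi>)))"

definition connections ::
  "'x cmanifold \<Rightarrow> ('l, 'x) lie_algebroid_data \<Rightarrow> ('e, 'x) cvbundle \<Rightarrow>
     (('x \<Rightarrow> 'e) \<Rightarrow> 'l \<Rightarrow> 'e) set" where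
  "connections M L E = {D \<in> sections M E \<rightarrow>\<^sub>E one_forms M L E.
     (\<forall>s\<in>sections M E. \<forall>t\<in>sections M E. D (sec_add E s t) = form_add L E (D s) (D t)) \<and>
     (\<forall>c. \<forall>s\<in>sections M E. D (sec_scale E (\<lambda>x. c) s) = form_scale L E (\<lambda>x. c) (D s)) \<and>
     (\<forall>f\<in>smooth_funs M. \<forall>s\<in>sections M E.
        D (sec_scale E f s) =
          form_add L E (form_tensor L E (dL L f) s) (form_scale L E f (D s)))}"

text \<open>The structure on \<open>L\<^sup>\<star> \<otimes> E\<close>; for sections this is \<open>\<omega> \<mapsto> \<sigma>\<^sup>~ \<circ> \<omega> \<circ> \<sigma>\<^sub>X\<close>.\<close>

definition form_conj ::
  "('l, 'x) lie_algebroid_data \<Rightarrow> ('l \<Rightarrow> 'l) \<Rightarrow> ('e \<Rightarrow> 'e) \<Rightarrow> ('l \<Rightarrow> 'e) \<Rightarrow> 'l \<Rightarrow> 'e" where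
  "form_conj L \<sigma>L \<sigma>E \<omega> = (\<lambda>\<xi>\<in>total L. \<sigma>E (\<omega> (\<sigma>L \<xi>)))"

definition compatible_connection ::
  "'x cmanifold \<Rightarrow> ('x \<Rightarrow> 'x) \<Rightarrow> ('l, 'x) lie_algebroid_data \<Rightarrow> ('l \<Rightarrow> 'l) \<Rightarrow>
     ('e, 'x) cvbundle \<Rightarrow> ('e \<Rightarrow> 'e) \<Rightarrow> (('x \<Rightarrow> 'e) \<Rightarrow> 'l \<Rightarrow> 'e) \<Rightarrow> bool" where
  "compatible_connection M \<sigma>X L \<sigma>L E \<sigma>E D \<longleftrightarrow> D \<in> connections M L E \<and>
     (\<forall>s\<in>sections M E. D (\<sigma>E \<circ> s \<circ> \<sigma>X) = form_conj L \<sigma>L \<sigma>E (D s))"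

definition connection_plus ::
  "'x cmanifold \<Rightarrow> ('l, 'x) lie_algebroid_data \<Rightarrow> ('e, 'x) cvbundle \<Rightarrow>
     (('x \<Rightarrow> 'e) \<Rightarrow> 'l \<Rightarrow> 'e) \<Rightarrow> ('l \<Rightarrow> 'x \<times> ('e \<Rightarrow> 'e)) \<Rightarrow> ('x \<Rightarrow> 'e) \<Rightarrow> 'l \<Rightarrow> 'e" where
  "connection_plus M L E D \<alpha> = (\<lambda>s\<in>sections M E.
     form_add L E (D s) (\<lambda>\<xi>\<in>total L. snd (\<alpha> \<xi>) (s (bproj L \<xi>))))"

definition end_form_conj ::
  "('l, 'x) lie_algebroid_data \<Rightarrow> ('l \<Rightarrow> 'l) \<Rightarrow> ('e, 'x) cvbundle \<Rightarrow> ('e \<Rightarrow> 'e) \<Rightarrow>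
     ('l \<Rightarrow> 'x \<times> ('e \<Rightarrow> 'e)) \<Rightarrow> 'l \<Rightarrow> 'x \<times> ('e \<Rightarrow> 'e)" where
  "end_form_conj L \<sigma>L E \<sigma>E \<alpha> = (\<lambda>\<xi>\<in>total L.
     (bproj L \<xi>, \<lambda>e\<in>fibre E (bproj L \<xi>). \<sigma>E (snd (\<alpha> (\<sigma>L \<xi>)) (inv_into (total E) \<sigma>E e))))"

text \<open>
  \<open>A(E, L)\<^sup>\<sigma>\<close>, relative to the reference connection \<open>D0\<close>. Any two connections differ by a unique
  one-form \<open>\<alpha>\<close> with values in \<open>End(E)\<close>, so the connection \<open>D0\<close> plus the conjugate of \<open>\<alpha>\<close> depends on \<open>D\<close> only.
\<close>

definition real_connections ::
  "'x cmanifold \<Rightarrow> ('l, 'x) lie_algebroid_data \<Rightarrow> ('l \<Rightarrow> 'l) \<Rightarrow> ('e, 'x) cvbundle \<Rightarrow> ('e \<Rightarrow> 'e) \<Rightarrow>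
     (('x \<Rightarrow> 'e) \<Rightarrow> 'l \<Rightarrow> 'e) \<Rightarrow> (('x \<Rightarrow> 'e) \<Rightarrow> 'l \<Rightarrow> 'e) set" where
  "real_connections M L \<sigma>L E \<sigma>E D0 = {D \<in> connections M L E.
     \<exists>\<alpha>\<in>one_forms M L (End_bundle E). D = connection_plus M L E D0 \<alpha> \<and>
       connection_plus M L E D0 (end_form_conj L \<sigma>L E \<sigma>E \<alpha>) = D}"


section \<open>Gauge groups\<close>

definition Gau :: "'x cmanifold \<Rightarrow> ('e, 'x) cvbundle \<Rightarrow> ('e \<Rightarrow> 'e) set" where
  "Gau M E = {\<phi> \<in> bundle_hom M E E. bij_betw \<phi> (total E) (total E) \<and>
     restrict (inv_into (total E) \<phi>) (total E) \<in> bundle_hom M E E}"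

definition endo_conj :: "('e, 'x) cvbundle \<Rightarrow> ('e \<Rightarrow> 'e) \<Rightarrow> ('e \<Rightarrow> 'e) \<Rightarrow> 'e \<Rightarrow> 'e" where
  "endo_conj E \<sigma>E \<phi> = (\<lambda>e\<in>total E. \<sigma>E (\<phi> (inv_into (total E) \<sigma>E e)))"

definition Gau_real :: "'x cmanifold \<Rightarrow> ('e, 'x) cvbundle \<Rightarrow> ('e \<Rightarrow> 'e) \<Rightarrow> ('e \<Rightarrow> 'e) set" where
  "Gau_real M E \<sigma>E = {\<phi> \<in> Gau M E. endo_conj E \<sigma>E \<phi> = \<phi>}"

definition gauge_act ::
  "'x cmanifold \<Rightarrow> ('l, 'x) lie_algebroid_data \<Rightarrow> ('e, 'x) cvbundle \<Rightarrow> ('e \<Rightarrow> 'e) \<Rightarrow>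
     (('x \<Rightarrow> 'e) \<Rightarrow> 'l \<Rightarrow> 'e) \<Rightarrow> ('x \<Rightarrow> 'e) \<Rightarrow> 'l \<Rightarrow> 'e" where
  "gauge_act M L E \<phi> D = (\<lambda>s\<in>sections M E. \<lambda>\<xi>\<in>total L.
     inv_into (total E) \<phi> (D (\<phi> \<circ> s) \<xi>))"

definition gauge_orbit ::
  "'x cmanifold \<Rightarrow> ('l, 'x) lie_algebroid_data \<Rightarrow> ('e, 'x) cvbundle \<Rightarrow> ('e \<Rightarrow> 'e) set \<Rightarrow>
     (('x \<Rightarrow> 'e) \<Rightarrow> 'l \<Rightarrow> 'e) \<Rightarrow> (('x \<Rightarrow> 'e) \<Rightarrow> 'l \<Rightarrow> 'e) set" where
  "gauge_orbit M L E G D = (\<lambda>\<phi>. gauge_act M L E \<phi> D) ` G"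

definition irreducible_connection ::
  "'x cmanifold \<Rightarrow> ('l, 'x) lie_algebroid_data \<Rightarrow> ('e, 'x) cvbundle \<Rightarrow> ('e \<Rightarrow> 'e) \<Rightarrow>
     (('x \<Rightarrow> 'e) \<Rightarrow> 'l \<Rightarrow> 'e) \<Rightarrow> bool" where
  "irreducible_connection M L E \<sigma>E D \<longleftrightarrow>
     {\<phi> \<in> Gau_real M E \<sigma>E. gauge_act M L E \<phi> D = D} =
     {\<lambda>e\<in>total E. vscale E (of_real t) e | t. t \<noteq> 0}"

end

theory Submission
  imports Defs "Jordan_Normal_Form.Determinant"
begin

text \<open>
  If \<open>\<phi>\<close> carries \<open>D\<close> to \<open>D'\<close>, then so does its conjugate \<open>\<phi>'\<close>, because both connections are real;
  hence \<open>\<psi> = \<phi>' \<phi>\<^sup>-\<^sup>1\<close> is a parallel endomorphism for \<open>D\<close>. Irreducibility only speaks about invertible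
  real endomorphisms, but over a compact base \<open>u + T\<close> is invertible for every endomorphism \<open>u\<close> and large
  real \<open>T\<close>, so every real parallel endomorphism is a real scalar. Applied to \<open>\<psi> + \<psi>'\<close> and \<open>\<i> (\<psi> - \<psi>')\<close> this
  gives \<open>\<phi>' = c \<phi>\<close> for a constant \<open>c\<close>, and \<open>|c| = 1\<close> because conjugation is an involution. If
  \<open>\<mu>\<^sup>2 = c\<close>, then \<open>\<mu> \<phi>\<close> is real and still carries \<open>D\<close> to \<open>D'\<close>.
\<close>

section \<open>Calculus on open subsets of coordinate space\<close>

text \<open>Membership in \<open>Gau\<close> asks for smoothness, so every construction on
  endomorphisms has to be shown smooth, and two of them shape the proof. Conjugation passes through
  \<sigma>X, which is antiholomorphic, so smooth functions must be pulled back along it. This takes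
  a chain rule for \<open>C_k_on\<close>, whose iterated partial derivatives live on a space of
  sequences with the product topology and no norm. The inverse of a gauge transformation must again
  be a smooth bundle map; it is obtained from determinants and adjugates of local matrices. Real and
  quaternionic structures are treated together: the square of \<sigma> is a sign \<epsilon>, so
  \<sigma> has inverse \<epsilon> \<sigma>, and conjugating twice is conjugating by a central
  scalar, which does nothing. The square root arises as follows: the conjugate of \<mu> \<phi> is
  cnj \<mu> c \<phi>, and for \<mu>^2 = c with |c| = 1 one has cnj \<mu> = 1 / \<mu>, so this is
  \<mu> \<phi>. In rank 0 nothing determines |c|, so that case is split off.\<close>

lemma coord_space_box:
  assumes W: "openin (top_of_set (coord_space n)) W" and a: "a \<in> W"
  obtains d where "d > 0"
    "\<And>q. q \<in> coord_space n \<Longrightarrow> (\<And>j. j < n \<Longrightarrow> norm (q j - a j) < d) \<Longrightarrow> q \<in> W"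
proof -
  obtain S where S: "open S" "W = coord_space n \<inter> S"
    using W by (auto simp: openin_open)
  have "openin (product_topology (\<lambda>i. euclidean) UNIV) S"
    using S(1) by (simp add: open_fun_def)
  from product_topology_open_contains_basis[OF this, of a] S a
  obtain X where X: "a \<in> Pi\<^sub>E UNIV X" "\<And>i. open (X i)" "Pi\<^sub>E UNIV X \<subseteq> S"
    by (auto simp: PiE_def)
  have "\<exists>e>0. ball (a j) e \<subseteq> X j" for j
    using X(1,2) open_contains_ball[of "X j"] by (auto simp: PiE_def Pi_def)
  then obtain e where e: "\<And>j. e j > 0" "\<And>j. ball (a j) (e j) \<subseteq> X j" by metis
  \<comment> \<open>Points of \<open>coord_space n\<close> can differ from \<open>a\<close> only in
    the first \<open>n\<close> coordinates, so finitely many radii matter; the extra 1 keeps the set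
    non-empty for \<open>n = 0\<close>.\<close>
  define d where "d = Min (insert 1 (e ` {..<n}))"
  have "d > 0" unfolding d_def using e(1) by (subst Min_gr_iff) auto
  moreover have "q \<in> W" if q: "q \<in> coord_space n" "\<And>j. j < n \<Longrightarrow> norm (q j - a j) < d" for q
  proof -
    have "q j \<in> X j" for j
    proof (cases "j < n")
      case True
      have "d \<le> e j" unfolding d_def using True by (intro Min_le) auto
      with q(2)[OF True] have "q j \<in> ball (a j) (e j)" by (simp add: dist_norm norm_minus_commute)
      with e(2) show ?thesis by blast
    next
      case False
      have "q j = a j" using False q(1) a S(2) by (auto simp: coord_space_def)
      then show ?thesis using e(1,2) by (metis centre_in_ball subsetD)
    qed
    then show ?thesis using X(3) q(1) S(2) by (auto simp: PiE_def)
  qed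
  ultimately show ?thesis using that by blast
qed

lemma coord_space_upd: "z \<in> coord_space n \<Longrightarrow> i < n \<Longrightarrow> z(i := w) \<in> coord_space n"
  by (auto simp: coord_space_def)

section \<open>Locality and closure properties of the classes C^k\<close>

lemma eventually_coord_line:
  assumes W: "openin (top_of_set (coord_space n)) W" and z: "z \<in> W" and i: "i < n"
  shows "\<forall>\<^sub>F t in nhds 0. z(i := z i + of_real t * c) \<in> W"
proof -
  obtain d where d: "d > 0"
    "\<And>q. q \<in> coord_space n \<Longrightarrow> (\<And>j. j < n \<Longrightarrow> norm (q j - z j) < d) \<Longrightarrow> q \<in> W"
    using coord_space_box[OF W z] by blast
  have "((\<lambda>t. norm (of_real t * c)) \<longlongrightarrow> norm (of_real 0 * c)) (nhds (0::real))"
    by (intro tendsto_intros) (simp add: filterlim_ident)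
  then have "\<forall>\<^sub>F t in nhds (0::real). norm (of_real t * c) < d"
    using d(1) by (intro order_tendstoD) auto
  moreover have "z \<in> coord_space n" using W z openin_imp_subset by fastforce
  ultimately show ?thesis
    by (auto elim!: eventually_mono intro!: d(2) coord_space_upd[OF _ i] simp: d(1))
qed

text \<open>A derivative at 0 only sees small parameters, for which the line stays in the open set
  \<open>W\<close>; the values of the functions off \<open>W\<close> are therefore
  irrelevant.\<close>

lemma coord_line_cong_deriv:
  assumes W: "openin (top_of_set (coord_space n)) W" and z: "z \<in> W" and i: "i < n"
    and fg: "\<And>y. y \<in> W \<Longrightarrow> f y = g y"
  shows "(coord_line f c i z has_vector_derivative d) (at 0) \<longleftrightarrow>
         (coord_line g c i z has_vector_derivative d) (at 0)"
proof (rule has_vector_derivative_cong_ev)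
  show "\<forall>\<^sub>F x in nhds 0. x \<in> UNIV \<longrightarrow> coord_line f c i z x = coord_line g c i z x"
    using eventually_coord_line[OF W z i, of c] by eventually_elim (simp add: coord_line_def fg)
  show "coord_line f c i z 0 = coord_line g c i z 0"
    using z by (simp add: coord_line_def fg)
qed

lemma C_k_on_continuous: "C_k_on n k W f \<Longrightarrow> continuous_on W f"
  by (cases k) auto

lemma C_k_on_cong:
  assumes W: "openin (top_of_set (coord_space n)) W"
  shows "(\<And>y. y \<in> W \<Longrightarrow> f y = g y) \<Longrightarrow> C_k_on n k W f \<longleftrightarrow> C_k_on n k W g"
proof (induction k arbitrary: f g)
  case 0
  then show ?case using continuous_on_cong[of W W f g] by simp
next
  case (Suc k)
  have "continuous_on W f \<longleftrightarrow> continuous_on W g"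
    using Suc.prems continuous_on_cong[of W W f g] by simp
  moreover have "coord_line f c i z differentiable at 0 \<longleftrightarrow> coord_line g c i z differentiable at 0"
    if z: "z \<in> W" and i: "i < n" for c i z
  proof -
    have "(coord_line f c i z has_vector_derivative d) (at 0) \<longleftrightarrow>
          (coord_line g c i z has_vector_derivative d) (at 0)" for d
      using Suc.prems by (rule coord_line_cong_deriv[OF W z i])
    then show ?thesis
      unfolding vector_derivative_works by (metis vector_derivative_at)
  qed
  moreover have "C_k_on n k W (real_partial c i f) \<longleftrightarrow> C_k_on n k W (real_partial c i g)"
    if i: "i < n" for c i
  proof (rule Suc.IH)
    fix z assume z: "z \<in> W"
    have "(coord_line f c i z has_vector_derivative d) (at 0) \<longleftrightarrow>
          (coord_line g c i z has_vector_derivative d) (at 0)" for d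
      using Suc.prems by (rule coord_line_cong_deriv[OF W z i])
    then show "real_partial c i f z = real_partial c i g z"
      by (simp add: real_partial_def vector_derivative_def)
  qed
  ultimately show ?case by auto
qed

text \<open>The values of \<open>real_partial\<close> off \<open>W\<close> are uncontrolled. Since
  the class on an open set depends only on values there, \<open>real_partial\<close> may be
  exchanged for any formula \<open>d\<close> that is the derivative at the points of
  \<open>W\<close>; the algebraic closure properties and the chain rule enter through such
  formulas.\<close>

lemma C_k_on_SucI:
  assumes W: "openin (top_of_set (coord_space n)) W" and "continuous_on W f"
    and "\<And>i c. i < n \<Longrightarrow> c \<in> {1, \<i>} \<Longrightarrow> C_k_on n k W (d c i)"
    and d: "\<And>i c z. i < n \<Longrightarrow> c \<in> {1, \<i>} \<Longrightarrow> z \<in> W \<Longrightarrow>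
               (coord_line f c i z has_vector_derivative d c i z) (at 0)"
  shows "C_k_on n (Suc k) W f"
proof -
  have "C_k_on n k W (real_partial c i f)" if "i < n" "c \<in> {1, \<i>}" for c i
    using assms(3)[OF that]
    by (rule C_k_on_cong[OF W, THEN iffD1, rotated])
       (simp add: real_partial_def vector_derivative_at[OF d[OF that]])
  then show ?thesis using assms(2) differentiableI_vector[OF d] by auto
qed

lemma C_k_on_SucD:
  assumes "C_k_on n (Suc k) W f" "i < n" "c \<in> {1, \<i>}"
  shows "C_k_on n k W (real_partial c i f)"
    and "z \<in> W \<Longrightarrow> (coord_line f c i z has_vector_derivative real_partial c i f z) (at 0)"
  using assms by (auto simp: vector_derivative_works real_partial_def[of c i f z])

lemma C_k_on_Suc_imp: "C_k_on n (Suc k) W f \<Longrightarrow> C_k_on n k W f"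
proof (induction k arbitrary: f)
  case (Suc k)
  then show ?case unfolding C_k_on.simps(2)[of n "Suc k"] C_k_on.simps(2)[of n k W f] by blast
qed simp

lemma C_k_on_subset: "C_k_on n k W f \<Longrightarrow> V \<subseteq> W \<Longrightarrow> C_k_on n k V f"
proof (induction k arbitrary: f)
  case (Suc k)
  then show ?case unfolding C_k_on.simps(2) by (blast intro: continuous_on_subset)
qed (simp add: continuous_on_subset)

text \<open>Continuity and differentiability are tested at single points, and
  \<open>real_partial\<close> does not refer to the domain. Locality allows charts and
  trivializations to be changed from point to point.\<close>

lemma C_k_on_local:
  assumes "\<And>z. z \<in> W \<Longrightarrow>
      \<exists>V. openin (top_of_set (coord_space n)) V \<and> z \<in> V \<and> C_k_on n k (W \<inter> V) f"
    and W: "openin (top_of_set (coord_space n)) W"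
  shows "C_k_on n k W f"
  using assms(1)
proof (induction k arbitrary: f)
  case 0
  have "continuous (at z within W) f" if z: "z \<in> W" for z
  proof -
    obtain V where V: "openin (top_of_set (coord_space n)) V" "z \<in> V" "continuous_on (W \<inter> V) f"
      using 0[OF z] by auto
    obtain S where S: "open S" "V = coord_space n \<inter> S" using V(1) by (auto simp: openin_open)
    have "z \<in> S" using S(2) V(2) by blast
    moreover have "W \<inter> S - {z} = W \<inter> V \<inter> S - {z}" using S(2) openin_imp_subset[OF W] by blast
    ultimately have "at z within W = at z within (W \<inter> V)"
      using S(1) by (intro at_within_nhd)
    moreover have "continuous (at z within (W \<inter> V)) f"
      using V z by (simp add: continuous_on_eq_continuous_within)
    ultimately show ?thesis by simp
  qed
  then show ?case by (simp add: continuous_on_eq_continuous_within)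
next
  case (Suc k)
  obtain V where V: "openin (top_of_set (coord_space n)) (V z)" "z \<in> V z"
      "C_k_on n (Suc k) (W \<inter> V z) f" if "z \<in> W" for z
    using Suc.prems by metis
  \<comment> \<open>Every level of \<open>C_k_on\<close> contains continuity, so the induction
    hypothesis for \<open>f\<close> itself supplies it.\<close>
  have "C_k_on n k W f"
    by (rule Suc.IH) (use V C_k_on_Suc_imp in metis)
  then have "continuous_on W f" by (rule C_k_on_continuous)
  moreover have "C_k_on n k W (real_partial c i f)" if ic: "i < n" "c \<in> {1, \<i>}" for c i
  proof (rule Suc.IH)
    fix z assume z: "z \<in> W"
    show "\<exists>V. openin (top_of_set (coord_space n)) V \<and> z \<in> V \<and> C_k_on n k (W \<inter> V) (real_partial c i f)"
      using V(1,2)[OF z] C_k_on_SucD(1)[OF V(3)[OF z] ic] by metis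
  qed
  moreover have "coord_line f c i z differentiable (at 0)"
    if ic: "i < n" "c \<in> {1, \<i>}" and z: "z \<in> W" for c i z
    using C_k_on_SucD(2)[OF V(3)[OF z] ic, of z] z V(2)[OF z]
    by (auto intro: differentiableI_vector)
  ultimately show ?case by (simp only: C_k_on.simps(2)) simp
qed

lemma C_k_on_const:
  assumes W: "openin (top_of_set (coord_space n)) W"
  shows "C_k_on n k W (\<lambda>z. a)"
proof (induction k arbitrary: a)
  case (Suc k)
  show ?case
    by (rule C_k_on_SucI[OF W, where d = "\<lambda>c i z. 0"])
      (auto simp: coord_line_def intro!: continuous_intros Suc derivative_eq_intros)
qed simp

text \<open>\<open>T\<close> is real-linear, so this covers conjugation and the real and imaginary
  parts, regarded as complex-valued maps, which the chain rule needs.\<close>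

lemma C_k_on_linear:
  assumes W: "openin (top_of_set (coord_space n)) W" and T: "bounded_linear T"
  shows "C_k_on n k W f \<Longrightarrow> C_k_on n k W (\<lambda>z. T (f z))"
proof (induction k arbitrary: f)
  case 0
  then show ?case by (simp add: bounded_linear.continuous_on[OF T])
next
  case (Suc k)
  show ?case
  proof (rule C_k_on_SucI[OF W, where d = "\<lambda>c i z. T (real_partial c i f z)"])
    show "continuous_on W (\<lambda>z. T (f z))"
      using Suc.prems by (simp add: bounded_linear.continuous_on[OF T])
    show "C_k_on n k W (\<lambda>z. T (real_partial c i f z))" if "i < n" "c \<in> {1, \<i>}" for i c
      by (rule Suc.IH[OF C_k_on_SucD(1)[OF Suc.prems that]])
    show "(coord_line (\<lambda>z. T (f z)) c i z has_vector_derivative T (real_partial c i f z)) (at 0)"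
      if "i < n" "c \<in> {1, \<i>}" "z \<in> W" for i c z
      using bounded_linear.has_vector_derivative[OF T C_k_on_SucD(2)[OF Suc.prems that]]
      by (simp add: coord_line_def)
  qed
qed

lemma C_k_on_add:
  assumes W: "openin (top_of_set (coord_space n)) W"
  shows "C_k_on n k W f \<Longrightarrow> C_k_on n k W g \<Longrightarrow> C_k_on n k W (\<lambda>z. f z + g z)"
proof (induction k arbitrary: f g)
  case 0
  then show ?case by (auto intro: continuous_intros)
next
  case (Suc k)
  show ?case
  proof (rule C_k_on_SucI[OF W, where d = "\<lambda>c i z. real_partial c i f z + real_partial c i g z"])
    show "continuous_on W (\<lambda>z. f z + g z)"
      using Suc.prems by (auto intro: continuous_intros)
    show "C_k_on n k W (\<lambda>z. real_partial c i f z + real_partial c i g z)"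
      if "i < n" "c \<in> {1, \<i>}" for i c
      by (intro Suc.IH C_k_on_SucD(1) Suc.prems that)
    show "(coord_line (\<lambda>z. f z + g z) c i z has_vector_derivative
        real_partial c i f z + real_partial c i g z) (at 0)"
      if "i < n" "c \<in> {1, \<i>}" "z \<in> W" for i c z
      using has_vector_derivative_add[OF C_k_on_SucD(2)[OF Suc.prems(1) that]
          C_k_on_SucD(2)[OF Suc.prems(2) that]]
      by (simp add: coord_line_def)
  qed
qed

lemma C_k_on_mult:
  assumes W: "openin (top_of_set (coord_space n)) W"
  shows "C_k_on n k W f \<Longrightarrow> C_k_on n k W g \<Longrightarrow> C_k_on n k W (\<lambda>z. f z * g z)"
proof (induction k arbitrary: f g)
  case 0
  then show ?case by (auto intro: continuous_intros)
next
  case (Suc k)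
  show ?case
  proof (rule C_k_on_SucI[OF W,
        where d = "\<lambda>c i z. f z * real_partial c i g z + real_partial c i f z * g z"])
    show "continuous_on W (\<lambda>z. f z * g z)"
      using Suc.prems by (auto intro: continuous_intros)
    show "C_k_on n k W (\<lambda>z. f z * real_partial c i g z + real_partial c i f z * g z)"
      if "i < n" "c \<in> {1, \<i>}" for i c
      by (intro C_k_on_add[OF W] Suc.IH C_k_on_SucD(1) Suc.prems that C_k_on_Suc_imp)
    show "(coord_line (\<lambda>z. f z * g z) c i z has_vector_derivative
        f z * real_partial c i g z + real_partial c i f z * g z) (at 0)"
      if "i < n" "c \<in> {1, \<i>}" "z \<in> W" for i c z
      using has_vector_derivative_mult[OF C_k_on_SucD(2)[OF Suc.prems(1) that]
          C_k_on_SucD(2)[OF Suc.prems(2) that]]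
      by (simp add: coord_line_def)
  qed
qed

text \<open>The derivative of 1 / f is - f' / f^2. It contains the reciprocal again, but one order
  of smoothness less is asked of it, so the induction on \<open>k\<close> closes with
  \<open>f\<close> fixed.\<close>

lemma C_k_on_inverse:
  assumes W: "openin (top_of_set (coord_space n)) W" and nz: "\<And>z. z \<in> W \<Longrightarrow> f z \<noteq> 0"
  shows "C_k_on n k W f \<Longrightarrow> C_k_on n k W (\<lambda>z. inverse (f z))"
proof (induction k)
  case 0
  then show ?case using nz by (auto intro: continuous_intros)
next
  case (Suc k)
  show ?case
  proof (rule C_k_on_SucI[OF W,
        where d = "\<lambda>c i z. (-1) * (real_partial c i f z * (inverse (f z) * inverse (f z)))"])
    show "continuous_on W (\<lambda>z. inverse (f z))"
      using Suc.prems nz by (auto intro: continuous_intros)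
    show "C_k_on n k W (\<lambda>z. (-1) * (real_partial c i f z * (inverse (f z) * inverse (f z))))"
      if "i < n" "c \<in> {1, \<i>}" for i c
      by (intro C_k_on_mult[OF W] C_k_on_const[OF W] Suc.IH C_k_on_SucD(1) Suc.prems that C_k_on_Suc_imp)
    show "(coord_line (\<lambda>z. inverse (f z)) c i z has_vector_derivative
        (-1) * (real_partial c i f z * (inverse (f z) * inverse (f z)))) (at 0)"
      if "i < n" "c \<in> {1, \<i>}" "z \<in> W" for i c z
    proof -
      let ?l = "coord_line f c i z" and ?d = "real_partial c i f z"
      have "?l 0 \<noteq> 0" using nz[OF that(3)] by (simp add: coord_line_def)
      moreover have "(?l has_derivative (\<lambda>h. h *\<^sub>R ?d)) (at 0)"
        using C_k_on_SucD(2)[OF Suc.prems that] by (simp add: has_vector_derivative_def)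
      ultimately have "((\<lambda>t. inverse (?l t)) has_derivative
          (\<lambda>h. - (inverse (?l 0) * (h *\<^sub>R ?d) * inverse (?l 0)))) (at 0)"
        by (rule Deriv.has_derivative_inverse)
      moreover have "(\<lambda>h. - (inverse (?l 0) * (h *\<^sub>R ?d) * inverse (?l 0))) =
          (\<lambda>h. h *\<^sub>R ((-1) * (?d * (inverse (f z) * inverse (f z)))))"
        by (simp add: coord_line_def fun_eq_iff scaleR_conv_of_real)
      ultimately show ?thesis
        by (simp add: coord_line_def has_vector_derivative_def)
    qed
  qed
qed

text \<open>
  The chain rule is proved by moving one real coordinate at a time. The base point \<open>p t\<close> of the move
  varies with \<open>t\<close>, so continuity of the partial derivative is needed.
\<close>

lemma has_vector_derivative_partial_step:
  assumes W: "openin (top_of_set (coord_space n)) W" and a: "a \<in> W" and m: "m < n"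
    and dif: "\<And>z. z \<in> W \<Longrightarrow> (coord_line f c m z has_vector_derivative g z) (at 0)"
    and cont: "continuous_on W g" and c: "norm c = 1"
    and p: "\<And>t. p t \<in> coord_space n" "p 0 = a" "\<And>j. j < n \<Longrightarrow> isCont (\<lambda>t. p t j) 0"
    and fp: "((\<lambda>t. f (p t)) has_vector_derivative d) (at 0)"
    and h: "(h has_real_derivative h') (at 0)" "h 0 = 0"
  shows "((\<lambda>t. f ((p t)(m := p t m + of_real (h t) * c))) has_vector_derivative
            d + of_real h' * g a) (at 0)"
proof -
  define G where "G t = f ((p t)(m := p t m + of_real (h t) * c)) - f (p t)" for t
  have G0: "G 0 = 0" by (simp add: G_def h(2))
  \<comment> \<open>The increment \<open>G\<close> caused by moving one coordinate is compared with
    its linear part by the mean value inequality on the segment from 0 to \<open>h t\<close>. The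
    factor 3 collects 2 e from the oscillation of \<open>g\<close> along the segment and e from
    replacing \<open>g (P 0)\<close> by \<open>g a\<close>.\<close>
  have key: "\<forall>\<^sub>F t in nhds 0. norm (G t - h t *\<^sub>R g a) \<le> 3 * e * \<bar>h t\<bar>" if e: "e > 0" for e
  proof -
    define W' where "W' = W \<inter> g -` ball (g a) e"
    have "openin (top_of_set W) W'"
      unfolding W'_def using continuous_openin_preimage_gen[OF cont, of "ball (g a) e"] by simp
    then have "openin (top_of_set (coord_space n)) W'" using W openin_trans by blast
    moreover have "a \<in> W'" using a e by (simp add: W'_def)
    ultimately obtain r where r: "r > 0"
      "\<And>q. q \<in> coord_space n \<Longrightarrow> (\<And>j. j < n \<Longrightarrow> norm (q j - a j) < r) \<Longrightarrow> q \<in> W'"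
      using coord_space_box by blast
    have "\<forall>\<^sub>F t in nhds 0. norm (p t j - a j) < r / 2" if "j < n" for j
    proof -
      have "((\<lambda>t. norm (p t j - a j)) \<longlongrightarrow> norm (p 0 j - a j)) (nhds 0)"
        using p(3)[OF that, unfolded isCont_def tendsto_at_iff_tendsto_nhds[of "\<lambda>t. p t j" 0]]
        by (intro tendsto_intros)
      then show ?thesis using r(1) p(2) by (intro order_tendstoD) auto
    qed
    then have "\<forall>\<^sub>F t in nhds 0. \<forall>j\<in>{..<n}. norm (p t j - a j) < r / 2"
      by (intro eventually_ball_finite) auto
    moreover have "\<forall>\<^sub>F t in nhds 0. \<bar>h t\<bar> < r / 2"
    proof -
      have "isCont h 0" using h(1) DERIV_isCont by blast
      then have "((\<lambda>t. \<bar>h t\<bar>) \<longlongrightarrow> \<bar>h 0\<bar>) (nhds 0)"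
        by (intro tendsto_intros) (simp add: isCont_def tendsto_at_iff_tendsto_nhds[of h])
      then show ?thesis using r(1) h(2) by (intro order_tendstoD) auto
    qed
    ultimately show ?thesis
    proof eventually_elim
      case (elim t)
      \<comment> \<open>Half of the radius \<open>r\<close> is reserved for the drift of the base
        point \<open>p t\<close>, the other half for the move along the segment.\<close>
      define P where "P s = (p t)(m := p t m + of_real s * c)" for s :: real
      have P: "P s \<in> W'" if "s \<in> closed_segment 0 (h t)" for s
      proof (rule r(2))
        show "P s \<in> coord_space n" unfolding P_def by (intro coord_space_upd p m)
        have "\<bar>s\<bar> < r / 2" using that elim(2) by (auto simp: closed_segment_eq_real_ivl split: if_splits)
        moreover have "norm (p t m + of_real s * c - a m) \<le> norm (p t m - a m) + norm (of_real s * c)"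
          by (metis add_diff_eq add.commute add_diff_add diff_zero diff_add_eq norm_triangle_ineq)
        ultimately show "norm (P s j - a j) < r" if "j < n" for j
          using that elim(1) r(1) m by (force simp: P_def norm_mult c)
      qed
      \<comment> \<open>The hypothesis \<open>dif\<close> differentiates at parameter 0 only; it is
        used at the point \<open>P s\<close> and carried to parameter \<open>s\<close> by a
        shift.\<close>
      have der: "((\<lambda>s. f (P s)) has_vector_derivative g (P s)) (at s within closed_segment 0 (h t))"
        if s: "s \<in> closed_segment 0 (h t)" for s
      proof -
        have "P s \<in> W" using P[OF s] by (simp add: W'_def)
        from dif[OF this] have "((\<lambda>x. f (P (x + s))) has_vector_derivative g (P s)) (at 0)"
          by (simp add: coord_line_def P_def algebra_simps)
        then have "((\<lambda>x. f (P x)) has_vector_derivative g (P s)) (at s)"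
          using vector_diff_chain_at[of "\<lambda>x. x - s" 1 s "\<lambda>x. f (P (x + s))" "g (P s)"]
            has_vector_derivative_diff[OF has_vector_derivative_id[where net = "at s"]
              has_vector_derivative_const[where c = s and net = "at s"]]
          by (simp add: o_def)
        then show ?thesis by (rule has_vector_derivative_at_within)
      qed
      have near: "norm (g (P s) - g a) < e" if "s \<in> closed_segment 0 (h t)" for s
        using P[OF that] by (simp add: W'_def dist_norm norm_minus_commute)
      have "norm (f (P (h t)) - f (P 0) - (h t - 0) *\<^sub>R g (P 0)) \<le> norm (h t - 0) * (2 * e)"
      proof (rule vector_differentiable_bound_linearization[OF der])
        show "norm (g (P x) - g (P 0)) \<le> 2 * e" if "x \<in> closed_segment 0 (h t)" for x
          using near[OF that] near[of 0] norm_triangle_ineq4[of "g (P x) - g a" "g (P 0) - g a"]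
          by simp
      qed auto
      moreover have "norm (h t *\<^sub>R g (P 0) - h t *\<^sub>R g a) \<le> \<bar>h t\<bar> * e"
        using near[of 0] by (simp flip: scaleR_diff_right add: mult_left_mono)
      moreover have "G t - h t *\<^sub>R g a = (f (P (h t)) - f (P 0) - (h t - 0) *\<^sub>R g (P 0)) +
          (h t *\<^sub>R g (P 0) - h t *\<^sub>R g a)"
        by (simp add: G_def P_def)
      ultimately have "norm (G t - h t *\<^sub>R g a) \<le> norm (h t - 0) * (2 * e) + \<bar>h t\<bar> * e"
        using norm_triangle_mono by metis
      then show ?case by (simp add: algebra_simps)
    qed
  qed
  have "(G has_vector_derivative h' *\<^sub>R g a) (at 0)"
    unfolding has_vector_derivative_def has_derivative_at_alt
  proof (intro conjI allI impI)
    show "bounded_linear (\<lambda>x. x *\<^sub>R h' *\<^sub>R g a)" by (rule bounded_linear_scaleR_left)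
    fix e :: real assume e: "e > 0"
    have lin: "\<exists>d>0. \<forall>y. norm (y - 0) < d \<longrightarrow> norm (h y - h 0 - h' * (y - 0)) \<le> e' * norm (y - 0)"
      if "e' > 0" for e'
      using h(1) that unfolding has_field_derivative_def has_derivative_at_alt by blast
    \<comment> \<open>Two errors of at most \<open>e / 2 * |t|\<close> are aimed at.
      \<open>e1\<close> absorbs the factor 3 and the bound (|h'| + 1) |t| for |h t|, and
      \<open>e2\<close> absorbs the norm of \<open>g a\<close>. The cap 1 on \<open>e2\<close>
      yields that bound for h; the added 1 keeps the denominators positive.\<close>
    define e1 where "e1 = e / (6 * (\<bar>h'\<bar> + 1))"
    define e2 where "e2 = min 1 (e / (2 * (norm (g a) + 1)))"
    have e1: "e1 > 0" and e2: "e2 > 0" "e2 \<le> 1" "e2 * norm (g a) \<le> e / 2"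
    proof -
      show "e1 > 0" "e2 > 0" "e2 \<le> 1"
        using e by (auto simp: e1_def e2_def add_nonneg_pos intro!: divide_pos_pos mult_pos_pos)
      have "e2 * norm (g a) \<le> e / (2 * (norm (g a) + 1)) * norm (g a)"
        by (intro mult_right_mono) (auto simp: e2_def)
      also have "\<dots> = e / 2 * (norm (g a) / (norm (g a) + 1))" by simp
      also have "\<dots> \<le> e / 2 * 1"
        using e by (intro mult_left_mono) (simp_all add: divide_le_eq_1 add_nonneg_pos)
      also have "\<dots> = e / 2" by simp
      finally show "e2 * norm (g a) \<le> e / 2" .
    qed
    obtain d1 where d1: "d1 > 0" "\<And>t. \<bar>t\<bar> < d1 \<Longrightarrow> norm (G t - h t *\<^sub>R g a) \<le> 3 * e1 * \<bar>h t\<bar>"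
      using key[OF e1] by (auto simp: eventually_nhds_metric dist_norm)
    obtain d2 where d2: "d2 > 0" "\<And>t. \<bar>t\<bar> < d2 \<Longrightarrow> \<bar>h t - h' * t\<bar> \<le> e2 * \<bar>t\<bar>"
      using lin[OF e2(1)] h(2) by auto
    show "\<exists>d>0. \<forall>y. norm (y - 0) < d \<longrightarrow>
            norm (G y - G 0 - (y - 0) *\<^sub>R h' *\<^sub>R g a) \<le> e * norm (y - 0)"
    proof (intro exI[of _ "min d1 d2"] conjI allI impI)
      fix t :: real assume "norm (t - 0) < min d1 d2"
      then have t: "\<bar>t\<bar> < d1" "\<bar>t\<bar> < d2" by auto
      have "e2 * \<bar>t\<bar> \<le> 1 * \<bar>t\<bar>" using e2 by (intro mult_right_mono) auto
      then have "\<bar>h t\<bar> \<le> (\<bar>h'\<bar> + 1) * \<bar>t\<bar>"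
        using d2(2)[OF t(2)] by (simp add: algebra_simps flip: abs_mult)
      then have "3 * e1 * \<bar>h t\<bar> \<le> 3 * e1 * ((\<bar>h'\<bar> + 1) * \<bar>t\<bar>)"
        using e1 by (intro mult_left_mono) auto
      also have "\<dots> = e / 2 * \<bar>t\<bar>" by (simp add: e1_def field_simps add_nonneg_eq_0_iff)
      finally have 1: "norm (G t - h t *\<^sub>R g a) \<le> e / 2 * \<bar>t\<bar>" using d1(2)[OF t(1)] by linarith
      have "norm ((h t - h' * t) *\<^sub>R g a) \<le> (e2 * \<bar>t\<bar>) * norm (g a)"
        using d2(2)[OF t(2)] by (simp add: mult_right_mono)
      also have "\<dots> \<le> e / 2 * \<bar>t\<bar>" using mult_right_mono[OF e2(3), of "\<bar>t\<bar>"] by (simp add: mult_ac)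
      finally have 2: "norm ((h t - h' * t) *\<^sub>R g a) \<le> e / 2 * \<bar>t\<bar>" .
      have "G t - t *\<^sub>R h' *\<^sub>R g a = (G t - h t *\<^sub>R g a) + (h t - h' * t) *\<^sub>R g a"
        by (simp add: algebra_simps)
      then have "norm (G t - t *\<^sub>R h' *\<^sub>R g a) \<le> e / 2 * \<bar>t\<bar> + e / 2 * \<bar>t\<bar>"
        using norm_triangle_mono[OF 1 2] by metis
      then show "norm (G t - G 0 - (t - 0) *\<^sub>R h' *\<^sub>R g a) \<le> e * norm (t - 0)"
        by (simp add: G0)
    qed (use d1 d2 in auto)
  qed
  from has_vector_derivative_add[OF fp this] show ?thesis
    by (simp add: G_def scaleR_conv_of_real)
qed

text \<open>The curve is switched on coordinate by coordinate, each coordinate in two moves, first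
  its real part and then its imaginary part; every move contributes one partial derivative.\<close>

lemma has_vector_derivative_coord_curve:
  assumes W: "openin (top_of_set (coord_space n)) W" and a: "\<gamma> 0 \<in> W"
    and f: "C_k_on n (Suc 0) W f"
    and \<gamma>: "\<forall>\<^sub>F t in nhds 0. \<gamma> t \<in> coord_space n"
           "\<And>j. j < n \<Longrightarrow> ((\<lambda>t. \<gamma> t j) has_vector_derivative \<gamma>' j) (at 0)"
  shows "((\<lambda>t. f (\<gamma> t)) has_vector_derivative
           (\<Sum>j<n. of_real (Re (\<gamma>' j)) * real_partial 1 j f (\<gamma> 0)
                 + of_real (Im (\<gamma>' j)) * real_partial \<i> j f (\<gamma> 0))) (at 0)"
proof -
  let ?a = "\<gamma> 0"
  have as: "?a \<in> coord_space n" using a W openin_imp_subset by blast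
  \<comment> \<open>\<open>p m\<close> follows \<gamma> in the first \<open>m\<close> coordinates
    and rests at the base point in the others. For \<open>m \<le> n\<close> it lies in
    \<open>coord_space n\<close> for all parameters, as a single move demands, whereas \<gamma> does
    so only near 0.\<close>
  define p where "p m t = (\<lambda>j. if j < m then \<gamma> t j else ?a j)" for m t
  have p0: "p m 0 = ?a" for m by (simp add: p_def fun_eq_iff)
  have ps: "p m t \<in> coord_space n" if "m \<le> n" for m t
    using as that by (auto simp: p_def coord_space_def)
  have cont: "isCont (\<lambda>t. \<gamma> t j) 0" if "j < n" for j
    using \<gamma>(2)[OF that] has_vector_derivative_continuous by blast
  have pcont: "isCont (\<lambda>t. p m t j) 0" if "j < n" for m j
    using cont[OF that] by (cases "j < m") (simp_all add: p_def)
  let ?D = "\<lambda>j. of_real (Re (\<gamma>' j)) * real_partial 1 j f ?a + of_real (Im (\<gamma>' j)) * real_partial \<i> j f ?a"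
  have "((\<lambda>t. f (p m t)) has_vector_derivative sum ?D {..<m}) (at 0)" if "m \<le> n" for m
    using that
  proof (induction m)
    case 0
    have "p 0 = (\<lambda>t. ?a)" by (simp add: p_def fun_eq_iff)
    then show ?case by simp
  next
    case (Suc m)
    then have m: "m < n" by simp
    let ?h1 = "\<lambda>t. Re (\<gamma> t m - ?a m)" and ?h2 = "\<lambda>t. Im (\<gamma> t m - ?a m)"
    have h1: "(?h1 has_real_derivative Re (\<gamma>' m)) (at 0)"
      and h2: "(?h2 has_real_derivative Im (\<gamma>' m)) (at 0)"
      using bounded_linear.has_vector_derivative[OF bounded_linear_Re \<gamma>(2)[OF m]]
        bounded_linear.has_vector_derivative[OF bounded_linear_Im \<gamma>(2)[OF m]]
      by (auto simp: has_real_derivative_iff_has_vector_derivative intro!: derivative_eq_intros)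
    let ?q = "\<lambda>t. (p m t)(m := p m t m + of_real (?h1 t) * 1)"
    have 1: "((\<lambda>t. f (?q t)) has_vector_derivative
        sum ?D {..<m} + of_real (Re (\<gamma>' m)) * real_partial 1 m f ?a) (at 0)"
    proof (rule has_vector_derivative_partial_step[OF W a m])
      show "((\<lambda>t. f (p m t)) has_vector_derivative sum ?D {..<m}) (at 0)" using Suc by simp
    qed (use h1 C_k_on_SucD[OF f m] p0 ps m pcont in simp_all)
    have "((\<lambda>t. f ((?q t)(m := ?q t m + of_real (?h2 t) * \<i>))) has_vector_derivative
        sum ?D {..<m} + of_real (Re (\<gamma>' m)) * real_partial 1 m f ?a +
        of_real (Im (\<gamma>' m)) * real_partial \<i> m f ?a) (at 0)"
    proof (rule has_vector_derivative_partial_step[where p = ?q and h = ?h2 and m = m and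
            g = "real_partial \<i> m f" and c = \<i>, OF W a m])
      show "((\<lambda>t. f (?q t)) has_vector_derivative
        sum ?D {..<m} + of_real (Re (\<gamma>' m)) * real_partial 1 m f ?a) (at 0)" by (rule 1)
      show "(?h2 has_real_derivative Im (\<gamma>' m)) (at 0)" by (rule h2)
      show "isCont (\<lambda>t. ?q t j) 0" if "j < n" for j
        using pcont[OF that, of m] cont[OF m]
        by (cases "j = m") (auto intro!: continuous_intros simp: p_def)
      show "?q t \<in> coord_space n" for t using ps m by (intro coord_space_upd) auto
      show "?q 0 = ?a" using p0[of m] by (auto simp: fun_eq_iff)
    qed (use C_k_on_SucD[OF f m] in simp_all)
    moreover have "(?q t)(m := ?q t m + of_real (?h2 t) * \<i>) = p (Suc m) t" for t
      by (auto simp: p_def fun_eq_iff complex_eq_iff)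
    ultimately show ?case by (simp add: add.assoc)
  qed
  from this[of n] show ?thesis
  proof (subst has_vector_derivative_cong_ev)
    show "\<forall>\<^sub>F t in nhds 0. t \<in> UNIV \<longrightarrow> f (\<gamma> t) = f (p n t)"
      using \<gamma>(1)
    proof eventually_elim
      case (elim t)
      then have "\<gamma> t = p n t" using as by (auto simp: p_def coord_space_def fun_eq_iff)
      then show ?case by simp
    qed
  qed (simp_all add: p0)
qed

section \<open>Closure of C^k under composition\<close>

lemma C_k_on_mono: "C_k_on n k W f \<Longrightarrow> j \<le> k \<Longrightarrow> C_k_on n j W f"
proof (induction k)
  case (Suc k)
  then show ?case using C_k_on_Suc_imp[of n k W f] by (cases "j = Suc k") auto
qed simp

lemma C_k_on_sum:
  assumes W: "openin (top_of_set (coord_space n)) W"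
    and "\<And>j. j \<in> J \<Longrightarrow> C_k_on n k W (F j)"
  shows "C_k_on n k W (\<lambda>z. \<Sum>j\<in>J. F j z)"
  using assms(2)
proof (induction J rule: infinite_finite_induct)
  case (insert x J)
  then have "C_k_on n k W (\<lambda>z. F x z + (\<Sum>j\<in>J. F j z))"
    by (intro C_k_on_add[OF W] insert.IH insert.prems) simp_all
  then show ?case using insert.hyps by simp
qed (simp_all add: C_k_on_const[OF W, of k 0])

text \<open>By the chain rule, a partial derivative of the composite is a sum of products of
  derivatives of the components of \<open>w\<close> with partial derivatives of \<open>f\<close>
  composed with \<open>w\<close>. The latter are composites of one order less, hence the induction
  on \<open>k\<close> with \<open>f\<close> arbitrary and \<open>w\<close> fixed.\<close>

lemma C_k_on_compose:
  assumes W: "openin (top_of_set (coord_space m)) W" and V: "openin (top_of_set (coord_space n)) V"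
    and w: "\<And>z. z \<in> W \<Longrightarrow> w z \<in> V"
  shows "C_k_on n k V f \<Longrightarrow> (\<And>j. j < n \<Longrightarrow> C_k_on m k W (\<lambda>z. w z j)) \<Longrightarrow>
     C_k_on m k W (\<lambda>z. f (w z))"
proof (induction k arbitrary: f)
  case 0
  have "continuous_on W w"
  proof (rule continuous_on_coordinatewise_then_product)
    fix j
    show "continuous_on W (\<lambda>z. w z j)"
    proof (cases "j < n")
      case False
      have "V \<subseteq> coord_space n" using V openin_imp_subset by blast
      then have "w z j = 0" if "z \<in> W" for z
        using w[OF that] False by (auto simp: coord_space_def)
      then show ?thesis using continuous_on_cong[of W W "\<lambda>z. w z j" "\<lambda>z. 0"] by simp
    qed (use 0 in simp)
  qed
  moreover have "continuous_on V f" using 0 by simp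
  ultimately have "continuous_on W (\<lambda>z. f (w z))"
    using w by (intro continuous_on_compose2[of V f W w]) auto
  then show ?case by simp
next
  case (Suc k)
  let ?D = "\<lambda>c i z. \<Sum>j<n. of_real (Re (real_partial c i (\<lambda>z. w z j) z)) * real_partial 1 j f (w z) +
          of_real (Im (real_partial c i (\<lambda>z. w z j) z)) * real_partial \<i> j f (w z)"
  have wk: "C_k_on m k W (\<lambda>z. w z j)" if "j < n" for j
    using Suc.prems(2)[OF that] by (rule C_k_on_Suc_imp)
  have re: "bounded_linear (\<lambda>z. of_real (Re z) :: complex)"
    and im: "bounded_linear (\<lambda>z. of_real (Im z) :: complex)"
    using bounded_linear_compose[OF bounded_linear_of_real bounded_linear_Re]
      bounded_linear_compose[OF bounded_linear_of_real bounded_linear_Im] by simp_all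
  show ?case
  proof (rule C_k_on_SucI[OF W, where d = ?D])
    have "C_k_on m k W (\<lambda>z. f (w z))"
      by (rule Suc.IH[OF C_k_on_Suc_imp[OF Suc.prems(1)] wk])
    then show "continuous_on W (\<lambda>z. f (w z))" by (rule C_k_on_continuous)
  next
    fix i and c :: complex assume ic: "i < m" "c \<in> {1, \<i>}"
    show "C_k_on m k W (?D c i)"
    proof (rule C_k_on_sum[OF W])
      fix j assume "j \<in> {..<n}"
      then have j: "j < n" by simp
      have "C_k_on m k W (\<lambda>z. real_partial d j f (w z))" if "d \<in> {1, \<i>}" for d
        by (rule Suc.IH[OF C_k_on_SucD(1)[OF Suc.prems(1) j that] wk])
      then show "C_k_on m k W (\<lambda>z. of_real (Re (real_partial c i (\<lambda>z. w z j) z)) * real_partial 1 j f (w z) +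
          of_real (Im (real_partial c i (\<lambda>z. w z j) z)) * real_partial \<i> j f (w z))"
        using C_k_on_SucD(1)[OF Suc.prems(2)[OF j] ic]
        by (intro C_k_on_add[OF W] C_k_on_mult[OF W] C_k_on_linear[OF W re] C_k_on_linear[OF W im]) simp_all
    qed
    fix z assume z: "z \<in> W"
    let ?\<gamma> = "\<lambda>t. w (z(i := z i + of_real t * c))"
    have "((\<lambda>t. f (?\<gamma> t)) has_vector_derivative
           (\<Sum>j<n. of_real (Re (real_partial c i (\<lambda>z. w z j) z)) * real_partial 1 j f (?\<gamma> 0)
                 + of_real (Im (real_partial c i (\<lambda>z. w z j) z)) * real_partial \<i> j f (?\<gamma> 0))) (at 0)"
    proof (rule has_vector_derivative_coord_curve[OF V])
      show "?\<gamma> 0 \<in> V" using w[OF z] by simp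
      show "C_k_on n (Suc 0) V f" using Suc.prems(1) by (rule C_k_on_mono) simp
      show "\<forall>\<^sub>F t in nhds 0. ?\<gamma> t \<in> coord_space n"
        using eventually_coord_line[OF W z ic(1), of c]
      proof (rule eventually_mono)
        show "w q \<in> coord_space n" if "q \<in> W" for q
          using w[OF that] openin_imp_subset[OF V] by blast
      qed
      show "((\<lambda>t. ?\<gamma> t j) has_vector_derivative real_partial c i (\<lambda>z. w z j) z) (at 0)" if "j < n" for j
        using C_k_on_SucD(2)[OF Suc.prems(2)[OF that] ic z] by (simp add: coord_line_def)
    qed
    then show "(coord_line (\<lambda>z. f (w z)) c i z has_vector_derivative ?D c i z) (at 0)"
      by (simp add: coord_line_def)
  qed
qed

section \<open>Smooth functions on manifolds\<close>

lemma complex_manifold_chart: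
  assumes "complex_manifold M" "(U, \<phi>) \<in> charts M"
  shows "open U" "openin (top_of_set (coord_space (cdim M))) (\<phi> ` U)"
    "homeomorphism U (\<phi> ` U) \<phi> (inv_into U \<phi>)"
proof -
  have "\<forall>(U, \<phi>)\<in>charts M.
        open U \<and> openin (top_of_set (coord_space (cdim M))) (\<phi> ` U) \<and>
        homeomorphism U (\<phi> ` U) \<phi> (inv_into U \<phi>)"
    using assms(1) unfolding complex_manifold_def by (elim conjE)
  from bspec[OF this assms(2)]
  show "open U" "openin (top_of_set (coord_space (cdim M))) (\<phi> ` U)"
    "homeomorphism U (\<phi> ` U) \<phi> (inv_into U \<phi>)" by simp_all
qed

lemma chart_image_openin:
  assumes M: "complex_manifold M" and U: "(U, \<phi>) \<in> charts M" and V: "open V"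
  shows "openin (top_of_set (coord_space (cdim M))) (\<phi> ` (U \<inter> V))"
proof -
  note hom = complex_manifold_chart(3)[OF M U]
  have "openin (top_of_set (\<phi> ` U)) (\<phi> ` (U \<inter> V))"
    by (rule homeomorphism_imp_open_map[OF hom]) (use V in auto)
  then show ?thesis using complex_manifold_chart(2)[OF M U] by (rule openin_trans)
qed

lemma chart_facts:
  assumes M: "complex_manifold M" and U: "(U, \<phi>) \<in> charts M"
  shows "open U" "inj_on \<phi> U" "continuous_on U \<phi>" "x \<in> U \<Longrightarrow> inv_into U \<phi> (\<phi> x) = x"
proof -
  note * = complex_manifold_chart[OF M U]
  then show "open U" "continuous_on U \<phi>" "x \<in> U \<Longrightarrow> inv_into U \<phi> (\<phi> x) = x" for x
    by (auto simp: homeomorphism_def)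
  then show "inj_on \<phi> U" by (metis inj_onI)
qed

lemma antiholomorphic_chart:
  assumes "antiholomorphic M h" "(U, \<phi>) \<in> charts M" "(V, \<psi>) \<in> charts M" "j < cdim M"
  shows "holomorphic_coord (cdim M) (\<phi> ` (U \<inter> h -` V)) (\<lambda>z. cnj (\<psi> (h (inv_into U \<phi> z)) j))"
proof -
  have "\<forall>(U, \<phi>)\<in>charts M. \<forall>(V, \<psi>)\<in>charts M. \<forall>i<cdim M.
      holomorphic_coord (cdim M) (\<phi> ` (U \<inter> h -` V)) (\<lambda>z. cnj (\<psi> (h (inv_into U \<phi> z)) i))"
    using assms(1) unfolding antiholomorphic_def by (elim conjE)
  from bspec[OF this assms(2)] have "\<forall>(V, \<psi>)\<in>charts M. \<forall>i<cdim M.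
      holomorphic_coord (cdim M) (\<phi> ` (U \<inter> h -` V)) (\<lambda>z. cnj (\<psi> (h (inv_into U \<phi> z)) i))"
    by simp
  from bspec[OF this assms(3)] assms(4) show ?thesis by simp
qed

lemma chart_cover:
  assumes "complex_manifold M"
  obtains U \<phi> where "(U, \<phi>) \<in> charts M" "x \<in> U"
proof -
  have "(\<Union>(U, \<phi>)\<in>charts M. U) = UNIV"
    using assms unfolding complex_manifold_def by (elim conjE)
  then have "x \<in> (\<Union>(U, \<phi>)\<in>charts M. U)" by simp
  then show thesis using that by auto
qed

lemma smooth_on_mfd_iff: "smooth_on_mfd M V f \<longleftrightarrow>
    (\<forall>U \<phi> k. (U, \<phi>) \<in> charts M \<longrightarrow> C_k_on (cdim M) k (\<phi> ` (U \<inter> V)) (\<lambda>z. f (inv_into U \<phi> z)))"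
  by (auto simp: smooth_on_mfd_def smooth_coord_def)

lemma smooth_on_mfd_subset: "smooth_on_mfd M V f \<Longrightarrow> W \<subseteq> V \<Longrightarrow> smooth_on_mfd M W f"
  unfolding smooth_on_mfd_iff by (meson C_k_on_subset Int_mono image_mono subset_refl)

section \<open>Algebra and locality of smooth functions on the manifold\<close>

context
  fixes M :: "'x::{t2_space, second_countable_topology} cmanifold"
  assumes M: "complex_manifold M"
begin

lemma smooth_on_mfd_cong:
  assumes V: "open V" and fg: "\<And>x. x \<in> V \<Longrightarrow> f x = g x" and g: "smooth_on_mfd M V g"
  shows "smooth_on_mfd M V f"
  unfolding smooth_on_mfd_iff
proof (safe)
  fix U \<phi> k assume U: "(U, \<phi>) \<in> charts M"
  have "C_k_on (cdim M) k (\<phi> ` (U \<inter> V)) (\<lambda>z. g (inv_into U \<phi> z))"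
    using g U unfolding smooth_on_mfd_iff by blast
  then show "C_k_on (cdim M) k (\<phi> ` (U \<inter> V)) (\<lambda>z. f (inv_into U \<phi> z))"
    by (rule C_k_on_cong[OF chart_image_openin[OF M U V], THEN iffD2, rotated])
      (auto simp: chart_facts(4)[OF M U] fg)
qed

text \<open>A common pattern for post-composition with linear maps and with inversion; inversion
  uses the condition that \<open>h\<close> takes only values of \<open>f\<close>, which excludes
  0.\<close>

lemma smooth_on_mfd_lift1:
  assumes V: "open V" and f: "smooth_on_mfd M V f"
    and T: "\<And>W k h. openin (top_of_set (coord_space (cdim M))) W \<Longrightarrow>
       C_k_on (cdim M) k W h \<Longrightarrow> (\<And>z. z \<in> W \<Longrightarrow> h z \<in> f ` V) \<Longrightarrow>
       C_k_on (cdim M) k W (\<lambda>z. T (h z))"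
  shows "smooth_on_mfd M V (\<lambda>x. T (f x))"
  unfolding smooth_on_mfd_iff
proof safe
  fix U \<phi> k assume U: "(U, \<phi>) \<in> charts M"
  show "C_k_on (cdim M) k (\<phi> ` (U \<inter> V)) (\<lambda>z. T (f (inv_into U \<phi> z)))"
    using f U unfolding smooth_on_mfd_iff
    by (intro T[OF chart_image_openin[OF M U V]]) (auto simp: chart_facts(4)[OF M U])
qed

lemma smooth_on_mfd_const: "open V \<Longrightarrow> smooth_on_mfd M V (\<lambda>x. a)"
  unfolding smooth_on_mfd_iff by (intro allI impI C_k_on_const[OF chart_image_openin[OF M]])

lemma smooth_on_mfd_linear:
  assumes "open V" "bounded_linear T" "smooth_on_mfd M V f"
  shows "smooth_on_mfd M V (\<lambda>x. T (f x))"
  by (rule smooth_on_mfd_lift1[OF assms(1,3)]) (rule C_k_on_linear[OF _ assms(2)])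

lemma smooth_on_mfd_inverse:
  assumes "open V" "smooth_on_mfd M V f" "\<And>x. x \<in> V \<Longrightarrow> f x \<noteq> 0"
  shows "smooth_on_mfd M V (\<lambda>x. inverse (f x))"
proof (rule smooth_on_mfd_lift1[OF assms(1,2)])
  fix W k and h :: "(nat \<Rightarrow> complex) \<Rightarrow> complex"
  assume W: "openin (top_of_set (coord_space (cdim M))) W"
    and h: "C_k_on (cdim M) k W h" "\<And>z. z \<in> W \<Longrightarrow> h z \<in> f ` V"
  have "h z \<noteq> 0" if "z \<in> W" for z using h(2)[OF that] assms(3) by force
  then show "C_k_on (cdim M) k W (\<lambda>z. inverse (h z))"
    using h(1) by (intro C_k_on_inverse[OF W])
qed

lemma smooth_on_mfd_add:
  assumes "open V" "smooth_on_mfd M V f" "smooth_on_mfd M V g"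
  shows "smooth_on_mfd M V (\<lambda>x. f x + g x)"
  unfolding smooth_on_mfd_iff
  using assms(2,3) by (intro allI impI C_k_on_add[OF chart_image_openin[OF M _ assms(1)]])
    (simp_all add: smooth_on_mfd_iff)

lemma smooth_on_mfd_mult:
  assumes "open V" "smooth_on_mfd M V f" "smooth_on_mfd M V g"
  shows "smooth_on_mfd M V (\<lambda>x. f x * g x)"
  unfolding smooth_on_mfd_iff
  using assms(2,3) by (intro allI impI C_k_on_mult[OF chart_image_openin[OF M _ assms(1)]])
    (simp_all add: smooth_on_mfd_iff)

lemma smooth_on_mfd_sum:
  assumes "open V" "\<And>j. j \<in> J \<Longrightarrow> smooth_on_mfd M V (f j)"
  shows "smooth_on_mfd M V (\<lambda>x. \<Sum>j\<in>J. f j x)"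
  using assms(2)
proof (induction J rule: infinite_finite_induct)
  case (insert j J)
  then have "smooth_on_mfd M V (\<lambda>x. f j x + (\<Sum>j\<in>J. f j x))"
    by (intro smooth_on_mfd_add assms(1) insert.IH insert.prems) simp_all
  then show ?case using insert.hyps by simp
qed (simp_all add: smooth_on_mfd_const[OF assms(1), of 0])

lemma smooth_on_mfd_prod:
  assumes "open V" "\<And>j. j \<in> J \<Longrightarrow> smooth_on_mfd M V (f j)"
  shows "smooth_on_mfd M V (\<lambda>x. \<Prod>j\<in>J. f j x)"
  using assms(2)
proof (induction J rule: infinite_finite_induct)
  case (insert j J)
  then have "smooth_on_mfd M V (\<lambda>x. f j x * (\<Prod>j\<in>J. f j x))"
    by (intro smooth_on_mfd_mult assms(1) insert.IH insert.prems) simp_all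
  then show ?case using insert.hyps by simp
qed (simp_all add: smooth_on_mfd_const[OF assms(1), of 1])

lemma smooth_on_mfd_local:
  assumes V: "open V"
    and loc: "\<And>x. x \<in> V \<Longrightarrow> \<exists>N. open N \<and> x \<in> N \<and> smooth_on_mfd M (V \<inter> N) f"
  shows "smooth_on_mfd M V f"
  unfolding smooth_on_mfd_iff
proof safe
  fix U \<phi> k assume U: "(U, \<phi>) \<in> charts M"
  note ch = chart_facts[OF M U]
  show "C_k_on (cdim M) k (\<phi> ` (U \<inter> V)) (\<lambda>z. f (inv_into U \<phi> z))"
  proof (rule C_k_on_local[OF _ chart_image_openin[OF M U V]])
    fix z assume "z \<in> \<phi> ` (U \<inter> V)"
    then obtain x where x: "x \<in> U" "x \<in> V" "z = \<phi> x" by blast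
    obtain N where N: "open N" "x \<in> N" "smooth_on_mfd M (V \<inter> N) f" using loc[OF x(2)] by blast
    have "\<phi> ` (U \<inter> V) \<inter> \<phi> ` (U \<inter> N) = \<phi> ` (U \<inter> (V \<inter> N))"
      using inj_onD[OF ch(2)] by blast
    moreover have "C_k_on (cdim M) k (\<phi> ` (U \<inter> (V \<inter> N))) (\<lambda>z. f (inv_into U \<phi> z))"
      using N(3) U unfolding smooth_on_mfd_iff by blast
    ultimately have "C_k_on (cdim M) k (\<phi> ` (U \<inter> V) \<inter> \<phi> ` (U \<inter> N)) (\<lambda>z. f (inv_into U \<phi> z))"
      by simp
    then show "\<exists>N'. openin (top_of_set (coord_space (cdim M))) N' \<and> z \<in> N' \<and>
        C_k_on (cdim M) k (\<phi> ` (U \<inter> V) \<inter> N') (\<lambda>z. f (inv_into U \<phi> z))"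
      using chart_image_openin[OF M U N(1)] x N(2) by (intro exI[of _ "\<phi> ` (U \<inter> N)"]) simp
  qed
qed

lemma smooth_on_mfd_continuous:
  assumes V: "open V" and f: "smooth_on_mfd M V f"
  shows "continuous_on V f"
proof (rule continuous_at_imp_continuous_on, rule ballI)
  fix x assume x: "x \<in> V"
  obtain U \<phi> where U: "(U, \<phi>) \<in> charts M" "x \<in> U" using chart_cover[OF M] .
  note ch = chart_facts[OF M U(1)]
  have "C_k_on (cdim M) 0 (\<phi> ` (U \<inter> V)) (\<lambda>z. f (inv_into U \<phi> z))"
    using f U(1) unfolding smooth_on_mfd_iff by blast
  then have "continuous_on (\<phi> ` (U \<inter> V)) (\<lambda>z. f (inv_into U \<phi> z))" by simp
  then have "continuous_on (U \<inter> V) (\<lambda>x. f (inv_into U \<phi> (\<phi> x)))"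
    by (rule continuous_on_compose2[OF _ continuous_on_subset[OF ch(3)]]) auto
  then have "continuous_on (U \<inter> V) f" by (rule continuous_on_eq) (use ch in auto)
  then show "isCont f x" using V ch(1) U(2) x by (simp add: continuous_on_eq_continuous_at open_Int)
qed

text \<open>Smoothness is encoded by pullback of local smooth functions. In this form it is
  immediate for the identity and is exactly what is applied to matrix entries later.\<close>

definition smooth_self_map :: "('x \<Rightarrow> 'x) \<Rightarrow> bool" where
  "smooth_self_map h \<longleftrightarrow> continuous_on UNIV h \<and>
     (\<forall>V f. open V \<longrightarrow> smooth_on_mfd M V f \<longrightarrow> smooth_on_mfd M (h -` V) (\<lambda>x. f (h x)))"

lemma smooth_self_map_id: "smooth_self_map (\<lambda>x. x)"
  by (simp add: smooth_self_map_def)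

lemma smooth_self_map_vimage: "smooth_self_map h \<Longrightarrow> open V \<Longrightarrow> open (h -` V)"
  by (simp add: smooth_self_map_def open_vimage)

lemma smooth_self_map_pullback:
  "smooth_self_map h \<Longrightarrow> open V \<Longrightarrow> smooth_on_mfd M V f \<Longrightarrow>
     smooth_on_mfd M (h -` V) (\<lambda>x. f (h x))"
  unfolding smooth_self_map_def by (elim conjE allE) (erule (1) impE)+

text \<open>In charts the conjugates of the components of \<open>h\<close> are smooth; conjugating
  back is real-linear, and the chain rule for \<open>C_k_on\<close> does the rest.\<close>

lemma smooth_self_map_antiholomorphic:
  assumes h: "antiholomorphic M h"
  shows "smooth_self_map h"
  unfolding smooth_self_map_def
proof (intro conjI allI impI)
  show hc: "continuous_on UNIV h" using h by (simp add: antiholomorphic_def)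
  fix V f assume V: "open V" and f: "smooth_on_mfd M V f"
  show "smooth_on_mfd M (h -` V) (\<lambda>x. f (h x))"
  proof (rule smooth_on_mfd_local)
    show hV: "open (h -` V)" using hc V by (rule open_vimage[rotated])
    fix x assume x: "x \<in> h -` V"
    obtain V' \<psi> where V': "(V', \<psi>) \<in> charts M" "h x \<in> V'" using chart_cover[OF M] .
    note ch' = chart_facts[OF M V'(1)]
    have hV': "open (h -` V')" using hc ch'(1) by (rule open_vimage[rotated])
    \<comment> \<open>Near \<open>x\<close> the values of \<open>h\<close> lie in one chart, so the
      pullback becomes a composite of maps between coordinate spaces.\<close>
    have "smooth_on_mfd M (h -` V \<inter> h -` V') (\<lambda>x. f (h x))"
      unfolding smooth_on_mfd_def smooth_coord_def
    proof safe
      fix U \<phi> k assume U: "(U, \<phi>) \<in> charts M"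
      note ch = chart_facts[OF M U]
      let ?n = "cdim M" and ?W = "\<phi> ` (U \<inter> (h -` V \<inter> h -` V'))"
      have W: "openin (top_of_set (coord_space ?n)) ?W"
        by (rule chart_image_openin[OF M U open_Int[OF hV hV']])
      have "C_k_on ?n k ?W (\<lambda>z. (\<lambda>y. f (inv_into V' \<psi> y)) (\<psi> (h (inv_into U \<phi> z))))"
      proof (rule C_k_on_compose[where w = "\<lambda>z. \<psi> (h (inv_into U \<phi> z))",
            OF W chart_image_openin[OF M V'(1) V]])
        fix z assume "z \<in> ?W"
        then obtain x where "x \<in> U" "h x \<in> V" "h x \<in> V'" "z = \<phi> x" by blast
        then show "\<psi> (h (inv_into U \<phi> z)) \<in> \<psi> ` (V' \<inter> V)" by (simp add: ch(4))
      next
        show "C_k_on ?n k (\<psi> ` (V' \<inter> V)) (\<lambda>y. f (inv_into V' \<psi> y))"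
          using f V'(1) unfolding smooth_on_mfd_iff by blast
        fix j assume j: "j < ?n"
        have "C_k_on ?n k (\<phi> ` (U \<inter> h -` V')) (\<lambda>z. cnj (\<psi> (h (inv_into U \<phi> z)) j))"
          using antiholomorphic_chart[OF h U V'(1) j] by (simp add: holomorphic_coord_def smooth_coord_def)
        then have "C_k_on ?n k ?W (\<lambda>z. cnj (\<psi> (h (inv_into U \<phi> z)) j))"
          by (rule C_k_on_subset) (intro image_mono Int_mono subset_refl Int_lower2)
        from C_k_on_linear[OF W bounded_linear_cnj this]
        show "C_k_on ?n k ?W (\<lambda>z. \<psi> (h (inv_into U \<phi> z)) j)" by simp
      qed
      then show "C_k_on ?n k ?W (\<lambda>z. f (h (inv_into U \<phi> z)))"
        by (rule C_k_on_cong[OF W, THEN iffD1, rotated]) (auto simp: ch(4) ch'(4))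
    qed
    then show "\<exists>N. open N \<and> x \<in> N \<and> smooth_on_mfd M (h -` V \<inter> N) (\<lambda>x. f (h x))"
      using hV' V'(2) by (intro exI[of _ "h -` V'"]) simp
  qed
qed

end

section \<open>Semilinear maps of a smooth vector bundle\<close>

locale smooth_vector_bundle =
  fixes M :: "'x::{t2_space, second_countable_topology} cmanifold" and E :: "('e, 'x) cvbundle"
  assumes M: "complex_manifold M" and E: "smooth_bundle M E"
begin

lemma fibre_zero: "vzero E x \<in> fibre E x"
proof -
  have "\<forall>x. vzero E x \<in> fibre E x" using E unfolding smooth_bundle_def by (elim conjE)
  then show ?thesis by simp
qed

lemma fibre_add: "u \<in> fibre E x \<Longrightarrow> v \<in> fibre E x \<Longrightarrow> vadd E u v \<in> fibre E x"
proof -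
  have "\<forall>x. \<forall>u\<in>fibre E x. \<forall>v\<in>fibre E x. vadd E u v \<in> fibre E x"
    using E unfolding smooth_bundle_def by (elim conjE)
  then show "u \<in> fibre E x \<Longrightarrow> v \<in> fibre E x \<Longrightarrow> vadd E u v \<in> fibre E x" by simp
qed

lemma fibre_scale: "u \<in> fibre E x \<Longrightarrow> vscale E c u \<in> fibre E x"
proof -
  have "\<forall>x. \<forall>c. \<forall>u\<in>fibre E x. vscale E c u \<in> fibre E x"
    using E unfolding smooth_bundle_def by (elim conjE)
  then show "u \<in> fibre E x \<Longrightarrow> vscale E c u \<in> fibre E x" by simp
qed

lemma triv_cover: obtains U \<tau> where "(U, \<tau>) \<in> trivs E" "x \<in> U"
proof -
  have "(\<Union>(U, \<tau>)\<in>trivs E. U) = UNIV"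
    using E unfolding smooth_bundle_def by (elim conjE)
  then have "x \<in> (\<Union>(U, \<tau>)\<in>trivs E. U)" by simp
  then show thesis using that by auto
qed

lemma triv:
  assumes "(U, \<tau>) \<in> trivs E"
  shows triv_open: "open U"
    and triv_bij: "x \<in> U \<Longrightarrow> bij_betw \<tau> (fibre E x) (coord_space (brank E))"
    and triv_zero: "x \<in> U \<Longrightarrow> \<tau> (vzero E x) = (\<lambda>i. 0)"
    and triv_add: "x \<in> U \<Longrightarrow> u \<in> fibre E x \<Longrightarrow> v \<in> fibre E x \<Longrightarrow> \<tau> (vadd E u v) = (\<lambda>i. \<tau> u i + \<tau> v i)"
    and triv_scale: "x \<in> U \<Longrightarrow> u \<in> fibre E x \<Longrightarrow> \<tau> (vscale E c u) = (\<lambda>i. c * \<tau> u i)"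
proof -
  have "\<forall>(U, \<tau>)\<in>trivs E. open U \<and>
        (\<forall>x\<in>U. bij_betw \<tau> (fibre E x) (coord_space (brank E)) \<and>
           \<tau> (vzero E x) = (\<lambda>i. 0) \<and>
           (\<forall>u\<in>fibre E x. \<forall>v\<in>fibre E x. \<tau> (vadd E u v) = (\<lambda>i. \<tau> u i + \<tau> v i)) \<and>
           (\<forall>c. \<forall>u\<in>fibre E x. \<tau> (vscale E c u) = (\<lambda>i. c * \<tau> u i)))"
    using E unfolding smooth_bundle_def by (elim conjE)
  from bspec[OF this assms]
  show "open U"
    and "x \<in> U \<Longrightarrow> bij_betw \<tau> (fibre E x) (coord_space (brank E))"
    and "x \<in> U \<Longrightarrow> \<tau> (vzero E x) = (\<lambda>i. 0)"
    and "x \<in> U \<Longrightarrow> u \<in> fibre E x \<Longrightarrow> v \<in> fibre E x \<Longrightarrow> \<tau> (vadd E u v) = (\<lambda>i. \<tau> u i + \<tau> v i)"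
    and "x \<in> U \<Longrightarrow> u \<in> fibre E x \<Longrightarrow> \<tau> (vscale E c u) = (\<lambda>i. c * \<tau> u i)"
    by simp_all
qed

lemma triv_transition:
  assumes "(U, \<tau>) \<in> trivs E" "(V, \<rho>) \<in> trivs E" "j < brank E" "i < brank E"
  shows "smooth_on_mfd M (U \<inter> V) (\<lambda>x. \<rho> (frame E \<tau> j x) i)"
proof -
  have "\<forall>(U, \<tau>)\<in>trivs E. \<forall>(V, \<rho>)\<in>trivs E. \<forall>j<brank E. \<forall>i<brank E.
        smooth_on_mfd M (U \<inter> V) (\<lambda>x. \<rho> (frame E \<tau> j x) i)"
    using E unfolding smooth_bundle_def by (elim conjE)
  from bspec[OF this assms(1)] have "\<forall>(V, \<rho>)\<in>trivs E. \<forall>j<brank E. \<forall>i<brank E.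
        smooth_on_mfd M (U \<inter> V) (\<lambda>x. \<rho> (frame E \<tau> j x) i)" by simp
  from bspec[OF this assms(2)] assms(3,4) show ?thesis by simp
qed

text \<open>All vector space identities in the fibres are verified through this: apply a
  trivialization, and the identity becomes one between complex numbers.\<close>

lemma fibre_eqI:
  assumes "(U, \<tau>) \<in> trivs E" "x \<in> U" "u \<in> fibre E x" "v \<in> fibre E x" "\<tau> u = \<tau> v"
  shows "u = v"
  using triv_bij[OF assms(1,2)] assms(3-5) by (auto simp: bij_betw_def dest: inj_onD)

lemma ex_coords:
  assumes "(U, \<tau>) \<in> trivs E" "x \<in> U" "y \<in> coord_space (brank E)"
  obtains e where "e \<in> fibre E x" "\<tau> e = y"
proof -
  have "y \<in> \<tau> ` fibre E x" using triv_bij[OF assms(1,2)] assms(3) by (simp add: bij_betw_def)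
  then show thesis using that by blast
qed

lemma triv_coords:
  assumes "(U, \<tau>) \<in> trivs E" "x \<in> U" "e \<in> fibre E x"
  shows "\<tau> e \<in> coord_space (brank E)"
  using triv_bij[OF assms(1,2)] assms(3) by (auto simp: bij_betw_def)

lemma frame_fibre:
  assumes t: "(U, \<tau>) \<in> trivs E" "x \<in> U" and j: "j < brank E"
  shows "frame E \<tau> j x \<in> fibre E x" and "\<tau> (frame E \<tau> j x) = unit_coord j"
proof -
  have "unit_coord j \<in> coord_space (brank E)" using j by (auto simp: unit_coord_def coord_space_def)
  then have "unit_coord j \<in> \<tau> ` fibre E x" using triv_bij[OF t] by (simp add: bij_betw_def)
  then show "frame E \<tau> j x \<in> fibre E x" and "\<tau> (frame E \<tau> j x) = unit_coord j"
    by (simp_all add: frame_def inv_into_into f_inv_into_f)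
qed

lemma mem_fibre_iff: "e \<in> fibre E x \<longleftrightarrow> e \<in> total E \<and> bproj E e = x"
  by (auto simp: fibre_def)

lemma vscale_0: "u \<in> fibre E x \<Longrightarrow> vscale E 0 u = vzero E x"
proof -
  assume u: "u \<in> fibre E x"
  obtain U \<tau> where t: "(U, \<tau>) \<in> trivs E" "x \<in> U" by (rule triv_cover)
  show ?thesis
    by (rule fibre_eqI[OF t fibre_scale[OF u] fibre_zero]) (simp add: triv_scale[OF t u] triv_zero[OF t])
qed

lemma vscale_1: "u \<in> fibre E x \<Longrightarrow> vscale E 1 u = u"
proof -
  assume u: "u \<in> fibre E x"
  obtain U \<tau> where t: "(U, \<tau>) \<in> trivs E" "x \<in> U" by (rule triv_cover)
  show ?thesis
    by (rule fibre_eqI[OF t fibre_scale[OF u] u]) (simp add: triv_scale[OF t u])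
qed

lemma vscale_vscale: "u \<in> fibre E x \<Longrightarrow> vscale E a (vscale E b u) = vscale E (a * b) u"
proof -
  assume u: "u \<in> fibre E x"
  obtain U \<tau> where t: "(U, \<tau>) \<in> trivs E" "x \<in> U" by (rule triv_cover)
  show ?thesis
    by (rule fibre_eqI[OF t])
      (simp_all add: triv_scale[OF t] fibre_scale u mult.assoc)
qed

text \<open>\<open>c\<close> is the identity for linear maps and \<open>cnj\<close> for antilinear
  ones, \<open>g\<close> the map covered on the base. Composition composes both, so \<sigma> \<phi>
  with \<sigma> inverse on the right needs no separate theory.\<close>

definition semilinear :: "(complex \<Rightarrow> complex) \<Rightarrow> ('x \<Rightarrow> 'x) \<Rightarrow> ('e \<Rightarrow> 'e) \<Rightarrow> bool" where
  "semilinear c g F \<longleftrightarrow>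
     (\<forall>x. \<forall>u\<in>fibre E x. F u \<in> fibre E (g x)) \<and>
     (\<forall>x. \<forall>u\<in>fibre E x. \<forall>v\<in>fibre E x. F (vadd E u v) = vadd E (F u) (F v)) \<and>
     (\<forall>x a. \<forall>u\<in>fibre E x. F (vscale E a u) = vscale E (c a) (F u))"

lemma semilinearD:
  assumes "semilinear c g F"
  shows "u \<in> fibre E x \<Longrightarrow> F u \<in> fibre E (g x)"
    "u \<in> fibre E x \<Longrightarrow> v \<in> fibre E x \<Longrightarrow> F (vadd E u v) = vadd E (F u) (F v)"
    "u \<in> fibre E x \<Longrightarrow> F (vscale E a u) = vscale E (c a) (F u)"
  using assms by (simp_all add: semilinear_def)

lemma semilinear_compose:
  assumes F: "semilinear c g F" and G: "semilinear c' g' G"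
  shows "semilinear (\<lambda>a. c (c' a)) (\<lambda>x. g (g' x)) (\<lambda>e. F (G e))"
proof -
  note Fd = semilinearD[OF F] and Gd = semilinearD[OF G]
  show ?thesis
    unfolding semilinear_def
    using Fd(1)[OF Gd(1)] Fd(2)[OF Gd(1) Gd(1)] Fd(3)[OF Gd(1)]
    by (intro conjI allI ballI) (simp_all add: Gd)
qed

lemma semilinear_cong:
  assumes F: "semilinear c g F" and FG: "\<And>e. e \<in> total E \<Longrightarrow> G e = F e"
  shows "semilinear c g G"
proof -
  have "G e = F e" if "e \<in> fibre E x" for e x using FG that by (simp add: mem_fibre_iff)
  note G = this[OF fibre_add] this[OF fibre_scale] this
  show ?thesis
    unfolding semilinear_def
    using semilinearD[OF F] by (intro conjI allI ballI) (simp_all add: G)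
qed

text \<open>Fibres come with a binary addition only, so the expansion in the frame is an induction
  on the number \<open>m\<close> of coordinates that may be nonzero.\<close>

lemma frame_expansion:
  assumes F: "semilinear c g F" and c: "c 0 = 0"
    and t: "(U, \<tau>) \<in> trivs E" "x \<in> U" and t': "(V, \<rho>) \<in> trivs E" "g x \<in> V"
    and e: "e \<in> fibre E x"
  shows "\<rho> (F e) i = (\<Sum>j<brank E. c (\<tau> e j) * \<rho> (F (frame E \<tau> j x)) i)"
proof -
  note Fd = semilinearD[OF F]
  have "\<rho> (F e) i = (\<Sum>j<m. c (\<tau> e j) * \<rho> (F (frame E \<tau> j x)) i)"
    if "m \<le> brank E" "e \<in> fibre E x" "\<tau> e \<in> coord_space m" for m e
    using that
  proof (induction m arbitrary: e)
    case 0
    have "\<tau> e = (\<lambda>i. 0)" using 0(3) by (auto simp: coord_space_def)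
    \<comment> \<open>An element with vanishing coordinates is 0 times itself, so
      \<open>c 0 = 0\<close> forces the coordinates of its image to vanish.\<close>
    then have "vscale E 0 e = e"
      using 0(2) by (intro fibre_eqI[OF t]) (simp_all add: fibre_scale triv_scale[OF t])
    then have "\<rho> (F e) = (\<lambda>i. c 0 * \<rho> (F e) i)"
      using Fd(3)[OF 0(2), of 0] triv_scale[OF t' Fd(1)[OF 0(2)]] by metis
    then have "\<rho> (F e) i = c 0 * \<rho> (F e) i" by (rule fun_cong)
    then show ?case using c by simp
  next
    case (Suc m)
    then have m: "m < brank E" by simp
    let ?f = "frame E \<tau> m x"
    note f = frame_fibre[OF t m]
    \<comment> \<open>Removing the component along the frame vector of index \<open>m\<close> leaves
      at most \<open>m\<close> nonzero coordinates.\<close>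
    define e' where "e' = vadd E e (vscale E (- \<tau> e m) ?f)"
    have e': "e' \<in> fibre E x" unfolding e'_def using Suc.prems f by (intro fibre_add fibre_scale)
    have te': "\<tau> e' = (\<lambda>i. \<tau> e i - \<tau> e m * unit_coord m i)"
      unfolding e'_def using Suc.prems f by (simp add: triv_add[OF t] triv_scale[OF t] fibre_scale)
    have sp: "\<tau> e' \<in> coord_space m"
    proof -
      have "\<tau> e' i = 0" if "m \<le> i" for i
        using that Suc.prems(3) by (cases "i = m") (simp_all add: te' coord_space_def unit_coord_def)
      then show ?thesis by (simp add: coord_space_def)
    qed
    have "e = vadd E e' (vscale E (\<tau> e m) ?f)"
      using Suc.prems(2) e' f
      by (intro fibre_eqI[OF t]) (simp_all add: fibre_add fibre_scale triv_add[OF t] triv_scale[OF t] te')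
    then have "F e = vadd E (F e') (vscale E (c (\<tau> e m)) (F ?f))"
      using Fd(2)[OF e' fibre_scale[OF f(1)]] Fd(3)[OF f(1)] by metis
    then have "\<rho> (F e) i = \<rho> (F e') i + c (\<tau> e m) * \<rho> (F ?f) i"
      using triv_add[OF t' Fd(1)[OF e'] fibre_scale[OF Fd(1)[OF f(1)]]] triv_scale[OF t' Fd(1)[OF f(1)]]
      by simp
    moreover have "\<rho> (F e') i = (\<Sum>j<m. c (\<tau> e' j) * \<rho> (F (frame E \<tau> j x)) i)"
      using Suc.IH[OF _ e' sp] m by simp
    moreover have "\<tau> e' j = \<tau> e j" if "j < m" for j using that by (simp add: te' unit_coord_def)
    ultimately show ?case by simp
  qed
  from this[OF order_refl e triv_coords[OF t e]] show ?thesis .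
qed

text \<open>
  Smooth sections over \<open>W\<close> of the pullback of \<open>E\<close> along \<open>h\<close>. With \<open>h\<close> the identity or the involution,
  these turn smoothness of all composites of linear and antilinear bundle maps into one lemma.
\<close>

definition smooth_lift :: "('x \<Rightarrow> 'x) \<Rightarrow> 'x set \<Rightarrow> ('x \<Rightarrow> 'e) \<Rightarrow> bool" where
  "smooth_lift h W e \<longleftrightarrow> (\<forall>x\<in>W. e x \<in> fibre E (h x)) \<and>
     (\<forall>U \<tau> i. (U, \<tau>) \<in> trivs E \<longrightarrow> i < brank E \<longrightarrow> smooth_on_mfd M (W \<inter> h -` U) (\<lambda>x. \<tau> (e x) i))"

lemma smooth_fibre_map_iff: "smooth_fibre_map M E E g F \<longleftrightarrow>
    (\<forall>U \<tau> V \<rho> j i. (U, \<tau>) \<in> trivs E \<longrightarrow> (V, \<rho>) \<in> trivs E \<longrightarrow> j < brank E \<longrightarrow> i < brank E \<longrightarrow>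
       smooth_on_mfd M (U \<inter> g -` V) (\<lambda>x. \<rho> (F (frame E \<tau> j x)) i))"
proof
  assume *: "smooth_fibre_map M E E g F"
  show "\<forall>U \<tau> V \<rho> j i. (U, \<tau>) \<in> trivs E \<longrightarrow> (V, \<rho>) \<in> trivs E \<longrightarrow> j < brank E \<longrightarrow> i < brank E \<longrightarrow>
       smooth_on_mfd M (U \<inter> g -` V) (\<lambda>x. \<rho> (F (frame E \<tau> j x)) i)"
  proof (intro allI impI)
    fix U \<tau> V \<rho> j i
    assume t: "(U, \<tau>) \<in> trivs E" "(V, \<rho>) \<in> trivs E" "j < brank E" "i < brank E"
    from bspec[OF *[unfolded smooth_fibre_map_def] t(1)]
    have "\<forall>(V, \<rho>)\<in>trivs E. \<forall>j<brank E. \<forall>i<brank E.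
        smooth_on_mfd M (U \<inter> g -` V) (\<lambda>x. \<rho> (F (frame E \<tau> j x)) i)" by simp
    from bspec[OF this t(2)] t(3,4)
    show "smooth_on_mfd M (U \<inter> g -` V) (\<lambda>x. \<rho> (F (frame E \<tau> j x)) i)" by simp
  qed
next
  assume "\<forall>U \<tau> V \<rho> j i. (U, \<tau>) \<in> trivs E \<longrightarrow> (V, \<rho>) \<in> trivs E \<longrightarrow> j < brank E \<longrightarrow> i < brank E \<longrightarrow>
       smooth_on_mfd M (U \<inter> g -` V) (\<lambda>x. \<rho> (F (frame E \<tau> j x)) i)"
  then show "smooth_fibre_map M E E g F"
    unfolding smooth_fibre_map_def by (intro ballI) (simp add: case_prod_beta)
qed

text \<open>\<open>F\<close> is typically a restriction to \<open>total E\<close>, or an inverse,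
  and \<open>G\<close> the formula it is given by; smoothness is verified for \<open>G\<close> along
  the frames.\<close>

lemma smooth_fibre_mapI:
  assumes lift: "\<And>U \<tau> j. (U, \<tau>) \<in> trivs E \<Longrightarrow> j < brank E \<Longrightarrow> smooth_lift g U (\<lambda>x. G (frame E \<tau> j x))"
    and FG: "\<And>e. e \<in> total E \<Longrightarrow> F e = G e" and g: "smooth_self_map M g"
  shows "smooth_fibre_map M E E g F"
  unfolding smooth_fibre_map_iff
proof (intro allI impI)
  fix U \<tau> V \<rho> j i
  assume t: "(U, \<tau>) \<in> trivs E" and t': "(V, \<rho>) \<in> trivs E" and ij: "j < brank E" "i < brank E"
  show "smooth_on_mfd M (U \<inter> g -` V) (\<lambda>x. \<rho> (F (frame E \<tau> j x)) i)"
  proof (rule smooth_on_mfd_cong[OF M])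
    show "open (U \<inter> g -` V)"
      using triv_open[OF t] smooth_self_map_vimage[OF M g triv_open[OF t']] by (rule open_Int)
    show "\<rho> (F (frame E \<tau> j x)) i = \<rho> (G (frame E \<tau> j x)) i" if "x \<in> U \<inter> g -` V" for x
      using frame_fibre(1)[OF t _ ij(1), of x] that FG by (simp add: mem_fibre_iff)
    show "smooth_on_mfd M (U \<inter> g -` V) (\<lambda>x. \<rho> (G (frame E \<tau> j x)) i)"
      using lift[OF t ij(1)] t' ij(2) by (simp add: smooth_lift_def)
  qed
qed

lemma smooth_lift_frame:
  assumes "(U, \<tau>) \<in> trivs E" "j < brank E"
  shows "smooth_lift (\<lambda>x. x) U (frame E \<tau> j)"
  unfolding smooth_lift_def
  using frame_fibre(1)[OF assms(1) _ assms(2)] triv_transition[OF assms(1) _ assms(2)] by simp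

text \<open>Locally, the coordinates of \<open>F (e x)\<close> are sums of the
  \<open>c\<close>-images of the coordinates of \<open>e x\<close> times matrix entries of
  \<open>F\<close> pulled back along \<open>h\<close>. The former are smooth because
  \<open>c\<close> is real-linear, the latter because \<open>h\<close> is a smooth self-map.\<close>

lemma smooth_lift_map:
  assumes W: "open W" and h: "smooth_self_map M h" and g: "smooth_self_map M g"
    and F: "semilinear c g F" "smooth_fibre_map M E E g F" and c: "bounded_linear c"
    and e: "smooth_lift h W e"
  shows "smooth_lift (\<lambda>x. g (h x)) W (\<lambda>x. F (e x))"
  unfolding smooth_lift_def
proof (intro conjI ballI allI impI)
  have ef: "e x \<in> fibre E (h x)" if "x \<in> W" for x using e that by (simp add: smooth_lift_def)
  then show "F (e x) \<in> fibre E (g (h x))" if "x \<in> W" for x using that semilinearD(1)[OF F(1)] by simp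
  fix V \<rho> i assume t': "(V, \<rho>) \<in> trivs E" and i: "i < brank E"
  have o: "open (g -` V)" by (rule smooth_self_map_vimage[OF M g triv_open[OF t']])
  have o': "open (W \<inter> (\<lambda>x. g (h x)) -` V)"
    using open_Int[OF W smooth_self_map_vimage[OF M h o]] by (simp add: vimage_def)
  show "smooth_on_mfd M (W \<inter> (\<lambda>x. g (h x)) -` V) (\<lambda>x. \<rho> (F (e x)) i)"
  proof (rule smooth_on_mfd_local[OF M o'])
    fix x assume x: "x \<in> W \<inter> (\<lambda>x. g (h x)) -` V"
    obtain U \<tau> where t: "(U, \<tau>) \<in> trivs E" "h x \<in> U" by (rule triv_cover)
    have oU: "open (h -` U)" by (rule smooth_self_map_vimage[OF M h triv_open[OF t(1)]])
    let ?N = "W \<inter> (\<lambda>x. g (h x)) -` V \<inter> h -` U"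
    have "smooth_on_mfd M ?N (\<lambda>x. \<rho> (F (e x)) i)"
    proof (rule smooth_on_mfd_cong[OF M])
      show oN: "open ?N" using o' oU by (rule open_Int)
      show "\<rho> (F (e y)) i = (\<Sum>j<brank E. c (\<tau> (e y) j) * \<rho> (F (frame E \<tau> j (h y))) i)"
        if "y \<in> ?N" for y
        using that ef by (intro frame_expansion[OF F(1) _ t(1) _ t'] linear_simps(3)[OF c]) auto
      show "smooth_on_mfd M ?N (\<lambda>y. \<Sum>j<brank E. c (\<tau> (e y) j) * \<rho> (F (frame E \<tau> j (h y))) i)"
      proof (rule smooth_on_mfd_sum[OF M oN])
        fix j assume "j \<in> {..<brank E}"
        then have j: "j < brank E" by simp
        have "smooth_on_mfd M (W \<inter> h -` U) (\<lambda>y. \<tau> (e y) j)"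
          using e t(1) j by (simp add: smooth_lift_def)
        then have 1: "smooth_on_mfd M ?N (\<lambda>y. \<tau> (e y) j)" by (rule smooth_on_mfd_subset) auto
        have "smooth_on_mfd M (U \<inter> g -` V) (\<lambda>y. \<rho> (F (frame E \<tau> j y)) i)"
          using F(2) t(1) t' i j by (simp add: smooth_fibre_map_iff)
        then have "smooth_on_mfd M (h -` (U \<inter> g -` V)) (\<lambda>y. \<rho> (F (frame E \<tau> j (h y))) i)"
          by (rule smooth_self_map_pullback[OF M h open_Int[OF triv_open[OF t(1)] o]])
        then have 2: "smooth_on_mfd M ?N (\<lambda>y. \<rho> (F (frame E \<tau> j (h y))) i)"
          by (rule smooth_on_mfd_subset) auto
        show "smooth_on_mfd M ?N (\<lambda>y. c (\<tau> (e y) j) * \<rho> (F (frame E \<tau> j (h y))) i)"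
          by (intro smooth_on_mfd_mult[OF M oN] smooth_on_mfd_linear[OF M oN c] 1 2)
      qed
    qed
    then show "\<exists>N. open N \<and> x \<in> N \<and> smooth_on_mfd M (W \<inter> (\<lambda>x. g (h x)) -` V \<inter> N) (\<lambda>x. \<rho> (F (e x)) i)"
      using oU t(2) by (intro exI[of _ "h -` U"]) simp
  qed
qed

lemma sections_iff: "s \<in> sections M E \<longleftrightarrow> smooth_lift (\<lambda>x. x) UNIV s"
  by (auto simp: sections_def smooth_lift_def)

lemma semilinear_id: "semilinear (\<lambda>a. a) (\<lambda>x. x) (\<lambda>e. e)"
  by (simp add: semilinear_def)

section \<open>The algebra of bundle endomorphisms\<close>

lemma bundle_hom_iff: "F \<in> bundle_hom M E E \<longleftrightarrow> F \<in> extensional (total E) \<and>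
    semilinear (\<lambda>a. a) (\<lambda>x. x) F \<and> smooth_fibre_map M E E (\<lambda>x. x) F"
  unfolding bundle_hom_def semilinear_def PiE_def
  by (auto simp: mem_fibre_iff Pi_def)

lemma smooth_fibre_map_compose:
  assumes F: "semilinear c g F" "smooth_fibre_map M E E g F" and c: "bounded_linear c"
    and g: "smooth_self_map M g" and G: "semilinear c' h G" "smooth_fibre_map M E E h G"
    and c': "bounded_linear c'" and h: "smooth_self_map M h" and gh: "smooth_self_map M (\<lambda>x. g (h x))"
    and H: "\<And>e. e \<in> total E \<Longrightarrow> H e = F (G e)"
  shows "smooth_fibre_map M E E (\<lambda>x. g (h x)) H"
proof (rule smooth_fibre_mapI[OF _ H gh])
  fix U \<tau> j assume t: "(U, \<tau>) \<in> trivs E" and j: "j < brank E"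
  have "smooth_lift h U (\<lambda>x. G (frame E \<tau> j x))"
    using smooth_lift_map[OF triv_open[OF t] smooth_self_map_id[OF M] h G c' smooth_lift_frame[OF t j]] by simp
  then show "smooth_lift (\<lambda>x. g (h x)) U (\<lambda>x. F (G (frame E \<tau> j x)))"
    by (rule smooth_lift_map[OF triv_open[OF t] h g F c])
qed

lemma bundle_hom_compose:
  assumes F: "F \<in> bundle_hom M E E" and G: "G \<in> bundle_hom M E E"
  shows "restrict (\<lambda>e. F (G e)) (total E) \<in> bundle_hom M E E"
proof -
  note F = F[unfolded bundle_hom_iff] and G = G[unfolded bundle_hom_iff]
  show ?thesis
    unfolding bundle_hom_iff
    using F G semilinear_cong[OF semilinear_compose[of "\<lambda>a. a" "\<lambda>x. x" F "\<lambda>a. a" "\<lambda>x. x" G]]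
      smooth_fibre_map_compose[of _ _ F _ _ G, OF _ _ bounded_linear_ident smooth_self_map_id[OF M] _ _
        bounded_linear_ident smooth_self_map_id[OF M] smooth_self_map_id[OF M]]
    by simp
qed

lemma sections_map:
  assumes F: "F \<in> bundle_hom M E E" and s: "s \<in> sections M E"
  shows "F \<circ> s \<in> sections M E"
  using smooth_lift_map[OF open_UNIV smooth_self_map_id[OF M] smooth_self_map_id[OF M] _ _
      bounded_linear_ident, of F s] F s
  by (simp add: sections_iff bundle_hom_iff o_def)

text \<open>Shifts u + T, real and imaginary parts of an endomorphism, and scalar multiples (with
  \<open>b = 0\<close>) are all of this form, so smoothness and parallelity are proved once for all
  of them.\<close>

definition hom_lincomb :: "complex \<Rightarrow> ('e \<Rightarrow> 'e) \<Rightarrow> complex \<Rightarrow> ('e \<Rightarrow> 'e) \<Rightarrow> 'e \<Rightarrow> 'e" where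
  "hom_lincomb a F b G = (\<lambda>e\<in>total E. vadd E (vscale E a (F e)) (vscale E b (G e)))"

lemma bundle_hom_lincomb:
  assumes F: "F \<in> bundle_hom M E E" and G: "G \<in> bundle_hom M E E"
  shows "hom_lincomb a F b G \<in> bundle_hom M E E"
proof -
  note F = F[unfolded bundle_hom_iff] and G = G[unfolded bundle_hom_iff]
  let ?H = "hom_lincomb a F b G"
  note Fd = semilinearD[OF conjunct1[OF conjunct2[OF F]]]
  note Gd = semilinearD[OF conjunct1[OF conjunct2[OF G]]]
  have H: "?H u = vadd E (vscale E a (F u)) (vscale E b (G u))" if "u \<in> fibre E x" for u x
    using that by (simp add: hom_lincomb_def mem_fibre_iff)
  have co: "\<tau> (?H u) = (\<lambda>i. a * \<tau> (F u) i + b * \<tau> (G u) i)"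
    if "(U, \<tau>) \<in> trivs E" "x \<in> U" "u \<in> fibre E x" for U \<tau> x u
    using that by (simp add: H Fd Gd fibre_scale triv_add[OF that(1,2)] triv_scale[OF that(1,2)])
  have Hf: "?H u \<in> fibre E x" if "u \<in> fibre E x" for u x
    using that by (simp add: H Fd Gd fibre_scale fibre_add)
  have "semilinear (\<lambda>a. a) (\<lambda>x. x) ?H"
    unfolding semilinear_def
  proof (intro conjI allI ballI)
    fix x u assume u: "u \<in> fibre E x"
    show "?H u \<in> fibre E x" by (rule Hf[OF u])
    obtain U \<tau> where t: "(U, \<tau>) \<in> trivs E" "x \<in> U" by (rule triv_cover)
    note simps = co[OF t] triv_add[OF t] triv_scale[OF t] fibre_add fibre_scale Hf Fd Gd
    show "?H (vscale E c u) = vscale E c (?H u)" for c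
      using u by (intro fibre_eqI[OF t]) (simp_all add: simps algebra_simps)
    fix v assume v: "v \<in> fibre E x"
    show "?H (vadd E u v) = vadd E (?H u) (?H v)"
      using u v by (intro fibre_eqI[OF t]) (simp_all add: simps algebra_simps)
  qed
  moreover have "smooth_fibre_map M E E (\<lambda>x. x) ?H"
    unfolding smooth_fibre_map_iff
  proof (intro allI impI)
    fix U \<tau> V \<rho> j i
    assume t: "(U, \<tau>) \<in> trivs E" and t': "(V, \<rho>) \<in> trivs E" and ij: "j < brank E" "i < brank E"
    have o: "open (U \<inter> (\<lambda>x. x) -` V)"  using open_Int[OF triv_open[OF t] triv_open[OF t']] by simp
    show "smooth_on_mfd M (U \<inter> (\<lambda>x. x) -` V) (\<lambda>x. \<rho> (?H (frame E \<tau> j x)) i)"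
    proof (rule smooth_on_mfd_cong[OF M o])
      show "\<rho> (?H (frame E \<tau> j x)) i = a * \<rho> (F (frame E \<tau> j x)) i + b * \<rho> (G (frame E \<tau> j x)) i"
        if "x \<in> U \<inter> (\<lambda>x. x) -` V" for x
        using that co[OF t' _ frame_fibre(1)[OF t _ ij(1)], of x] by simp
      show "smooth_on_mfd M (U \<inter> (\<lambda>x. x) -` V)
          (\<lambda>x. a * \<rho> (F (frame E \<tau> j x)) i + b * \<rho> (G (frame E \<tau> j x)) i)"
        using F G t t' ij
        by (intro smooth_on_mfd_add[OF M o] smooth_on_mfd_mult[OF M o] smooth_on_mfd_const[OF M o])
          (simp_all add: smooth_fibre_map_iff)
    qed
  qed
  ultimately show ?thesis by (simp add: bundle_hom_iff hom_lincomb_def)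
qed

end

section \<open>Inverses of bundle endomorphisms\<close>

text \<open>Cramer's rule, with matrices given by their entries so that they can depend on a point.\<close>

definition entry_det :: "nat \<Rightarrow> (nat \<Rightarrow> nat \<Rightarrow> complex) \<Rightarrow> complex" where
  "entry_det n a = Determinant.det (Matrix.mat n n (\<lambda>(i, j). a i j))"

definition entry_adj :: "nat \<Rightarrow> (nat \<Rightarrow> nat \<Rightarrow> complex) \<Rightarrow> nat \<Rightarrow> nat \<Rightarrow> complex" where
  "entry_adj n a i j = adj_mat (Matrix.mat n n (\<lambda>(i, j). a i j)) $$ (i, j)"

text \<open>Leibniz' formula displays the determinant as a polynomial in the entries, which makes it
  smooth as soon as the entries are.\<close>

lemma entry_det_expand:
  "entry_det n a = (\<Sum>p | p permutes {0..<n}. signof p * (\<Prod>i = 0..<n. a i (p i)))"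
proof -
  have "p i < n" if "p permutes {0..<n}" "i < n" for p i
    using permutes_in_image[OF that(1), of i] that(2) by simp
  then show ?thesis
    unfolding entry_det_def by (subst det_def'[of _ n]) (auto intro!: sum.cong prod.cong)
qed

text \<open>Adjugate entries are signed minors, so their smoothness reduces to that of determinants.
  The index shifts skip row \<open>j\<close> and column \<open>i\<close>, the transposition being
  that of the adjugate.\<close>

lemma entry_adj_expand:
  assumes "i < n" "j < n"
  shows "entry_adj n a i j = (- 1) ^ (j + i) *
     entry_det (n - 1) (\<lambda>k l. a (if k < j then k else Suc k) (if l < i then l else Suc l))"
proof -
  let ?A = "Matrix.mat n n (\<lambda>(i, j). a i j)"
  have "mat_delete ?A j i = Matrix.mat (n - 1) (n - 1)
      (\<lambda>(k, l). a (if k < j then k else Suc k) (if l < i then l else Suc l))"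
    unfolding mat_delete_def using assms by (intro eq_matI) auto
  then show ?thesis
    using assms by (simp add: entry_adj_def entry_det_def adj_mat_def cofactor_def)
qed

lemma entry_adj_mult:
  assumes ij: "i < n" "j < n"
  shows "(\<Sum>k<n. entry_adj n a i k * a k j) = (if i = j then entry_det n a else 0)"
    and "(\<Sum>k<n. a i k * entry_adj n a k j) = (if i = j then entry_det n a else 0)"
proof -
  let ?A = "Matrix.mat n n (\<lambda>(i, j). a i j)"
  have A: "?A \<in> carrier_mat n n" by simp
  note adj = adj_mat[OF A]
  have "(adj_mat ?A * ?A) $$ (i, j) = (\<Sum>k<n. entry_adj n a i k * a k j)"
    using ij adj(1) by (auto simp: times_mat_def scalar_prod_def entry_adj_def atLeast0LessThan intro!: sum.cong)
  then show "(\<Sum>k<n. entry_adj n a i k * a k j) = (if i = j then entry_det n a else 0)"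
    unfolding adj(3) entry_det_def using ij by auto
  have "(?A * adj_mat ?A) $$ (i, j) = (\<Sum>k<n. a i k * entry_adj n a k j)"
    using ij adj(1) by (auto simp: times_mat_def scalar_prod_def entry_adj_def atLeast0LessThan intro!: sum.cong)
  then show "(\<Sum>k<n. a i k * entry_adj n a k j) = (if i = j then entry_det n a else 0)"
    unfolding adj(2) entry_det_def using ij by auto
qed

lemma entry_det_nonzero:
  assumes "\<And>v i. (\<And>i. i < n \<Longrightarrow> (\<Sum>j<n. a i j * v j) = 0) \<Longrightarrow> i < n \<Longrightarrow> v i = 0"
  shows "entry_det n a \<noteq> 0"
proof
  let ?A = "Matrix.mat n n (\<lambda>(i, j). a i j)"
  assume "entry_det n a = 0"
  then obtain v where v: "v \<in> carrier_vec n" "v \<noteq> 0\<^sub>v n" "?A *\<^sub>v v = 0\<^sub>v n"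
    using det_0_iff_vec_prod_zero_field[of ?A n] by (auto simp: entry_det_def)
  have "(\<Sum>j<n. a i j * vec_index v j) = 0" if "i < n" for i
  proof -
    have "(\<Sum>j<n. a i j * vec_index v j) = vec_index (?A *\<^sub>v v) i"
      using that v(1) by (auto simp: mult_mat_vec_def scalar_prod_def atLeast0LessThan intro!: sum.cong)
    then show ?thesis using that v(3) by simp
  qed
  then have "vec_index v i = 0" if "i < n" for i using assms that by blast
  then have "v = 0\<^sub>v n" using v(1) by (intro eq_vecI) auto
  with v(2) show False by simp
qed

lemma smooth_on_mfd_entry_det:
  assumes M: "complex_manifold M" and V: "open V"
    and a: "\<And>i j. i < n \<Longrightarrow> j < n \<Longrightarrow> smooth_on_mfd M V (\<lambda>x. a x i j)"
  shows "smooth_on_mfd M V (\<lambda>x. entry_det n (a x))"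
  unfolding entry_det_expand
proof (intro smooth_on_mfd_sum[OF M V] smooth_on_mfd_mult[OF M V] smooth_on_mfd_const[OF M V]
    smooth_on_mfd_prod[OF M V] a)
  fix p i assume "p \<in> {p. p permutes {0..<n}}" "i \<in> {0..<n}"
  then show "i < n" "p i < n" using permutes_in_image[of p "{0..<n}" i] by simp_all
qed

lemma smooth_on_mfd_entry_adj:
  assumes M: "complex_manifold M" and V: "open V"
    and a: "\<And>i j. i < n \<Longrightarrow> j < n \<Longrightarrow> smooth_on_mfd M V (\<lambda>x. a x i j)"
    and ij: "i < n" "j < n"
  shows "smooth_on_mfd M V (\<lambda>x. entry_adj n (a x) i j)"
  unfolding entry_adj_expand[OF ij]
  by (intro smooth_on_mfd_mult[OF M V] smooth_on_mfd_const[OF M V] smooth_on_mfd_entry_det[OF M V] a) auto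

section \<open>Gauge transformations from fibrewise injective endomorphisms\<close>

context smooth_vector_bundle
begin

definition local_matrix :: "('e \<Rightarrow> nat \<Rightarrow> complex) \<Rightarrow> ('e \<Rightarrow> 'e) \<Rightarrow> 'x \<Rightarrow> nat \<Rightarrow> nat \<Rightarrow> complex" where
  "local_matrix \<tau> u x i k = \<tau> (u (frame E \<tau> k x)) i"

lemma local_matrix_apply:
  assumes u: "u \<in> bundle_hom M E E" and t: "(U, \<tau>) \<in> trivs E" "x \<in> U" and e: "e \<in> fibre E x"
  shows "\<tau> (u e) i = (\<Sum>k<brank E. local_matrix \<tau> u x i k * \<tau> e k)"
  using frame_expansion[of "\<lambda>a. a" "\<lambda>x. x" u U \<tau> x U \<tau> e i] u t e
  by (simp add: bundle_hom_iff local_matrix_def mult.commute)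

lemma smooth_local_matrix:
  assumes "u \<in> bundle_hom M E E" "(U, \<tau>) \<in> trivs E" "i < brank E" "k < brank E"
  shows "smooth_on_mfd M U (\<lambda>x. local_matrix \<tau> u x i k)"
proof -
  have "smooth_on_mfd M (U \<inter> (\<lambda>x. x) -` U) (\<lambda>x. \<tau> (u (frame E \<tau> k x)) i)"
    using assms unfolding bundle_hom_iff smooth_fibre_map_iff by blast
  then show ?thesis by (simp add: local_matrix_def)
qed

text \<open>The transition matrices are smooth, so smoothness seen in one trivialization over
  \<open>U\<close> carries over to all others.\<close>

lemma smooth_lift_from_triv:
  assumes t: "(U, \<tau>) \<in> trivs E" and e: "\<And>x. x \<in> U \<Longrightarrow> e x \<in> fibre E x"
    and sm: "\<And>k. k < brank E \<Longrightarrow> smooth_on_mfd M U (\<lambda>x. \<tau> (e x) k)"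
  shows "smooth_lift (\<lambda>x. x) U e"
  unfolding smooth_lift_def
proof (intro conjI ballI allI impI e)
  fix V \<rho> i assume t': "(V, \<rho>) \<in> trivs E" and i: "i < brank E"
  have o: "open (U \<inter> (\<lambda>x. x) -` V)" using open_Int[OF triv_open[OF t] triv_open[OF t']] by simp
  show "smooth_on_mfd M (U \<inter> (\<lambda>x. x) -` V) (\<lambda>x. \<rho> (e x) i)"
  proof (rule smooth_on_mfd_cong[OF M o])
    show "\<rho> (e x) i = (\<Sum>j<brank E. \<tau> (e x) j * \<rho> (frame E \<tau> j x) i)"
      if "x \<in> U \<inter> (\<lambda>x. x) -` V" for x
      using that e by (intro frame_expansion[OF semilinear_id _ t _ t']) auto
    show "smooth_on_mfd M (U \<inter> (\<lambda>x. x) -` V) (\<lambda>x. \<Sum>j<brank E. \<tau> (e x) j * \<rho> (frame E \<tau> j x) i)"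
    proof (intro smooth_on_mfd_sum[OF M o] smooth_on_mfd_mult[OF M o])
      fix j assume "j \<in> {..<brank E}"
      then have j: "j < brank E" by simp
      show "smooth_on_mfd M (U \<inter> (\<lambda>x. x) -` V) (\<lambda>x. \<tau> (e x) j)"
        using sm[OF j] by (rule smooth_on_mfd_subset) auto
      show "smooth_on_mfd M (U \<inter> (\<lambda>x. x) -` V) (\<lambda>x. \<rho> (frame E \<tau> j x) i)"
        using triv_transition[OF t t' j i] by simp
    qed
  qed
qed

text \<open>A trivial kernel makes the local determinants nonzero. Cramer's rule then gives
  fibrewise bijectivity, and the matrix of the inverse, adjugate over determinant, is
  smooth.\<close>

lemma Gau_of_kernel:
  assumes u: "u \<in> bundle_hom M E E"
    and ker: "\<And>x e. e \<in> fibre E x \<Longrightarrow> u e = vzero E x \<Longrightarrow> e = vzero E x"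
  shows "u \<in> Gau M E"
proof -
  let ?r = "brank E"
  note ud = semilinearD[OF conjunct1[OF conjunct2[OF u[unfolded bundle_hom_iff]]]]
  let ?a = "\<lambda>\<tau>. local_matrix \<tau> u"
  have det: "entry_det ?r (?a \<tau> x) \<noteq> 0" if t: "(U, \<tau>) \<in> trivs E" "x \<in> U" for U \<tau> x
  proof (rule entry_det_nonzero)
    fix v i assume v: "\<And>i. i < ?r \<Longrightarrow> (\<Sum>j<?r. ?a \<tau> x i j * v j) = 0" and i: "i < ?r"
    \<comment> \<open>Only the entries of \<open>v\<close> below the rank matter; padding by 0
      yields a point of \<open>coord_space\<close>.\<close>
    let ?y = "\<lambda>j. if j < ?r then v j else 0"
    have "?y \<in> coord_space ?r" by (simp add: coord_space_def)
    then obtain e where e: "e \<in> fibre E x" "\<tau> e = ?y" by (rule ex_coords[OF t])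
    have "\<tau> (u e) i = 0" for i
    proof (cases "i < ?r")
      case True
      then show ?thesis using local_matrix_apply[OF u t e(1), of i] v by (simp add: e(2))
    next
      case False
      then show ?thesis using triv_coords[OF t ud(1)[OF e(1)]] by (simp add: coord_space_def)
    qed
    then have "u e = vzero E x"
      by (intro fibre_eqI[OF t ud(1)[OF e(1)] fibre_zero]) (auto simp: triv_zero[OF t])
    then have "\<tau> e = (\<lambda>i. 0)" using ker[OF e(1)] triv_zero[OF t] by simp
    then show "v i = 0" using e(2) i by (metis (full_types))
  qed
  \<comment> \<open>Cramer's rule recovers \<open>e\<close> from \<open>u e\<close>. It gives
    injectivity now and the coordinates of the inverse map later.\<close>
  have left: "\<tau> e i = inverse (entry_det ?r (?a \<tau> x)) * (\<Sum>k<?r. entry_adj ?r (?a \<tau> x) i k * \<tau> (u e) k)"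
    if t: "(U, \<tau>) \<in> trivs E" "x \<in> U" and e: "e \<in> fibre E x" and i: "i < ?r" for U \<tau> x e i
  proof -
    let ?b = "entry_adj ?r (?a \<tau> x)"
    have "(\<Sum>k<?r. ?b i k * \<tau> (u e) k) = (\<Sum>k<?r. \<Sum>j<?r. ?b i k * ?a \<tau> x k j * \<tau> e j)"
      by (simp add: local_matrix_apply[OF u t e] sum_distrib_left mult.assoc)
    also have "\<dots> = (\<Sum>j<?r. (\<Sum>k<?r. ?b i k * ?a \<tau> x k j) * \<tau> e j)"
      by (subst sum.swap) (simp add: sum_distrib_right)
    also have "\<dots> = (\<Sum>j<?r. (if i = j then entry_det ?r (?a \<tau> x) else 0) * \<tau> e j)"
      by (intro sum.cong refl) (simp add: entry_adj_mult(1)[OF i])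
    also have "\<dots> = (\<Sum>j<?r. if j = i then entry_det ?r (?a \<tau> x) * \<tau> e j else 0)"
      by (intro sum.cong refl) simp
    also have "\<dots> = entry_det ?r (?a \<tau> x) * \<tau> e i" using i by simp
    finally show ?thesis using det[OF t] by simp
  qed
  have inj: "e = e'" if "e \<in> fibre E x" "e' \<in> fibre E x" "u e = u e'" for e e' x
  proof -
    obtain U \<tau> where t: "(U, \<tau>) \<in> trivs E" "x \<in> U" by (rule triv_cover)
    have "\<tau> e i = \<tau> e' i" for i
    proof (cases "i < ?r")
      case True
      then show ?thesis using left[OF t that(1)] left[OF t that(2)] that(3) by simp
    next
      case False
      then show ?thesis using triv_coords[OF t] that(1,2) by (simp add: coord_space_def)
    qed
    then show ?thesis using fibre_eqI[OF t that(1,2)] by blast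
  qed
  have surj: "\<exists>e\<in>fibre E x. u e = e'" if e': "e' \<in> fibre E x" for e' x
  proof -
    obtain U \<tau> where t: "(U, \<tau>) \<in> trivs E" "x \<in> U" by (rule triv_cover)
    let ?b = "entry_adj ?r (?a \<tau> x)" and ?d = "entry_det ?r (?a \<tau> x)"
    \<comment> \<open>The coordinates of a preimage are adjugate over determinant applied to those
      of \<open>e'\<close>; that \<open>u\<close> sends it to \<open>e'\<close> uses the product
      with the adjugate on the right.\<close>
    let ?y = "\<lambda>k. if k < ?r then inverse ?d * (\<Sum>j<?r. ?b k j * \<tau> e' j) else 0"
    have "?y \<in> coord_space ?r" by (simp add: coord_space_def)
    then obtain e where e: "e \<in> fibre E x" "\<tau> e = ?y" by (rule ex_coords[OF t])
    have "\<tau> (u e) i = \<tau> e' i" for i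
    proof (cases "i < ?r")
      case True
      have "\<tau> (u e) i = (\<Sum>k<?r. ?a \<tau> x i k * (inverse ?d * (\<Sum>j<?r. ?b k j * \<tau> e' j)))"
        by (simp add: local_matrix_apply[OF u t e(1)] e(2))
      also have "\<dots> = inverse ?d * (\<Sum>k<?r. \<Sum>j<?r. ?a \<tau> x i k * ?b k j * \<tau> e' j)"
        by (simp add: sum_distrib_left mult_ac)
      also have "\<dots> = inverse ?d * (\<Sum>j<?r. (\<Sum>k<?r. ?a \<tau> x i k * ?b k j) * \<tau> e' j)"
        by (subst sum.swap) (simp add: sum_distrib_right)
      also have "(\<Sum>j<?r. (\<Sum>k<?r. ?a \<tau> x i k * ?b k j) * \<tau> e' j) =
          (\<Sum>j<?r. (if i = j then ?d else 0) * \<tau> e' j)"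
        by (intro sum.cong refl) (simp add: entry_adj_mult(2)[OF True])
      also have "\<dots> = (\<Sum>j<?r. if j = i then ?d * \<tau> e' j else 0)"
        by (intro sum.cong refl) simp
      also have "inverse ?d * \<dots> = \<tau> e' i" using True det[OF t] by simp
      finally show ?thesis .
    next
      case False
      then show ?thesis using triv_coords[OF t ud(1)[OF e(1)]] triv_coords[OF t e'] by (simp add: coord_space_def)
    qed
    then have "u e = e'" by (intro fibre_eqI[OF t ud(1)[OF e(1)] e']) auto
    then show ?thesis using e(1) by blast
  qed
  have utot: "u e \<in> total E" "bproj E (u e) = bproj E e" if "e \<in> total E" for e
    using ud(1)[of e "bproj E e"] that by (auto simp: mem_fibre_iff)
  have inj_tot: "inj_on u (total E)"
  proof (rule inj_onI)
    fix e e' assume e: "e \<in> total E" "e' \<in> total E" "u e = u e'"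
    then have "bproj E e = bproj E e'" using utot(2)[OF e(1)] utot(2)[OF e(2)] by simp
    then have "e \<in> fibre E (bproj E e)" "e' \<in> fibre E (bproj E e)" using e(1,2) by (simp_all add: mem_fibre_iff)
    then show "e = e'" using e(3) by (rule inj)
  qed
  have surj_tot: "\<exists>e\<in>total E. u e = e'" if "e' \<in> total E" for e'
  proof -
    have "e' \<in> fibre E (bproj E e')" using that by (simp add: mem_fibre_iff)
    from surj[OF this] obtain e where "e \<in> fibre E (bproj E e')" "u e = e'" ..
    then show ?thesis unfolding mem_fibre_iff by (intro bexI[of _ e]) simp_all
  qed
  have bij: "bij_betw u (total E) (total E)"
  proof (rule bij_betw_imageI[OF inj_tot])
    have "e' \<in> u ` total E" if "e' \<in> total E" for e'
      using surj_tot[OF that] by (auto simp: image_iff)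
    moreover have "u ` total E \<subseteq> total E" using utot(1) by (rule image_subsetI)
    ultimately show "u ` total E = total E" by (intro equalityI subsetI) auto
  qed
  let ?v = "restrict (inv_into (total E) u) (total E)"
  have vf: "?v e \<in> fibre E x" and uv: "u (?v e) = e" if ex: "e \<in> fibre E x" for e x
  proof -
    obtain e0 where e0: "e0 \<in> fibre E x" "u e0 = e" using surj[OF ex] by blast
    have "inv_into (total E) u (u e0) = e0"
      using bij_betw_imp_inj_on[OF bij] e0(1) by (simp add: mem_fibre_iff inv_into_f_f)
    then have "?v e = e0" using ex e0(2) by (simp add: mem_fibre_iff)
    then show "?v e \<in> fibre E x" "u (?v e) = e" using e0 by simp_all
  qed
  \<comment> \<open>Linearity of the inverse is checked after applying the injective map
    \<open>u\<close>.\<close>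
  have "semilinear (\<lambda>a. a) (\<lambda>x. x) ?v"
    unfolding semilinear_def
  proof (intro conjI allI ballI)
    fix x e assume e: "e \<in> fibre E x"
    show "?v e \<in> fibre E x" by (rule vf[OF e])
    show "?v (vscale E a e) = vscale E a (?v e)" for a
    proof (rule inj)
      show "?v (vscale E a e) \<in> fibre E x" by (rule vf[OF fibre_scale[OF e]])
      show "vscale E a (?v e) \<in> fibre E x" by (rule fibre_scale[OF vf[OF e]])
      show "u (?v (vscale E a e)) = u (vscale E a (?v e))"
        by (simp only: ud(3)[OF vf[OF e]] uv[OF e] uv[OF fibre_scale[OF e]])
    qed
    fix e' assume e': "e' \<in> fibre E x"
    show "?v (vadd E e e') = vadd E (?v e) (?v e')"
    proof (rule inj)
      show "?v (vadd E e e') \<in> fibre E x" by (rule vf[OF fibre_add[OF e e']])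
      show "vadd E (?v e) (?v e') \<in> fibre E x" by (rule fibre_add[OF vf[OF e] vf[OF e']])
      show "u (?v (vadd E e e')) = u (vadd E (?v e) (?v e'))"
        by (simp only: ud(2)[OF vf[OF e] vf[OF e']] uv[OF e] uv[OF e'] uv[OF fibre_add[OF e e']])
    qed
  qed
  moreover have "smooth_fibre_map M E E (\<lambda>x. x) ?v"
  proof (rule smooth_fibre_mapI[OF _ refl smooth_self_map_id[OF M]])
    fix U \<tau> j assume t: "(U, \<tau>) \<in> trivs E" and j: "j < ?r"
    note f = frame_fibre[OF t _ j]
    show "smooth_lift (\<lambda>x. x) U (\<lambda>x. ?v (frame E \<tau> j x))"
    proof (rule smooth_lift_from_triv[OF t])
      show "?v (frame E \<tau> j x) \<in> fibre E x" if "x \<in> U" for x using vf[OF f(1)[OF that]] .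
      fix k assume k: "k < ?r"
      show "smooth_on_mfd M U (\<lambda>x. \<tau> (?v (frame E \<tau> j x)) k)"
      proof (rule smooth_on_mfd_cong[OF M triv_open[OF t]])
        fix x assume x: "x \<in> U"
        \<comment> \<open>Cramer's rule for the preimage of a frame vector: the coordinates of the
          latter are \<open>unit_coord j\<close>, so a single column of the adjugate
          survives.\<close>
        have "(\<Sum>i<?r. entry_adj ?r (?a \<tau> x) k i * unit_coord j i) =
            (\<Sum>i<?r. if i = j then entry_adj ?r (?a \<tau> x) k i else 0)"
          by (intro sum.cong refl) (simp add: unit_coord_def)
        then show "\<tau> (?v (frame E \<tau> j x)) k =
            inverse (entry_det ?r (?a \<tau> x)) * entry_adj ?r (?a \<tau> x) k j"
          unfolding left[OF t x vf[OF f(1)[OF x]] k] uv[OF f(1)[OF x]] f(2)[OF x] using j by simp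
      next
        note o = triv_open[OF t]
        show "smooth_on_mfd M U (\<lambda>x. inverse (entry_det ?r (?a \<tau> x)) * entry_adj ?r (?a \<tau> x) k j)"
          by (intro smooth_on_mfd_mult[OF M o] smooth_on_mfd_inverse[OF M o] smooth_on_mfd_entry_det[OF M o]
              smooth_on_mfd_entry_adj[OF M o] smooth_local_matrix[OF u t] det[OF t] k j)
      qed
    qed
  qed
  ultimately have "?v \<in> bundle_hom M E E" by (simp add: bundle_hom_iff)
  then show ?thesis using u bij by (simp add: Gau_def)
qed

section \<open>Invertible shifts of an endomorphism over a compact base\<close>

abbreviation "hom_id \<equiv> restrict (\<lambda>e. e) (total E)"

lemma hom_id: "hom_id \<in> bundle_hom M E E"
proof -
  have "smooth_fibre_map M E E (\<lambda>x. x) hom_id"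
    by (rule smooth_fibre_mapI[of "\<lambda>x. x" "\<lambda>e. e", OF _ _ smooth_self_map_id[OF M]])
      (simp_all add: smooth_lift_frame)
  moreover have "semilinear (\<lambda>a. a) (\<lambda>x. x) hom_id"
    by (rule semilinear_cong[OF semilinear_id]) simp
  ultimately show ?thesis by (simp add: bundle_hom_iff)
qed

text \<open>If u e = - T e, comparing sums of moduli of coordinates gives T m \<le> B m, so m = 0
  once T exceeds B. Continuity bounds B by its value at \<open>x0\<close> plus 1 on a
  neighbourhood.\<close>

lemma local_eigenvalue_bound:
  assumes u: "u \<in> bundle_hom M E E"
  shows "\<exists>N K. open N \<and> x0 \<in> N \<and> (\<forall>T x e. x \<in> N \<longrightarrow> e \<in> fibre E x \<longrightarrow> K < T \<longrightarrow>
     hom_lincomb 1 u (of_real T) hom_id e = vzero E x \<longrightarrow> e = vzero E x)"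
proof -
  let ?r = "brank E"
  note ud = semilinearD[OF conjunct1[OF conjunct2[OF u[unfolded bundle_hom_iff]]]]
  obtain U \<tau> where t: "(U, \<tau>) \<in> trivs E" "x0 \<in> U" by (rule triv_cover)
  let ?a = "local_matrix \<tau> u"
  \<comment> \<open>The sum of the moduli of all matrix entries bounds the operator norm for the sum
    norm \<open>m\<close> used below, and it depends continuously on the point.\<close>
  define B where "B x = (\<Sum>i<?r. \<Sum>k<?r. norm (?a x i k))" for x
  have "continuous_on U B"
    unfolding B_def
    by (intro continuous_intros smooth_on_mfd_continuous[OF M triv_open[OF t(1)]] smooth_local_matrix[OF u t(1)]) auto
  then have "open (U \<inter> B -` {..<B x0 + 1})"
    using continuous_open_preimage triv_open[OF t(1)] open_lessThan by blast
  moreover have "e = vzero E x"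
    if x: "x \<in> U" "B x < B x0 + 1" and e: "e \<in> fibre E x" and T: "B x0 + 1 < T"
      and z: "hom_lincomb 1 u (of_real T) hom_id e = vzero E x" for x e T
  proof -
    have tx: "(U, \<tau>) \<in> trivs E" "x \<in> U" using t x by auto
    have "vadd E (vscale E 1 (u e)) (vscale E (of_real T) e) = vzero E x"
      using z e by (simp add: hom_lincomb_def mem_fibre_iff)
    then have "\<tau> (vadd E (vscale E 1 (u e)) (vscale E (of_real T) e)) = (\<lambda>i. 0)"
      using triv_zero[OF tx] by simp
    then have eq: "\<tau> (u e) i + of_real T * \<tau> e i = 0" for i
      using e ud(1)[OF e] by (simp add: triv_add[OF tx] triv_scale[OF tx] fibre_scale fun_eq_iff)
    define m where "m = (\<Sum>i<?r. norm (\<tau> e i))"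
    have m0: "0 \<le> m" unfolding m_def by (intro sum_nonneg) simp
    have "0 \<le> B x0" unfolding B_def by (intro sum_nonneg) simp
    with T have T0: "0 < T" by simp
    have "T * m = (\<Sum>i<?r. norm (\<tau> (u e) i))"
    proof -
      have "norm (\<tau> (u e) i) = T * norm (\<tau> e i)" for i
      proof -
        have "\<tau> (u e) i = - (of_real T * \<tau> e i)" using eq[of i] by (simp add: eq_neg_iff_add_eq_0)
        then show ?thesis using T0 by (simp add: norm_mult)
      qed
      then show ?thesis by (simp add: m_def sum_distrib_left)
    qed
    also have "\<dots> \<le> (\<Sum>i<?r. \<Sum>k<?r. norm (?a x i k) * m)"
    proof (intro sum_mono)
      fix i
      have "norm (\<tau> (u e) i) \<le> (\<Sum>k<?r. norm (?a x i k * \<tau> e k))"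
        unfolding local_matrix_apply[OF u tx e] by (rule norm_sum)
      also have "\<dots> \<le> (\<Sum>k<?r. norm (?a x i k) * m)"
        unfolding norm_mult m_def
        by (intro sum_mono mult_left_mono member_le_sum) auto
      finally show "norm (\<tau> (u e) i) \<le> (\<Sum>k<?r. norm (?a x i k) * m)" .
    qed
    also have "\<dots> = B x * m" by (simp add: B_def sum_distrib_right)
    finally have "(T - B x) * m \<le> 0" by (simp add: algebra_simps)
    moreover have "0 < T - B x" using T x(2) by simp
    ultimately have "m = 0" using m0 by (simp add: mult_le_0_iff)
    then have "\<tau> e i = 0" if "i < ?r" for i using that by (simp add: m_def sum_nonneg_eq_0_iff)
    then have "\<tau> e = (\<lambda>i. 0)" using triv_coords[OF tx e] by (auto simp: coord_space_def fun_eq_iff) (metis not_le)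
    then show ?thesis by (intro fibre_eqI[OF tx e fibre_zero]) (simp add: triv_zero[OF tx])
  qed
  ultimately show ?thesis
    using t(2) by (intro exI[of _ "U \<inter> B -` {..<B x0 + 1}"] exI[of _ "B x0 + 1"]) auto
qed

lemma ex_invertible_shift:
  assumes u: "u \<in> bundle_hom M E E" and compact: "compact (UNIV :: 'x set)"
  obtains T :: real where "hom_lincomb 1 u (of_real T) hom_id \<in> Gau M E"
proof -
  define P where "P N K \<longleftrightarrow> (\<forall>T x e. x \<in> N \<longrightarrow> e \<in> fibre E x \<longrightarrow> K < T \<longrightarrow>
     hom_lincomb 1 u (of_real T) hom_id e = vzero E x \<longrightarrow> e = vzero E x)" for N and K :: real
  have "\<exists>N K. open N \<and> x0 \<in> N \<and> P N K" for x0
    unfolding P_def by (rule local_eigenvalue_bound[OF u])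
  then obtain N K where N: "\<And>x. open (N x)" "\<And>x. x \<in> N x" "\<And>x. P (N x) (K x)" by metis
  obtain C where C: "finite C" "UNIV \<subseteq> (\<Union>x\<in>C. N x)"
  proof (rule compactE_image[OF compact, of UNIV N])
    show "UNIV \<subseteq> (\<Union>x. N x)" using N(2) by blast
  qed (use N(1) in simp_all)
  \<comment> \<open>Compactness leaves finitely many local bounds; the sum of their absolute values
    plus 1 exceeds each of them.\<close>
  define T where "T = (\<Sum>x\<in>C. \<bar>K x\<bar>) + 1"
  have T: "K x < T" if "x \<in> C" for x
    using member_le_sum[OF that, of "\<lambda>x. \<bar>K x\<bar>"] C(1) by (simp add: T_def)
  have "hom_lincomb 1 u (of_real T) hom_id \<in> Gau M E"
  proof (rule Gau_of_kernel[OF bundle_hom_lincomb[OF u hom_id]])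
    fix x e assume e: "e \<in> fibre E x" "hom_lincomb 1 u (of_real T) hom_id e = vzero E x"
    obtain x0 where "x0 \<in> C" "x \<in> N x0" using C(2) by blast
    then show "e = vzero E x" using N(3)[of x0, unfolded P_def, rule_format, OF _ e(1) T e(2)] by simp
  qed
  then show thesis by (rule that)
qed

end

section \<open>Bundles over a manifold with involution\<close>

text \<open>The sign \<open>\<epsilon>\<close> is \<open>1\<close> for real and \<open>-1\<close> for quaternionic bundles.\<close>

locale vector_bundle_with_involution = smooth_vector_bundle M E
  for M :: "'x::{t2_space, second_countable_topology} cmanifold" and E :: "('e, 'x) cvbundle" +
  fixes \<sigma>X :: "'x \<Rightarrow> 'x" and \<sigma> :: "'e \<Rightarrow> 'e" and \<epsilon> :: complex
  assumes invol: "manifold_involution M \<sigma>X"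
    and anti: "antilinear_bundle_map M \<sigma>X E \<sigma>"
    and eps: "\<epsilon> = 1 \<or> \<epsilon> = -1"
    and square: "e \<in> total E \<Longrightarrow> \<sigma> (\<sigma> e) = vscale E \<epsilon> e"
begin

lemma involX [simp]: "\<sigma>X (\<sigma>X x) = x"
  using invol by (simp add: manifold_involution_def)

lemma smooth_involX: "smooth_self_map M \<sigma>X"
  using invol smooth_self_map_antiholomorphic[OF M] by (simp add: manifold_involution_def)

lemma semilinear_sigma: "semilinear cnj \<sigma>X \<sigma>"
  using anti unfolding antilinear_bundle_map_def semilinear_def by (auto simp: mem_fibre_iff Pi_iff)

lemma smooth_sigma: "smooth_fibre_map M E E \<sigma>X \<sigma>"
  using anti unfolding antilinear_bundle_map_def by (elim conjE)

lemma eps_eps [simp]: "\<epsilon> * \<epsilon> = 1" "cnj \<epsilon> = \<epsilon>"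
  using eps by auto

abbreviation "\<sigma>' \<equiv> inv_into (total E) \<sigma>"

lemma sigma_total: "e \<in> total E \<Longrightarrow> \<sigma> e \<in> total E"
  using semilinearD(1)[OF semilinear_sigma, of e "bproj E e"] by (simp add: mem_fibre_iff)

lemma vscale_total: "e \<in> total E \<Longrightarrow> vscale E a e \<in> total E"
  using fibre_scale[of e "bproj E e" a] by (simp add: mem_fibre_iff)

lemma sigma_inverse: "e \<in> total E \<Longrightarrow> \<sigma> (vscale E \<epsilon> (\<sigma> e)) = e" "e \<in> total E \<Longrightarrow> vscale E \<epsilon> (\<sigma> (\<sigma> e)) = e"
proof -
  assume e: "e \<in> total E"
  then have "e \<in> fibre E (bproj E e)" by (simp add: mem_fibre_iff)
  then show *: "vscale E \<epsilon> (\<sigma> (\<sigma> e)) = e" using e by (simp add: square vscale_vscale vscale_1)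
  have "\<sigma> e \<in> fibre E (bproj E (\<sigma> e))" using sigma_total[OF e] by (simp add: mem_fibre_iff)
  then have "\<sigma> (vscale E \<epsilon> (\<sigma> e)) = vscale E \<epsilon> (\<sigma> (\<sigma> e))"
    using semilinearD(3)[OF semilinear_sigma] by simp
  then show "\<sigma> (vscale E \<epsilon> (\<sigma> e)) = e" using * by simp
qed

text \<open>As the square of \<sigma> is the real scalar \<epsilon> with \<epsilon>^2 = 1, the
  inverse is \<epsilon> \<sigma>; antilinearity and smoothness of the inverse are read off from
  this.\<close>

lemma sigma'_eq: "e \<in> total E \<Longrightarrow> \<sigma>' e = vscale E \<epsilon> (\<sigma> e)"
proof -
  assume e: "e \<in> total E"
  have "inj_on \<sigma> (total E)" by (rule inj_on_inverseI[where g = "\<lambda>e. vscale E \<epsilon> (\<sigma> e)"]) (rule sigma_inverse(2))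
  from inv_into_f_f[OF this vscale_total[OF sigma_total[OF e], of \<epsilon>]]
  show ?thesis by (simp add: sigma_inverse(1)[OF e])
qed

lemma sigma_sigma' [simp]: "e \<in> total E \<Longrightarrow> \<sigma> (\<sigma>' e) = e" "e \<in> total E \<Longrightarrow> \<sigma>' (\<sigma> e) = e"
  by (simp_all add: sigma'_eq sigma_inverse sigma_total)

lemma semilinear_scale: "semilinear (\<lambda>a. a) (\<lambda>x. x) (vscale E a)"
  unfolding semilinear_def
proof (intro conjI allI ballI)
  fix x u assume u: "u \<in> fibre E x"
  show "vscale E a u \<in> fibre E x" by (rule fibre_scale[OF u])
  show "vscale E a (vscale E b u) = vscale E b (vscale E a u)" for b
    by (simp add: vscale_vscale[OF u] mult.commute)
  fix v assume v: "v \<in> fibre E x"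
  obtain U \<tau> where t: "(U, \<tau>) \<in> trivs E" "x \<in> U" by (rule triv_cover)
  show "vscale E a (vadd E u v) = vadd E (vscale E a u) (vscale E a v)"
    using u v by (intro fibre_eqI[OF t])
      (simp_all add: fibre_add fibre_scale triv_add[OF t] triv_scale[OF t] algebra_simps)
qed

lemma smooth_scale: "smooth_fibre_map M E E (\<lambda>x. x) (vscale E a)"
proof (rule smooth_fibre_mapI[OF _ refl smooth_self_map_id[OF M]])
  fix U \<tau> j assume t: "(U, \<tau>) \<in> trivs E" and j: "j < brank E"
  note f = frame_fibre[OF t _ j] and o = triv_open[OF t]
  show "smooth_lift (\<lambda>x. x) U (\<lambda>x. vscale E a (frame E \<tau> j x))"
  proof (rule smooth_lift_from_triv[OF t fibre_scale[OF f(1)]])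
    fix k
    show "smooth_on_mfd M U (\<lambda>x. \<tau> (vscale E a (frame E \<tau> j x)) k)"
      by (rule smooth_on_mfd_cong[OF M o _ smooth_on_mfd_const[OF M o, of "a * unit_coord j k"]])
        (simp add: triv_scale[OF t _ f(1)] f(2))
  qed
qed

lemma semilinear_sigma': "semilinear cnj \<sigma>X \<sigma>'"
  by (rule semilinear_cong[OF semilinear_compose[OF semilinear_scale semilinear_sigma]]) (rule sigma'_eq)

lemma smooth_sigma': "smooth_fibre_map M E E \<sigma>X \<sigma>'"
  by (rule smooth_fibre_map_compose[OF semilinear_scale smooth_scale bounded_linear_ident
        smooth_self_map_id[OF M] semilinear_sigma smooth_sigma bounded_linear_cnj smooth_involX smooth_involX])
    (rule sigma'_eq)

text \<open>Meant for \<open>F\<close> equal to \<sigma> or its inverse: s composed with \<sigma>X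
  is a lift of \<sigma>X, and \<open>F\<close> brings it back over the identity.\<close>

lemma sections_conj:
  assumes F: "semilinear cnj \<sigma>X F" "smooth_fibre_map M E E \<sigma>X F" and s: "s \<in> sections M E"
  shows "F \<circ> s \<circ> \<sigma>X \<in> sections M E"
proof -
  have "smooth_lift \<sigma>X UNIV (\<lambda>x. s (\<sigma>X x))"
    unfolding smooth_lift_def
  proof (intro conjI ballI allI impI)
    show "s (\<sigma>X x) \<in> fibre E (\<sigma>X x)" for x using s by (simp add: sections_def)
    fix U \<tau> i assume t: "(U, \<tau>) \<in> trivs E" and i: "i < brank E"
    have "smooth_on_mfd M U (\<lambda>x. \<tau> (s x) i)" using s t i by (auto simp: sections_def)
    from smooth_self_map_pullback[OF M smooth_involX triv_open[OF t] this]
    show "smooth_on_mfd M (UNIV \<inter> \<sigma>X -` U) (\<lambda>x. \<tau> (s (\<sigma>X x)) i)" by simp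
  qed
  from smooth_lift_map[OF open_UNIV smooth_involX smooth_involX F bounded_linear_cnj this]
  show ?thesis by (simp add: sections_iff o_def)
qed

section \<open>Conjugation of endomorphisms\<close>

lemma endo_conj_apply: "e \<in> total E \<Longrightarrow> endo_conj E \<sigma> \<phi> e = \<sigma> (\<phi> (\<sigma>' e))"
  by (simp add: endo_conj_def)

text \<open>Two antilinear factors make a linear map, and the two copies of \<sigma>X on the base
  cancel.\<close>

lemma endo_conj_hom:
  assumes "\<phi> \<in> bundle_hom M E E"
  shows "endo_conj E \<sigma> \<phi> \<in> bundle_hom M E E"
proof -
  have \<phi>: "semilinear (\<lambda>a. a) (\<lambda>x. x) \<phi>" "smooth_fibre_map M E E (\<lambda>x. x) \<phi>"
    using assms by (simp_all add: bundle_hom_iff)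
  let ?G = "\<lambda>e. \<phi> (\<sigma>' e)"
  have G: "semilinear cnj \<sigma>X ?G" by (rule semilinear_compose[OF \<phi>(1) semilinear_sigma'])
  have G': "smooth_fibre_map M E E \<sigma>X ?G"
    by (rule smooth_fibre_map_compose[OF \<phi> bounded_linear_ident smooth_self_map_id[OF M]
          semilinear_sigma' smooth_sigma' bounded_linear_cnj smooth_involX smooth_involX refl])
  have "semilinear (\<lambda>a. cnj (cnj a)) (\<lambda>x. \<sigma>X (\<sigma>X x)) (endo_conj E \<sigma> \<phi>)"
    by (rule semilinear_cong[OF semilinear_compose[OF semilinear_sigma G]]) (rule endo_conj_apply)
  moreover have "smooth_fibre_map M E E (\<lambda>x. \<sigma>X (\<sigma>X x)) (endo_conj E \<sigma> \<phi>)"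
  proof (rule smooth_fibre_map_compose[OF semilinear_sigma smooth_sigma bounded_linear_cnj smooth_involX
          G G' bounded_linear_cnj smooth_involX])
    show "smooth_self_map M (\<lambda>x. \<sigma>X (\<sigma>X x))" using smooth_self_map_id[OF M] by simp
  qed (rule endo_conj_apply)
  ultimately show ?thesis by (simp add: bundle_hom_iff endo_conj_def)
qed

lemma hom_fibre: "\<phi> \<in> bundle_hom M E E \<Longrightarrow> e \<in> fibre E x \<Longrightarrow> \<phi> e \<in> fibre E x"
  using semilinearD(1)[of "\<lambda>a. a" "\<lambda>x. x" \<phi> e x] by (simp add: bundle_hom_iff)

lemma hom_scale: "\<phi> \<in> bundle_hom M E E \<Longrightarrow> e \<in> fibre E x \<Longrightarrow> \<phi> (vscale E a e) = vscale E a (\<phi> e)"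
  using semilinearD(3)[of "\<lambda>a. a" "\<lambda>x. x" \<phi> e x a] by (simp add: bundle_hom_iff)

lemma sigma_fibre: "e \<in> fibre E x \<Longrightarrow> \<sigma> e \<in> fibre E (\<sigma>X x)" "e \<in> fibre E x \<Longrightarrow> \<sigma>' e \<in> fibre E (\<sigma>X x)"
  using semilinearD(1)[OF semilinear_sigma] semilinearD(1)[OF semilinear_sigma'] by simp_all

lemma in_total: "e \<in> fibre E x \<Longrightarrow> e \<in> total E"
  by (simp add: mem_fibre_iff)

lemma hom_eqI:
  assumes "F \<in> bundle_hom M E E" "G \<in> bundle_hom M E E"
    and "\<And>x e. e \<in> fibre E x \<Longrightarrow> F e = G e"
  shows "F = G"
proof (rule extensionalityI)
  show "F \<in> extensional (total E)" "G \<in> extensional (total E)"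
    using assms(1,2) by (simp_all add: bundle_hom_iff)
  show "F e = G e" if "e \<in> total E" for e using assms(3)[of e "bproj E e"] that by (simp add: mem_fibre_iff)
qed

lemma hom_lincomb_apply:
  "e \<in> fibre E x \<Longrightarrow> hom_lincomb a F b G e = vadd E (vscale E a (F e)) (vscale E b (G e))"
  by (simp add: hom_lincomb_def in_total)

text \<open>Conjugating twice is conjugating by the square of \<sigma>, a scalar, with which the
  linear map \<phi> commutes; the sign \<epsilon> has no effect.\<close>

lemma endo_conj_endo_conj:
  assumes \<phi>: "\<phi> \<in> bundle_hom M E E"
  shows "endo_conj E \<sigma> (endo_conj E \<sigma> \<phi>) = \<phi>"
proof (rule hom_eqI[OF endo_conj_hom[OF endo_conj_hom[OF \<phi>]] \<phi>])
  fix x e assume e: "e \<in> fibre E x"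
  let ?e = "\<sigma>' (\<sigma>' e)"
  have e1: "\<sigma>' e \<in> fibre E (\<sigma>X x)" by (rule sigma_fibre(2)[OF e])
  then have e2: "?e \<in> fibre E x" using sigma_fibre(2)[of "\<sigma>' e" "\<sigma>X x"] by simp
  have "\<sigma> (\<sigma> ?e) = e" using e e1 by (simp add: in_total)
  then have "vscale E \<epsilon> ?e = e" using square[OF in_total[OF e2]] by simp
  then have "\<phi> e = vscale E \<epsilon> (\<phi> ?e)" using hom_scale[OF \<phi> e2] by metis
  also have "\<dots> = \<sigma> (\<sigma> (\<phi> ?e))" using square[OF in_total[OF hom_fibre[OF \<phi> e2]]] by simp
  finally show "endo_conj E \<sigma> (endo_conj E \<sigma> \<phi>) e = \<phi> e"
    using e e1 by (simp add: endo_conj_apply in_total)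
qed

lemma endo_conj_lincomb:
  assumes F: "F \<in> bundle_hom M E E" and G: "G \<in> bundle_hom M E E"
  shows "endo_conj E \<sigma> (hom_lincomb a F b G) =
     hom_lincomb (cnj a) (endo_conj E \<sigma> F) (cnj b) (endo_conj E \<sigma> G)"
proof (rule hom_eqI[OF endo_conj_hom[OF bundle_hom_lincomb[OF F G]]
      bundle_hom_lincomb[OF endo_conj_hom[OF F] endo_conj_hom[OF G]]])
  fix x e assume e: "e \<in> fibre E x"
  note e1 = sigma_fibre(2)[OF e]
  note f = hom_fibre[OF F e1] and g = hom_fibre[OF G e1]
  note sd = semilinearD[OF semilinear_sigma]
  show "endo_conj E \<sigma> (hom_lincomb a F b G) e =
     hom_lincomb (cnj a) (endo_conj E \<sigma> F) (cnj b) (endo_conj E \<sigma> G) e"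
    by (simp add: endo_conj_apply[OF in_total[OF e]] hom_lincomb_apply[OF e] hom_lincomb_apply[OF e1]
        sd(2)[OF fibre_scale[OF f] fibre_scale[OF g]] sd(3)[OF f] sd(3)[OF g])
qed

lemma endo_conj_id: "endo_conj E \<sigma> hom_id = hom_id"
proof (rule hom_eqI[OF endo_conj_hom[OF hom_id] hom_id])
  fix x e assume e: "e \<in> fibre E x"
  show "endo_conj E \<sigma> hom_id e = hom_id e"
    using in_total[OF e] in_total[OF sigma_fibre(2)[OF e]] by (simp add: endo_conj_apply)
qed

end

section \<open>Intertwiners of connections\<close>

context smooth_vector_bundle
begin

lemma section_fibre: "s \<in> sections M E \<Longrightarrow> s x \<in> fibre E x"
  by (simp add: sections_def)

lemma sections_scale:
  assumes s: "s \<in> sections M E"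
  shows "sec_scale E (\<lambda>x. a) s \<in> sections M E"
proof -
  have "smooth_on_mfd M U (\<lambda>x. \<tau> (vscale E a (s x)) i)" if t: "(U, \<tau>) \<in> trivs E" and i: "i < brank E" for U \<tau> i
  proof (rule smooth_on_mfd_cong[OF M triv_open[OF t]])
    have "smooth_on_mfd M U (\<lambda>x. \<tau> (s x) i)"
      using s t i by (auto simp: sections_def)
    then show "smooth_on_mfd M U (\<lambda>x. a * \<tau> (s x) i)"
      by (rule smooth_on_mfd_linear[OF M triv_open[OF t] bounded_linear_mult_right])
    show "\<tau> (vscale E a (s x)) i = a * \<tau> (s x) i" if "x \<in> U" for x
      using triv_scale[OF t that section_fibre[OF s]] by simp
  qed
  then show ?thesis using section_fibre[OF s]
    by (auto simp: sections_def sec_scale_def fibre_scale)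
qed

lemma connection_value:
  assumes D: "D \<in> connections M L E" and s: "s \<in> sections M E" and \<xi>: "\<xi> \<in> total L"
  shows "D s \<xi> \<in> fibre E (bproj L \<xi>)"
proof -
  have "D s \<in> bundle_hom M L E" using D s by (auto simp: connections_def one_forms_def)
  then show ?thesis using \<xi> by (auto simp: bundle_hom_def fibre_def)
qed

text \<open>The gauge equation D' = \<phi>^(-1) D \<phi> with the inverse cleared. It is linear in
  \<phi> and meaningful for endomorphisms that are not invertible, such as \<psi> + \<psi>'.\<close>

definition intertwines ::
  "('l, 'x) lie_algebroid_data \<Rightarrow> (('x \<Rightarrow> 'e) \<Rightarrow> 'l \<Rightarrow> 'e) \<Rightarrow> (('x \<Rightarrow> 'e) \<Rightarrow> 'l \<Rightarrow> 'e) \<Rightarrow> ('e \<Rightarrow> 'e) \<Rightarrow> bool" where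
  "intertwines L D D' \<phi> \<longleftrightarrow> (\<forall>s\<in>sections M E. \<forall>\<xi>\<in>total L. D (\<phi> \<circ> s) \<xi> = \<phi> (D' s \<xi>))"

text \<open>Bijectivity of \<phi> moves its inverse to the other side; conversely, extensionality
  turns equality of all values into equality of connections.\<close>

lemma gauge_act_eq_iff:
  assumes \<phi>: "\<phi> \<in> Gau M E" and D: "D \<in> connections M L E" and D': "D' \<in> connections M L E"
  shows "gauge_act M L E \<phi> D = D' \<longleftrightarrow> intertwines L D D' \<phi>"
proof -
  have hom: "\<phi> \<in> bundle_hom M E E" and bij: "bij_betw \<phi> (total E) (total E)"
    using \<phi> by (simp_all add: Gau_def)
  have val: "D (\<phi> \<circ> s) \<xi> \<in> total E" "D' s \<xi> \<in> total E" if "s \<in> sections M E" "\<xi> \<in> total L" for s \<xi>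
    using connection_value[OF D sections_map[OF hom that(1)] that(2)] connection_value[OF D' that]
    by (simp_all add: mem_fibre_iff)
  show ?thesis
  proof
    assume eq: "gauge_act M L E \<phi> D = D'"
    show "intertwines L D D' \<phi>"
      unfolding intertwines_def
    proof (intro ballI)
      fix s \<xi> assume s: "s \<in> sections M E" and \<xi>: "\<xi> \<in> total L"
      have "D' s \<xi> = inv_into (total E) \<phi> (D (\<phi> \<circ> s) \<xi>)"
        using s \<xi> by (simp add: eq[symmetric] gauge_act_def)
      then show "D (\<phi> \<circ> s) \<xi> = \<phi> (D' s \<xi>)"
        using bij_betw_inv_into_right[OF bij val(1)[OF s \<xi>]] by simp
    qed
  next
    assume int: "intertwines L D D' \<phi>"
    have ext: "D' \<in> extensional (sections M E)" "s \<in> sections M E \<Longrightarrow> D' s \<in> extensional (total L)" for s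
      using D' by (auto simp: connections_def one_forms_def bundle_hom_def PiE_def Pi_def)
    show "gauge_act M L E \<phi> D = D'"
    proof (rule extensionalityI[OF _ ext(1)])
      show "gauge_act M L E \<phi> D \<in> extensional (sections M E)" by (simp add: gauge_act_def)
      fix s assume s: "s \<in> sections M E"
      show "gauge_act M L E \<phi> D s = D' s"
      proof (rule extensionalityI[OF _ ext(2)[OF s]])
        show "gauge_act M L E \<phi> D s \<in> extensional (total L)" using s by (simp add: gauge_act_def)
        fix \<xi> assume \<xi>: "\<xi> \<in> total L"
        show "gauge_act M L E \<phi> D s \<xi> = D' s \<xi>"
          using int s \<xi> bij_betw_inv_into_left[OF bij val(2)[OF s \<xi>]]
          by (simp add: gauge_act_def intertwines_def)
      qed
    qed
  qed
qed

lemma restrict_comp_section: "s \<in> sections M E \<Longrightarrow> restrict f (total E) \<circ> s = f \<circ> s"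
  using section_fibre by (auto simp: fun_eq_iff mem_fibre_iff)

lemma intertwines_id: "D \<in> connections M L E \<Longrightarrow> intertwines L D D hom_id"
  unfolding intertwines_def
proof (intro ballI)
  fix s \<xi> assume D: "D \<in> connections M L E" and s: "s \<in> sections M E" and \<xi>: "\<xi> \<in> total L"
  show "D (hom_id \<circ> s) \<xi> = hom_id (D s \<xi>)"
    unfolding restrict_comp_section[OF s] using connection_value[OF D s \<xi>] by (simp add: o_def mem_fibre_iff)
qed

lemma intertwines_compose:
  assumes \<phi>: "intertwines L D D' \<phi>" and \<psi>: "intertwines L D' D'' \<psi>" "\<psi> \<in> bundle_hom M E E"
    and D'': "D'' \<in> connections M L E"
  shows "intertwines L D D'' (restrict (\<lambda>e. \<phi> (\<psi> e)) (total E))"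
  unfolding intertwines_def
proof (intro ballI)
  fix s \<xi> assume s: "s \<in> sections M E" and \<xi>: "\<xi> \<in> total L"
  have "D (restrict (\<lambda>e. \<phi> (\<psi> e)) (total E) \<circ> s) \<xi> = D (\<phi> \<circ> (\<psi> \<circ> s)) \<xi>"
    unfolding restrict_comp_section[OF s] by (simp add: o_def)
  also have "\<dots> = \<phi> (\<psi> (D'' s \<xi>))"
    using \<phi> \<psi>(1) s \<xi> sections_map[OF \<psi>(2) s] by (simp add: intertwines_def)
  finally show "D (restrict (\<lambda>e. \<phi> (\<psi> e)) (total E) \<circ> s) \<xi> = restrict (\<lambda>e. \<phi> (\<psi> e)) (total E) (D'' s \<xi>)"
    using connection_value[OF D'' s \<xi>] by (simp add: mem_fibre_iff)
qed

lemma intertwines_inverse: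
  assumes \<phi>: "\<phi> \<in> Gau M E" "intertwines L D D' \<phi>" and D': "D' \<in> connections M L E" and D: "D \<in> connections M L E"
  shows "intertwines L D' D (restrict (inv_into (total E) \<phi>) (total E))"
  unfolding intertwines_def
proof (intro ballI)
  let ?v = "restrict (inv_into (total E) \<phi>) (total E)"
  fix s \<xi> assume s: "s \<in> sections M E" and \<xi>: "\<xi> \<in> total L"
  have v: "?v \<in> bundle_hom M E E" and bij: "bij_betw \<phi> (total E) (total E)"
    using \<phi>(1) by (simp_all add: Gau_def)
  note vs = sections_map[OF v s]
  have "\<phi> \<circ> (?v \<circ> s) = s"
    using section_fibre[OF s] bij_betw_inv_into_right[OF bij] by (simp add: fun_eq_iff mem_fibre_iff)
  then have "D s \<xi> = \<phi> (D' (?v \<circ> s) \<xi>)"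
    using \<phi>(2) vs \<xi> by (metis intertwines_def)
  moreover have "D' (?v \<circ> s) \<xi> \<in> total E" "D s \<xi> \<in> total E"
    using connection_value[OF D' vs \<xi>] connection_value[OF D s \<xi>] by (simp_all add: mem_fibre_iff)
  ultimately show "D' (?v \<circ> s) \<xi> = ?v (D s \<xi>)"
    using bij_betw_inv_into_left[OF bij] by simp
qed

lemma intertwines_lincomb:
  assumes D: "D \<in> connections M L E" and D': "D' \<in> connections M L E"
    and F: "F \<in> bundle_hom M E E" "intertwines L D D' F"
    and G: "G \<in> bundle_hom M E E" "intertwines L D D' G"
  shows "intertwines L D D' (hom_lincomb a F b G)"
  unfolding intertwines_def
proof (intro ballI)
  fix s \<xi> assume s: "s \<in> sections M E" and \<xi>: "\<xi> \<in> total L"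
  note Fs = sections_map[OF F(1) s] and Gs = sections_map[OF G(1) s]
  have add: "D (sec_add E s t) = form_add L E (D s) (D t)"
    if "s \<in> sections M E" "t \<in> sections M E" for s t
    using D that by (simp add: connections_def)
  have scale: "D (sec_scale E (\<lambda>x. c) s) = form_scale L E (\<lambda>x. c) (D s)"
    if "s \<in> sections M E" for c s
    using D that by (simp add: connections_def)
  have "hom_lincomb a F b G \<circ> s =
      sec_add E (sec_scale E (\<lambda>x. a) (F \<circ> s)) (sec_scale E (\<lambda>x. b) (G \<circ> s))"
    using section_fibre[OF s] by (auto simp: hom_lincomb_def sec_add_def sec_scale_def fun_eq_iff mem_fibre_iff)
  then have "D (hom_lincomb a F b G \<circ> s) \<xi> = vadd E (vscale E a (D (F \<circ> s) \<xi>)) (vscale E b (D (G \<circ> s) \<xi>))"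
    using \<xi> by (simp add: add scale sections_scale Fs Gs form_add_def form_scale_def)
  also have "\<dots> = hom_lincomb a F b G (D' s \<xi>)"
    using F(2) G(2) s \<xi> connection_value[OF D' s \<xi>] by (simp add: intertwines_def hom_lincomb_def mem_fibre_iff)
  finally show "D (hom_lincomb a F b G \<circ> s) \<xi> = hom_lincomb a F b G (D' s \<xi>)" .
qed

end

section \<open>Real connections and conjugation of intertwiners\<close>

context vector_bundle_with_involution
begin

text \<open>Reality as equivariance under conjugation of sections, free of the reference connection;
  this is the form in which it acts on intertwiners.\<close>

definition real_conn ::
  "('l, 'x) lie_algebroid_data \<Rightarrow> ('l \<Rightarrow> 'l) \<Rightarrow> (('x \<Rightarrow> 'e) \<Rightarrow> 'l \<Rightarrow> 'e) \<Rightarrow> bool" where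
  "real_conn L \<sigma>L D \<longleftrightarrow> D \<in> connections M L E \<and>
     (\<forall>s\<in>sections M E. \<forall>\<xi>\<in>total L. D (\<sigma> \<circ> s \<circ> \<sigma>X) \<xi> = \<sigma> (D s (\<sigma>L \<xi>)))"

lemma real_conn_of_real_connections:
  assumes L: "lie_algebroid_real_structure M \<sigma>X L \<sigma>L"
    and D0: "compatible_connection M \<sigma>X L \<sigma>L E \<sigma> D0"
    and D: "D \<in> real_connections M L \<sigma>L E \<sigma> D0"
  shows "real_conn L \<sigma>L D"
proof -
  obtain \<alpha> where DD: "D \<in> connections M L E" and \<alpha>: "\<alpha> \<in> one_forms M L (End_bundle E)"
    "D = connection_plus M L E D0 \<alpha>" "connection_plus M L E D0 (end_form_conj L \<sigma>L E \<sigma> \<alpha>) = D"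
    using D unfolding real_connections_def by auto
  have DD0: "D0 \<in> connections M L E"
    and D0c: "D0 (\<sigma> \<circ> s \<circ> \<sigma>X) = form_conj L \<sigma>L \<sigma> (D0 s)" if "s \<in> sections M E" for s
    using D0 that by (simp_all add: compatible_connection_def)
  have \<sigma>L: "\<sigma>L \<xi> \<in> total L" "bproj L (\<sigma>L \<xi>) = \<sigma>X (bproj L \<xi>)" if "\<xi> \<in> total L" for \<xi>
    using L that unfolding lie_algebroid_real_structure_def real_structure_def antilinear_bundle_map_def
    by (auto simp: Pi_iff)
  have \<alpha>f: "snd (\<alpha> \<xi>) e \<in> fibre E (bproj L \<xi>)" if "\<xi> \<in> total L" "e \<in> fibre E (bproj L \<xi>)" for \<xi> e
  proof -
    have "\<alpha> \<xi> \<in> total (End_bundle E)" "bproj (End_bundle E) (\<alpha> \<xi>) = bproj L \<xi>"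
      using \<alpha>(1) that(1) by (auto simp: one_forms_def bundle_hom_def)
    then have "snd (\<alpha> \<xi>) \<in> fibre_end E (bproj L \<xi>)" by (auto simp: End_bundle_def)
    then show ?thesis using that(2) by (auto simp: fibre_end_def)
  qed
  have "D (\<sigma> \<circ> s \<circ> \<sigma>X) \<xi> = \<sigma> (D s (\<sigma>L \<xi>))" if s: "s \<in> sections M E" and \<xi>: "\<xi> \<in> total L" for s \<xi>
  proof -
    let ?x = "bproj L \<xi>"
    note ss = sections_conj[OF semilinear_sigma smooth_sigma s]
    have sx: "s (\<sigma>X ?x) \<in> fibre E (\<sigma>X ?x)" by (rule section_fibre[OF s])
    have 1: "\<sigma>' (\<sigma> (s (\<sigma>X ?x))) = s (\<sigma>X ?x)" using in_total[OF sx] by simp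
    have sf: "\<sigma> (s (\<sigma>X ?x)) \<in> fibre E ?x" using sigma_fibre(1)[OF sx] by simp
    have v1: "D0 s (\<sigma>L \<xi>) \<in> fibre E (\<sigma>X ?x)" using connection_value[OF DD0 s \<sigma>L(1)[OF \<xi>]] \<sigma>L(2)[OF \<xi>] s by simp
    have v2: "snd (\<alpha> (\<sigma>L \<xi>)) (s (\<sigma>X ?x)) \<in> fibre E (\<sigma>X ?x)"
      using \<alpha>f[OF \<sigma>L(1)[OF \<xi>], of "s (\<sigma>X ?x)"] sx \<sigma>L(2)[OF \<xi>] by simp
    \<comment> \<open>Here \<open>D\<close> is read as \<open>D0\<close> plus the conjugate of
      \<alpha>, at the end as \<open>D0\<close> plus \<alpha>; that both are \<open>D\<close> is its
      reality. The inverse of \<sigma> inside the conjugate form cancels the \<sigma> in the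
      section.\<close>
    have "D (\<sigma> \<circ> s \<circ> \<sigma>X) \<xi> = connection_plus M L E D0 (end_form_conj L \<sigma>L E \<sigma> \<alpha>) (\<sigma> \<circ> s \<circ> \<sigma>X) \<xi>"
      by (simp add: \<alpha>(3))
    also have "\<dots> = vadd E (\<sigma> (D0 s (\<sigma>L \<xi>))) (\<sigma> (snd (\<alpha> (\<sigma>L \<xi>)) (s (\<sigma>X ?x))))"
      using ss \<xi> D0c[OF s] sf 1
      by (simp add: connection_plus_def form_add_def end_form_conj_def form_conj_def)
    also have "\<dots> = \<sigma> (vadd E (D0 s (\<sigma>L \<xi>)) (snd (\<alpha> (\<sigma>L \<xi>)) (s (\<sigma>X ?x))))"
      using semilinearD(2)[OF semilinear_sigma v1 v2] by simp
    also have "\<dots> = \<sigma> (D s (\<sigma>L \<xi>))"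
      using s \<sigma>L[OF \<xi>] by (simp add: \<alpha>(2) connection_plus_def form_add_def)
    finally show ?thesis .
  qed
  then show ?thesis using DD by (simp add: real_conn_def)
qed

text \<open>Equivariance of both connections lets \<sigma> be pulled out of \<open>D\<close> and
  \<open>D'\<close>, which reduces the claim for the conjugate to the equation for \<phi> at a
  conjugated section and at \<open>\<sigma>L \<xi>\<close>.\<close>

lemma intertwines_endo_conj:
  assumes L: "lie_algebroid_real_structure M \<sigma>X L \<sigma>L"
    and D: "real_conn L \<sigma>L D" and D': "real_conn L \<sigma>L D'"
    and \<phi>: "\<phi> \<in> bundle_hom M E E" "intertwines L D D' \<phi>"
  shows "intertwines L D D' (endo_conj E \<sigma> \<phi>)"
  unfolding intertwines_def
proof (intro ballI)
  fix s \<xi> assume s: "s \<in> sections M E" and \<xi>: "\<xi> \<in> total L"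
  have \<sigma>L: "\<sigma>L \<xi> \<in> total L"
    using L \<xi> unfolding lie_algebroid_real_structure_def real_structure_def antilinear_bundle_map_def
    by (auto simp: Pi_iff)
  \<comment> \<open>The section whose conjugate is \<open>s\<close>; it is formed with the inverse
    of \<sigma>, which differs from \<sigma> by a sign in the quaternionic case.\<close>
  define s' where "s' = \<sigma>' \<circ> s \<circ> \<sigma>X"
  have s': "s' \<in> sections M E" unfolding s'_def by (rule sections_conj[OF semilinear_sigma' smooth_sigma' s])
  have st: "s x \<in> total E" for x by (rule in_total[OF section_fibre[OF s]])
  have eq1: "endo_conj E \<sigma> \<phi> \<circ> s = \<sigma> \<circ> (\<phi> \<circ> s') \<circ> \<sigma>X"
    by (simp add: fun_eq_iff s'_def endo_conj_apply st)
  have eq2: "\<sigma> \<circ> s' \<circ> \<sigma>X = s"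
    by (simp add: fun_eq_iff s'_def st)
  have v: "D' s' (\<sigma>L \<xi>) \<in> total E"
    using D' connection_value[OF _ s' \<sigma>L] by (auto simp: real_conn_def mem_fibre_iff)
  have "D (endo_conj E \<sigma> \<phi> \<circ> s) \<xi> = \<sigma> (D (\<phi> \<circ> s') (\<sigma>L \<xi>))"
    unfolding eq1 using D sections_map[OF \<phi>(1) s'] \<xi> by (simp add: real_conn_def)
  also have "\<dots> = \<sigma> (\<phi> (D' s' (\<sigma>L \<xi>)))"
    using \<phi>(2) s' \<sigma>L by (simp add: intertwines_def)
  also have "\<dots> = endo_conj E \<sigma> \<phi> (\<sigma> (D' s' (\<sigma>L \<xi>)))"
    using v by (simp add: endo_conj_apply sigma_total)
  also have "\<sigma> (D' s' (\<sigma>L \<xi>)) = D' (\<sigma> \<circ> s' \<circ> \<sigma>X) \<xi>"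
    using D' s' \<xi> by (simp add: real_conn_def)
  finally show "D (endo_conj E \<sigma> \<phi> \<circ> s) \<xi> = endo_conj E \<sigma> \<phi> (D' s \<xi>)" unfolding eq2 .
qed

section \<open>Parallel endomorphisms of irreducible connections\<close>

lemma real_parallel_endomorphism_scalar:
  assumes compact: "compact (UNIV :: 'x set)"
    and D: "D \<in> connections M L E" and irr: "irreducible_connection M L E \<sigma> D"
    and u: "u \<in> bundle_hom M E E" "intertwines L D D u" "endo_conj E \<sigma> u = u"
  shows "\<exists>t::real. \<forall>x. \<forall>e\<in>fibre E x. u e = vscale E (of_real t) e"
proof -
  obtain T :: real where T: "hom_lincomb 1 u (of_real T) hom_id \<in> Gau M E" (is "?w \<in> _")
    using ex_invertible_shift[OF u(1) compact] .
  \<comment> \<open>A real multiple of the identity is real and parallel, so the shifted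
    endomorphism lies in the stabilizer that irreducibility describes.\<close>
  have "endo_conj E \<sigma> ?w = ?w" by (simp add: endo_conj_lincomb[OF u(1) hom_id] u(3) endo_conj_id)
  moreover have "gauge_act M L E ?w D = D"
    using gauge_act_eq_iff[OF T D D] intertwines_lincomb[OF D D u(1,2) hom_id intertwines_id[OF D]] by simp
  ultimately have "?w \<in> {\<lambda>e\<in>total E. vscale E (of_real t) e | t. t \<noteq> 0}"
    using irr T unfolding irreducible_connection_def Gau_real_def by blast
  then obtain t where t: "?w = (\<lambda>e\<in>total E. vscale E (of_real t) e)" by blast
  \<comment> \<open>The shift is undone by subtracting \<open>T\<close> in coordinates; the
    resulting scalar may well be 0.\<close>
  have "u e = vscale E (of_real (t - T)) e" if e: "e \<in> fibre E x" for x e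
  proof -
    obtain U \<tau> where c: "(U, \<tau>) \<in> trivs E" "x \<in> U" by (rule triv_cover)
    note ue = hom_fibre[OF u(1) e]
    have "vadd E (vscale E 1 (u e)) (vscale E (of_real T) e) = vscale E (of_real t) e"
      using fun_cong[OF t, of e] in_total[OF e] by (simp add: hom_lincomb_def)
    then have "\<tau> (vadd E (vscale E 1 (u e)) (vscale E (of_real T) e)) = \<tau> (vscale E (of_real t) e)"
      by simp
    then have "\<tau> (u e) i + of_real T * \<tau> e i = of_real t * \<tau> e i" for i
      by (simp add: triv_add[OF c] triv_scale[OF c] fibre_scale e ue fun_eq_iff)
    then have "\<tau> (u e) i = of_real (t - T) * \<tau> e i" for i
      by (simp add: algebra_simps eq_diff_eq)
    then show ?thesis
      by (intro fibre_eqI[OF c ue fibre_scale[OF e]]) (auto simp: triv_scale[OF c e])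
  qed
  then show ?thesis by blast
qed

text \<open>Conjugation is antilinear and swaps \<psi> with its conjugate, so a \<psi> + cnj a
  \<psi>' is real and hence a real scalar. The values a = 1 and a = \<i> determine \<psi>.\<close>

lemma parallel_endomorphism_scalar:
  assumes L: "lie_algebroid_real_structure M \<sigma>X L \<sigma>L"
    and compact: "compact (UNIV :: 'x set)"
    and D: "real_conn L \<sigma>L D" and irr: "irreducible_connection M L E \<sigma> D"
    and \<psi>: "\<psi> \<in> bundle_hom M E E" "intertwines L D D \<psi>"
  shows "\<exists>c. \<forall>x. \<forall>e\<in>fibre E x. \<psi> e = vscale E c e"
proof -
  have DD: "D \<in> connections M L E" using D by (simp add: real_conn_def)
  let ?\<psi>' = "endo_conj E \<sigma> \<psi>"
  note \<psi>' = endo_conj_hom[OF \<psi>(1)] intertwines_endo_conj[OF L D D \<psi>]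
  have comm: "hom_lincomb a F b G = hom_lincomb b G a F"
    if F: "F \<in> bundle_hom M E E" and G: "G \<in> bundle_hom M E E" for a F b G
  proof (rule hom_eqI[OF bundle_hom_lincomb[OF F G] bundle_hom_lincomb[OF G F]])
    fix x e assume e: "e \<in> fibre E x"
    obtain U \<tau> where c: "(U, \<tau>) \<in> trivs E" "x \<in> U" by (rule triv_cover)
    show "hom_lincomb a F b G e = hom_lincomb b G a F e"
      unfolding hom_lincomb_apply[OF e] using hom_fibre[OF F e] hom_fibre[OF G e]
      by (intro fibre_eqI[OF c]) (simp_all add: fibre_add fibre_scale triv_add[OF c] triv_scale[OF c] add.commute)
  qed
  have re: "\<exists>t::real. \<forall>x. \<forall>e\<in>fibre E x. hom_lincomb a \<psi> b ?\<psi>' e = vscale E (of_real t) e"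
    if ab: "cnj a = b" for a b
  proof -
    have ba: "cnj b = a" using ab by auto
    let ?u = "hom_lincomb a \<psi> b ?\<psi>'"
    have conj: "endo_conj E \<sigma> ?u = ?u"
      unfolding endo_conj_lincomb[OF \<psi>(1) \<psi>'(1)] endo_conj_endo_conj[OF \<psi>(1)] ab ba
      by (rule comm[OF \<psi>'(1) \<psi>(1)])
    show ?thesis
      by (rule real_parallel_endomorphism_scalar[OF compact DD irr bundle_hom_lincomb[OF \<psi>(1) \<psi>'(1)]
          intertwines_lincomb[OF DD DD \<psi> \<psi>'] conj])
  qed
  obtain p where p: "\<And>x e. e \<in> fibre E x \<Longrightarrow> hom_lincomb 1 \<psi> 1 ?\<psi>' e = vscale E (of_real p) e"
    using re[of 1 1] by auto
  obtain q where q: "\<And>x e. e \<in> fibre E x \<Longrightarrow> hom_lincomb \<i> \<psi> (-\<i>) ?\<psi>' e = vscale E (of_real q) e"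
    using re[of \<i> "-\<i>"] by auto
  \<comment> \<open>From \<psi> + \<psi>' = p and \<i> (\<psi> - \<psi>') = q one gets 2 \<psi> = p
    - \<i> q.\<close>
  have "\<psi> e = vscale E ((of_real p - \<i> * of_real q) / 2) e" if e: "e \<in> fibre E x" for x e
  proof -
    obtain U \<tau> where c: "(U, \<tau>) \<in> trivs E" "x \<in> U" by (rule triv_cover)
    note f = hom_fibre[OF \<psi>(1) e] hom_fibre[OF \<psi>'(1) e]
    have co: "a * \<tau> (\<psi> e) i + b * \<tau> (?\<psi>' e) i = r * \<tau> e i"
      if "hom_lincomb a \<psi> b ?\<psi>' e = vscale E r e" for a b r i
    proof -
      have "\<tau> (vadd E (vscale E a (\<psi> e)) (vscale E b (?\<psi>' e))) = \<tau> (vscale E r e)"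
        using that by (simp add: hom_lincomb_apply[OF e])
      then show ?thesis
        by (simp add: triv_add[OF c] triv_scale[OF c] fibre_scale e f fun_eq_iff)
    qed
    have "\<tau> (\<psi> e) i = (of_real p - \<i> * of_real q) / 2 * \<tau> e i" for i
    proof -
      have 1: "\<tau> (\<psi> e) i + \<tau> (?\<psi>' e) i = of_real p * \<tau> e i" using co[OF p[OF e], of i] by simp
      have "\<i> * \<tau> (\<psi> e) i + - \<i> * \<tau> (?\<psi>' e) i = of_real q * \<tau> e i" by (rule co[OF q[OF e]])
      then have "-\<i> * (\<i> * \<tau> (\<psi> e) i + - \<i> * \<tau> (?\<psi>' e) i) = -\<i> * (of_real q * \<tau> e i)" by simp
      then have 2: "\<tau> (\<psi> e) i - \<tau> (?\<psi>' e) i = - \<i> * (of_real q * \<tau> e i)"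
        by (simp add: algebra_simps)
      have "2 * \<tau> (\<psi> e) i = (\<tau> (\<psi> e) i + \<tau> (?\<psi>' e) i) + (\<tau> (\<psi> e) i - \<tau> (?\<psi>' e) i)" by simp
      then show ?thesis unfolding 1 2 by (simp add: field_simps)
    qed
    then show ?thesis
      by (intro fibre_eqI[OF c f(1) fibre_scale[OF e]]) (auto simp: triv_scale[OF c e])
  qed
  then show ?thesis by blast
qed

lemma real_gauge_of_gauge:
  assumes L: "lie_algebroid_real_structure M \<sigma>X L \<sigma>L"
    and compact: "compact (UNIV :: 'x set)"
    and D: "real_conn L \<sigma>L D" and D': "real_conn L \<sigma>L D'" and irr: "irreducible_connection M L E \<sigma> D"
    and \<phi>: "\<phi> \<in> Gau M E" "gauge_act M L E \<phi> D = D'"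
  shows "\<exists>\<eta>\<in>Gau_real M E \<sigma>. gauge_act M L E \<eta> D = D'"
proof -
  have DD: "D \<in> connections M L E" and DD': "D' \<in> connections M L E"
    using D D' by (simp_all add: real_conn_def)
  have hom: "\<phi> \<in> bundle_hom M E E" and bij: "bij_betw \<phi> (total E) (total E)"
    and inv: "restrict (inv_into (total E) \<phi>) (total E) \<in> bundle_hom M E E" (is "?v \<in> _")
    using \<phi>(1) by (simp_all add: Gau_def)
  have int: "intertwines L D D' \<phi>" using gauge_act_eq_iff[OF \<phi>(1) DD DD'] \<phi>(2) by simp
  let ?\<phi>' = "endo_conj E \<sigma> \<phi>"
  note hom' = endo_conj_hom[OF hom]
  have int': "intertwines L D D' ?\<phi>'" by (rule intertwines_endo_conj[OF L D D' hom int])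
  \<comment> \<open>The conjugate of \<phi> takes \<open>D\<close> to \<open>D'\<close> and the
    inverse of \<phi> takes \<open>D'\<close> back to \<open>D\<close>, so their product is parallel
    for \<open>D\<close> and equals one scalar on all fibres.\<close>
  obtain \<kappa> where \<kappa>: "\<And>x e. e \<in> fibre E x \<Longrightarrow> restrict (\<lambda>e. ?\<phi>' (?v e)) (total E) e = vscale E \<kappa> e"
    using parallel_endomorphism_scalar[OF L compact D irr bundle_hom_compose[OF hom' inv]
        intertwines_compose[OF int' intertwines_inverse[OF \<phi>(1) int DD' DD] inv DD]] by blast
  have \<phi>': "?\<phi>' e = vscale E \<kappa> (\<phi> e)" if e: "e \<in> fibre E x" for x e
  proof -
    note f = hom_fibre[OF hom e]
    have "?v (\<phi> e) = e" using bij_betw_inv_into_left[OF bij in_total[OF e]] in_total[OF f] by simp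
    then show ?thesis using \<kappa>[OF f] in_total[OF f] by simp
  qed
  \<comment> \<open>Conjugating \<phi>' = \<kappa> \<phi> once more returns \<phi> and produces the
    factor cnj \<kappa> \<kappa>.\<close>
  have norm: "\<phi> e = vscale E (cnj \<kappa> * \<kappa>) (\<phi> e)" if e: "e \<in> fibre E x" for x e
  proof -
    note e1 = sigma_fibre(2)[OF e]
    have "\<phi> e = endo_conj E \<sigma> ?\<phi>' e" by (simp add: endo_conj_endo_conj[OF hom])
    also have "\<dots> = \<sigma> (vscale E \<kappa> (\<phi> (\<sigma>' e)))" by (simp add: endo_conj_apply[OF in_total[OF e]] \<phi>'[OF e1])
    also have "\<dots> = vscale E (cnj \<kappa>) (?\<phi>' e)"
      using semilinearD(3)[OF semilinear_sigma hom_fibre[OF hom e1]] by (simp add: endo_conj_apply[OF in_total[OF e]])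
    also have "\<dots> = vscale E (cnj \<kappa> * \<kappa>) (\<phi> e)" by (simp add: \<phi>'[OF e] vscale_vscale[OF hom_fibre[OF hom e]])
    finally show ?thesis .
  qed
  \<comment> \<open>The left side is the conjugate of \<mu> \<phi> at \<open>e\<close>, so the
    equation says that \<mu> \<phi> is real.\<close>
  have "\<exists>\<mu>. \<mu> \<noteq> 0 \<and> (\<forall>x. \<forall>e\<in>fibre E x. vscale E (cnj \<mu> * \<kappa>) (\<phi> e) = vscale E \<mu> (\<phi> e))"
  proof (cases "cnj \<kappa> * \<kappa> = 1") \<comment> \<open>fails only if \<open>E\<close> has rank \<open>0\<close>\<close>
    case True
    let ?\<mu> = "csqrt \<kappa>"
    have "complex_of_real ((cmod \<kappa>)\<^sup>2) = of_real 1"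
      unfolding complex_norm_square using True by (simp only: mult.commute of_real_1)
    then have "(cmod \<kappa>)\<^sup>2 = 1" by (simp only: of_real_eq_iff)
    then have n: "cmod \<kappa> = 1" using norm_ge_zero[of \<kappa>] by (auto simp: power2_eq_1_iff)
    have "cnj ?\<mu> * ?\<mu> = of_real ((cmod ?\<mu>)\<^sup>2)" unfolding complex_norm_square by (rule mult.commute)
    also have "(cmod ?\<mu>)\<^sup>2 = cmod (?\<mu>\<^sup>2)" by (simp add: norm_power)
    finally have "cnj ?\<mu> * ?\<mu> = 1" using n by simp
    then have "cnj ?\<mu> * \<kappa> = ?\<mu>"
      using power2_csqrt[of \<kappa>] by (metis mult.assoc mult.left_neutral power2_eq_square)
    moreover have "?\<mu> \<noteq> 0" using n by auto
    ultimately show ?thesis by (intro exI[of _ ?\<mu>]) simp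
  next
    case False
    have "\<phi> e = vzero E x" if e: "e \<in> fibre E x" for x e
    proof -
      obtain U \<tau> where c: "(U, \<tau>) \<in> trivs E" "x \<in> U" by (rule triv_cover)
      note f = hom_fibre[OF hom e]
      have "\<tau> (\<phi> e) i = (cnj \<kappa> * \<kappa>) * \<tau> (\<phi> e) i" for i
        using arg_cong[where f = \<tau>, OF norm[OF e]] triv_scale[OF c f] by (metis (no_types, lifting))
      then have "\<tau> (\<phi> e) i = 0" for i using False by (metis mult_cancel_right1)
      then show ?thesis by (intro fibre_eqI[OF c f fibre_zero]) (auto simp: triv_zero[OF c])
    qed
    \<comment> \<open>With \<phi> = 0 both sides are zero vectors, so any nonzero \<mu> would serve;
      1 is taken.\<close>
    then have "vscale E (cnj 1 * \<kappa>) (\<phi> e) = vscale E 1 (\<phi> e)" if e: "e \<in> fibre E x" for x e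
      using hom_fibre[OF hom fibre_scale[OF e]] hom_scale[OF hom e] that fibre_scale[OF e] by metis
    then show ?thesis by (intro exI[of _ 1]) auto
  qed
  then obtain \<mu> where \<mu>: "\<mu> \<noteq> 0" "\<And>x e. e \<in> fibre E x \<Longrightarrow> vscale E (cnj \<mu> * \<kappa>) (\<phi> e) = vscale E \<mu> (\<phi> e)"
    by blast
  have lincomb0: "hom_lincomb a F 0 F e = vscale E a (F e)"
    if F: "F \<in> bundle_hom M E E" and e: "e \<in> fibre E x" for a F x e
  proof -
    obtain U \<tau> where c: "(U, \<tau>) \<in> trivs E" "x \<in> U" by (rule triv_cover)
    show ?thesis
      unfolding hom_lincomb_apply[OF e] using hom_fibre[OF F e]
      by (intro fibre_eqI[OF c]) (simp_all add: fibre_add fibre_scale triv_add[OF c] triv_scale[OF c])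
  qed
  \<comment> \<open>The multiple \<mu> \<phi>, written as a combination with second coefficient 0 so
    that the lemmas on combinations apply.\<close>
  let ?\<eta> = "hom_lincomb \<mu> \<phi> 0 \<phi>"
  note \<eta> = bundle_hom_lincomb[OF hom hom, of \<mu> 0]
  have "?\<eta> \<in> Gau M E"
  proof (rule Gau_of_kernel[OF \<eta>])
    fix x e assume e: "e \<in> fibre E x" and z: "?\<eta> e = vzero E x"
    obtain U \<tau> where c: "(U, \<tau>) \<in> trivs E" "x \<in> U" by (rule triv_cover)
    note f = hom_fibre[OF hom e]
    have "\<tau> (vscale E \<mu> (\<phi> e)) = (\<lambda>i. 0)" using z triv_zero[OF c] by (simp add: lincomb0[OF hom e])
    then have "\<tau> (\<phi> e) i = 0" for i using \<mu>(1) by (simp add: triv_scale[OF c f] fun_eq_iff)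
    then have "\<phi> e = vscale E 0 (\<phi> e)"
      by (intro fibre_eqI[OF c f fibre_scale[OF f]]) (auto simp: triv_scale[OF c f])
    then have "\<phi> e = \<phi> (vscale E 0 e)" by (simp add: hom_scale[OF hom e])
    then have "e = vscale E 0 e"
      using bij_betw_imp_inj_on[OF bij] in_total[OF e] in_total[OF fibre_scale[OF e]] by (metis inj_onD)
    then show "e = vzero E x" using vscale_0[OF e] by simp
  qed
  moreover have "endo_conj E \<sigma> ?\<eta> = ?\<eta>"
  proof (rule hom_eqI[OF endo_conj_hom[OF \<eta>] \<eta>])
    fix x e assume e: "e \<in> fibre E x"
    have "endo_conj E \<sigma> ?\<eta> e = vscale E (cnj \<mu>) (?\<phi>' e)"
      by (simp add: endo_conj_lincomb[OF hom hom] lincomb0[OF hom' e])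
    also have "\<dots> = vscale E \<mu> (\<phi> e)"
      by (simp add: \<phi>'[OF e] vscale_vscale[OF hom_fibre[OF hom e]] \<mu>(2)[OF e])
    finally show "endo_conj E \<sigma> ?\<eta> e = ?\<eta> e" by (simp add: lincomb0[OF hom e])
  qed
  ultimately have "?\<eta> \<in> Gau_real M E \<sigma>" "?\<eta> \<in> Gau M E" by (simp_all add: Gau_real_def)
  moreover have "intertwines L D D' ?\<eta>" by (rule intertwines_lincomb[OF DD DD' hom int hom int])
  ultimately show ?thesis using gauge_act_eq_iff[OF _ DD DD'] by blast
qed

end

theorem proposition3p16:
  fixes M :: "'x::{t2_space, second_countable_topology} cmanifold"
    and \<sigma>X :: "'x \<Rightarrow> 'x"
    and L :: "('l, 'x) lie_algebroid_data"
    and \<sigma>L :: "'l \<Rightarrow> 'l"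
    and E :: "('e, 'x) cvbundle"
    and \<sigma>E :: "'e \<Rightarrow> 'e"
    and D0 D D' :: "('x \<Rightarrow> 'e) \<Rightarrow> 'l \<Rightarrow> 'e"
  assumes "complex_manifold M"
    and "compact (UNIV :: 'x set)" and "connected (UNIV :: 'x set)"
    and "manifold_involution M \<sigma>X"
    and "lie_algebroid M L"
    and "lie_algebroid_real_structure M \<sigma>X L \<sigma>L"
    and "smooth_bundle M E"
    and "real_structure M \<sigma>X E \<sigma>E \<or> quaternionic_structure M \<sigma>X E \<sigma>E"
    and "compatible_connection M \<sigma>X L \<sigma>L E \<sigma>E D0"
    and "D \<in> real_connections M L \<sigma>L E \<sigma>E D0"
    and "D' \<in> real_connections M L \<sigma>L E \<sigma>E D0"
    and "irreducible_connection M L E \<sigma>E D"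
    and "irreducible_connection M L E \<sigma>E D'"
  shows "D' \<in> gauge_orbit M L E (Gau M E) D \<longleftrightarrow> D' \<in> gauge_orbit M L E (Gau_real M E \<sigma>E) D"
proof
  interpret smooth_vector_bundle M E using assms(1,7) by unfold_locales
  \<comment> \<open>The two kinds of structure are merged by recording only the sign of the square
    of \<sigma>E.\<close>
  have "\<exists>\<epsilon>. (\<epsilon> = 1 \<or> \<epsilon> = -1) \<and> antilinear_bundle_map M \<sigma>X E \<sigma>E \<and>
      (\<forall>e\<in>total E. \<sigma>E (\<sigma>E e) = vscale E \<epsilon> e)"
    using assms(8)
  proof
    assume "real_structure M \<sigma>X E \<sigma>E"
    then show ?thesis
      using vscale_1 by (intro exI[of _ 1]) (simp add: real_structure_def mem_fibre_iff)
  next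
    assume "quaternionic_structure M \<sigma>X E \<sigma>E"
    then show ?thesis by (intro exI[of _ "-1"]) (simp add: quaternionic_structure_def)
  qed
  then obtain \<epsilon> where \<epsilon>: "\<epsilon> = 1 \<or> \<epsilon> = -1" "antilinear_bundle_map M \<sigma>X E \<sigma>E"
      "\<And>e. e \<in> total E \<Longrightarrow> \<sigma>E (\<sigma>E e) = vscale E \<epsilon> e" by blast
  interpret vector_bundle_with_involution M E \<sigma>X \<sigma>E \<epsilon> using assms(4) \<epsilon> by unfold_locales
  note real = real_conn_of_real_connections[OF assms(6,9)]
  assume "D' \<in> gauge_orbit M L E (Gau M E) D"
  then obtain \<phi> where "\<phi> \<in> Gau M E" "gauge_act M L E \<phi> D = D'"
    unfolding gauge_orbit_def by blast
  from real_gauge_of_gauge[OF assms(6,2) real[OF assms(10)] real[OF assms(11)] assms(12) this]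
  show "D' \<in> gauge_orbit M L E (Gau_real M E \<sigma>E) D"
    unfolding gauge_orbit_def by blast
next
  assume "D' \<in> gauge_orbit M L E (Gau_real M E \<sigma>E) D"
  then show "D' \<in> gauge_orbit M L E (Gau M E) D"
    by (auto simp: gauge_orbit_def Gau_real_def)
qed

end
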